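(* Let $G=(V,E)$ be a weighted graph, with $n=|V|$. For any integer $k\ge1$ and any number $\frac{1}{2k-1}<q<k$, a $\left((2k-1)\cdot\left(1+\frac{2}{q}\right)+\frac{2}{q}\right)$-spanner of $G$ with $O\left(n^{1+1/k}\cdot(1+q)\right)$ edges and lightness $O\left(k\cdot n^{1/k}\cdot q\right)$ can be built in $O(k\cdot n^{2+1/k}\cdot(1+q^2))$ time.
   Context: Graphs are undirected with positive edge weights $\omega$; $dist_H(u,v)$ denotes the weighted shortest-path distance in $H$. For $t\ge1$, a $t$-spanner of $G=(V,E)$ is a subgraph $H=(V,E')$, $E'\subseteq E$, such that $dist_H(u,v)\le t\cdot dist_G(u,v)$ for every edge $(u,v)\in E$. The lightness of $H$ is $\omega(H)/\omega(MST(G))$, where $\omega(H)$ is the total edge weight of $H$ and $\omega(MST(G))$ is the weight of a minimum spanning tree of $G$ ($G$ is assumed connected). *)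

theory Defs
  imports Complex_Main "HOL-Library.Extended_Real"
begin

section \<open>Weighted undirected graphs\<close>

text \<open>A graph is a vertex set \<open>V\<close> with a set \<open>E\<close> of two-element subsets of \<open>V\<close>;
  an edge weighting is a function on edges, of which only the values on \<open>E\<close> matter.\<close>

definition weighted_graph :: "'a set \<Rightarrow> 'a set set \<Rightarrow> ('a set \<Rightarrow> real) \<Rightarrow> bool" where
  "weighted_graph V E \<omega> \<longleftrightarrow>
     finite V \<and> (\<forall>e\<in>E. e \<subseteq> V \<and> card e = 2) \<and> (\<forall>e\<in>E. \<omega> e > 0)"

definition walk :: "'a set \<Rightarrow> 'a set set \<Rightarrow> 'a list \<Rightarrow> bool" where
  "walk V E p \<longleftrightarrow>
     p \<noteq> [] \<and> set p \<subseteq> V \<and> (\<forall>i. Suc i < length p \<longrightarrow> {p ! i, p ! Suc i} \<in> E)"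

definition walk_weight :: "('a set \<Rightarrow> real) \<Rightarrow> 'a list \<Rightarrow> real" where
  "walk_weight \<omega> p = (\<Sum>i<length p - 1. \<omega> {p ! i, p ! Suc i})"

definition walks_between :: "'a set \<Rightarrow> 'a set set \<Rightarrow> 'a \<Rightarrow> 'a \<Rightarrow> 'a list set" where
  "walks_between V E u v = {p. walk V E p \<and> hd p = u \<and> last p = v}"

text \<open>The distance is \<open>\<infinity>\<close> if there is no walk.\<close>

definition graph_dist :: "'a set \<Rightarrow> 'a set set \<Rightarrow> ('a set \<Rightarrow> real) \<Rightarrow> 'a \<Rightarrow> 'a \<Rightarrow> ereal" where
  "graph_dist V E \<omega> u v = (INF p\<in>walks_between V E u v. ereal (walk_weight \<omega> p))"

definition connected_graph :: "'a set \<Rightarrow> 'a set set \<Rightarrow> bool" where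
  "connected_graph V E \<longleftrightarrow> V \<noteq> {} \<and> (\<forall>u\<in>V. \<forall>v\<in>V. walks_between V E u v \<noteq> {})"

definition cycle :: "'a set set \<Rightarrow> 'a list \<Rightarrow> bool" where
  "cycle E p \<longleftrightarrow>
     3 \<le> length p \<and> distinct p \<and> (\<forall>i. Suc i < length p \<longrightarrow> {p ! i, p ! Suc i} \<in> E) \<and>
     {last p, hd p} \<in> E"

definition spanning_tree :: "'a set \<Rightarrow> 'a set set \<Rightarrow> 'a set set \<Rightarrow> bool" where
  "spanning_tree V E T \<longleftrightarrow> T \<subseteq> E \<and> connected_graph V T \<and> (\<nexists>p. cycle T p)"

definition total_weight :: "('a set \<Rightarrow> real) \<Rightarrow> 'a set set \<Rightarrow> real" where
  "total_weight \<omega> E = (\<Sum>e\<in>E. \<omega> e)"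

definition mst_weight :: "'a set \<Rightarrow> 'a set set \<Rightarrow> ('a set \<Rightarrow> real) \<Rightarrow> real" where
  "mst_weight V E \<omega> = Min (total_weight \<omega> ` {T. spanning_tree V E T})"

text \<open>For a single vertex this is \<open>0 / 0 = 0\<close>.\<close>

definition lightness :: "'a set \<Rightarrow> 'a set set \<Rightarrow> ('a set \<Rightarrow> real) \<Rightarrow> 'a set set \<Rightarrow> real" where
  "lightness V E \<omega> H = total_weight \<omega> H / mst_weight V E \<omega>"

definition spanner :: "real \<Rightarrow> 'a set \<Rightarrow> 'a set set \<Rightarrow> ('a set \<Rightarrow> real) \<Rightarrow> 'a set set \<Rightarrow> bool" where
  "spanner t V E \<omega> H \<longleftrightarrow>
     t \<ge> 1 \<and> H \<subseteq> E \<and>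
     (\<forall>u v. {u, v} \<in> E \<longrightarrow> graph_dist V H \<omega> u v \<le> ereal t * graph_dist V E \<omega> u v)"


section \<open>A real random access machine\<close>

text \<open>
  Running time is measured on a real RAM, presented as a structured language.  The memory
  consists of finitely many (those a program mentions) named variables and arrays, holding
  natural numbers or exact reals.  Array indices are arbitrary natural numbers.

  The operations are chosen so that unit cost cannot be abused.  Natural numbers are only added,
  subtracted (truncated at 0) and compared, so there is no multiplication, division or bit
  operation producing or dissecting very long integers.  Reals admit field operations (with
  \<open>x / 0 = 0\<close>) and comparison, and naturals can be converted to reals, but there is neither a
  conversion from reals to naturals (such as rounding) nor a real constant in a program.
\<close>

type_synonym name = string

datatype nexp =
    NConst nat
  | NVar name
  | NGet name nexp
  | NAdd nexp nexp
  | NSub nexp nexp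

datatype rexp =
    RNat nexp
  | RVar name
  | RGet name nexp
  | RAdd rexp rexp
  | RSub rexp rexp
  | RMul rexp rexp
  | RDiv rexp rexp

datatype bexp =
    NLess nexp nexp
  | RLess rexp rexp
  | BNot bexp
  | BAnd bexp bexp

datatype com =
    Skip
  | NAssign name nexp
  | RAssign name rexp
  | NStore name nexp nexp
  | RStore name nexp rexp
  | Seq com com
  | Cond bexp com com
  | While bexp com

record state =
  nvar :: "name \<Rightarrow> nat"
  rvar :: "name \<Rightarrow> real"
  narr :: "name \<Rightarrow> nat \<Rightarrow> nat"
  rarr :: "name \<Rightarrow> nat \<Rightarrow> real"

primrec nval :: "nexp \<Rightarrow> state \<Rightarrow> nat" where
  "nval (NConst c) s = c"
| "nval (NVar x) s = nvar s x"
| "nval (NGet a i) s = narr s a (nval i s)"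
| "nval (NAdd x y) s = nval x s + nval y s"
| "nval (NSub x y) s = nval x s - nval y s"

primrec rval :: "rexp \<Rightarrow> state \<Rightarrow> real" where
  "rval (RNat x) s = real (nval x s)"
| "rval (RVar x) s = rvar s x"
| "rval (RGet a i) s = rarr s a (nval i s)"
| "rval (RAdd x y) s = rval x s + rval y s"
| "rval (RSub x y) s = rval x s - rval y s"
| "rval (RMul x y) s = rval x s * rval y s"
| "rval (RDiv x y) s = rval x s / rval y s"

primrec bval :: "bexp \<Rightarrow> state \<Rightarrow> bool" where
  "bval (NLess x y) s \<longleftrightarrow> nval x s < nval y s"
| "bval (RLess x y) s \<longleftrightarrow> rval x s < rval y s"
| "bval (BNot b) s \<longleftrightarrow> \<not> bval b s"
| "bval (BAnd b c) s \<longleftrightarrow> bval b s \<and> bval c s"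

text \<open>
  \<open>exec c s T s'\<close>: started in \<open>s\<close>, the program \<open>c\<close> terminates in \<open>s'\<close> after \<open>T\<close> steps.
  Every assignment, test and \<open>Skip\<close> counts as one step.  Charging instead for each operation inside
  an expression would change the time of a program only by a constant factor, the size of its
  largest expression.
\<close>

inductive exec :: "com \<Rightarrow> state \<Rightarrow> nat \<Rightarrow> state \<Rightarrow> bool" where
  Skip: "exec Skip s 1 s"
| NAssign: "exec (NAssign x e) s 1 (s\<lparr>nvar := (nvar s)(x := nval e s)\<rparr>)"
| RAssign: "exec (RAssign x e) s 1 (s\<lparr>rvar := (rvar s)(x := rval e s)\<rparr>)"
| NStore: "exec (NStore a i e) s 1
             (s\<lparr>narr := (narr s)(a := (narr s a)(nval i s := nval e s))\<rparr>)"
| RStore: "exec (RStore a i e) s 1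
             (s\<lparr>rarr := (rarr s)(a := (rarr s a)(nval i s := rval e s))\<rparr>)"
| Seq: "exec c1 s T1 s1 \<Longrightarrow> exec c2 s1 T2 s2 \<Longrightarrow> exec (Seq c1 c2) s (T1 + T2) s2"
| CondTrue: "bval b s \<Longrightarrow> exec c1 s T s1 \<Longrightarrow> exec (Cond b c1 c2) s (Suc T) s1"
| CondFalse: "\<not> bval b s \<Longrightarrow> exec c2 s T s1 \<Longrightarrow> exec (Cond b c1 c2) s (Suc T) s1"
| WhileFalse: "\<not> bval b s \<Longrightarrow> exec (While b c) s 1 s"
| WhileTrue: "bval b s \<Longrightarrow> exec c s T1 s1 \<Longrightarrow> exec (While b c) s1 T2 s2 \<Longrightarrow>
    exec (While b c) s (Suc (T1 + T2)) s2"

inductive_cases exec_SkipE: "exec Skip s T s'"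
inductive_cases exec_NAssignE: "exec (NAssign x e) s T s'"
inductive_cases exec_RAssignE: "exec (RAssign x e) s T s'"
inductive_cases exec_NStoreE: "exec (NStore a i e) s T s'"
inductive_cases exec_RStoreE: "exec (RStore a i e) s T s'"
inductive_cases exec_SeqE: "exec (Seq c1 c2) s T s'"
inductive_cases exec_CondE: "exec (Cond b c1 c2) s T s'"
inductive_cases exec_WhileE: "exec (While b c) s T s'"

lemma exec_deterministic:
  "exec c s T s' \<Longrightarrow> exec c s T' s'' \<Longrightarrow> T' = T \<and> s'' = s'"
proof (induction arbitrary: T' s'' rule: exec.induct)
  case (Seq c1 s T1 s1 c2 T2 s2)
  then show ?case by (metis exec_SeqE)
next
  case (CondTrue b s c1 T s1 c2)
  then show ?case by (metis exec_CondE)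
next
  case (CondFalse b s c2 T s1 c1)
  then show ?case by (metis exec_CondE)
next
  case (WhileTrue b s c T1 s1 T2 s2)
  from WhileTrue.prems WhileTrue.hyps obtain T1' t1 T2' where
    "T' = Suc (T1' + T2')" "exec c s T1' t1" "exec (While b c) t1 T2' s''"
    by (auto elim: exec_WhileE)
  with WhileTrue.IH show ?case by metis
qed (auto elim: exec_SkipE exec_NAssignE exec_RAssignE exec_NStoreE exec_RStoreE exec_WhileE)

text \<open>
  The vertices of an input graph are \<open>0, \<dots>, n - 1\<close>.  Its edges are presented by a list that
  contains each edge exactly once, in an arbitrary order and orientation.  All memory not
  occupied by the input is initially 0.
\<close>

definition edge :: "nat \<times> nat \<Rightarrow> nat set" where
  "edge e = {fst e, snd e}"

definition lists_edges :: "(nat \<times> nat) list \<Rightarrow> nat set set \<Rightarrow> bool" where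
  "lists_edges es E \<longleftrightarrow> distinct (map edge es) \<and> set (map edge es) = E"

definition input_state ::
  "nat \<Rightarrow> (nat \<times> nat) list \<Rightarrow> (nat set \<Rightarrow> real) \<Rightarrow> nat \<Rightarrow> real \<Rightarrow> state" where
  "input_state n es \<omega> k q = \<lparr>
     nvar = (\<lambda>_. 0)(''n'' := n, ''m'' := length es, ''k'' := k),
     rvar = (\<lambda>_. 0)(''q'' := q),
     narr = (\<lambda>_ _. 0)(''src'' := \<lambda>i. if i < length es then fst (es ! i) else 0,
                      ''dst'' := \<lambda>i. if i < length es then snd (es ! i) else 0),
     rarr = (\<lambda>_ _. 0)(''wgt'' := \<lambda>i. if i < length es then \<omega> (edge (es ! i)) else 0)\<rparr>"

definition output_edges :: "state \<Rightarrow> nat set set" where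
  "output_edges s =
     (\<lambda>i. {narr s ''out_src'' i, narr s ''out_dst'' i}) ` {..<nvar s ''out_m''}"

end

theory Submission
  imports Defs "HOL-Library.Multiset"
begin

text \<open>
  The edges are sorted, and Kruskal's algorithm computes a minimum spanning tree, of weight \<open>M\<close>,
  together with a closed tour of length \<open>2M\<close> through all vertices: when two components are joined by
  an edge \<open>{u, v}\<close>, exchanging the tour successors of \<open>u\<close> and \<open>v\<close> merges their tours at an extra cost
  of twice the weight of the edge.

  Scale \<open>i\<close> treats the edges of weight at most \<open>w\<^sub>i = 2\<^sup>i \<sqdot> 2qM/n\<close> not treated before.  The tour is cut
  into at most \<open>2n/2\<^sup>i\<close> clusters of diameter at most \<open>D\<^sub>i = (2/q) w\<^bsub>i-1\<^esub>\<close> (singletons, \<open>D\<^sub>0 = 0\<close>, for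
  \<open>i = 0\<close>).  An edge is kept unless at most \<open>2k - 1\<close> edges kept at this scale already join the clusters
  of its ends.  A rejected edge of weight \<open>w\<close> is thus bypassed at cost at most
  \<open>(2k - 1) w + 2k D\<^sub>i \<le> ((2k - 1)(1 + 2/q) + 2/q) w\<close>, and the kept edges form a graph without cycles of
  length at most \<open>2k\<close> on \<open>N\<close> clusters, which has \<open>O(N\<^bsup>1+1/k\<^esup>)\<close> edges by the Moore bound.  The number of
  kept edges decreases geometrically with \<open>i\<close>; their total weight is
  \<open>\<Sum>\<^sub>i w\<^sub>i O((n/2\<^sup>i)\<^bsup>1+1/k\<^esup>) = q M n\<^bsup>1/k\<^esup> \<Sum>\<^sub>i O(2\<^bsup>-i/k\<^esup>) = O(k q n\<^bsup>1/k\<^esup> M)\<close>.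

  Within a scale all hop distances, truncated at \<open>2k\<close>, are maintained under edge insertions.  Whenever the
  distance of a pair \<open>(r, v)\<close> decreases, the neighbours of \<open>v\<close> are scanned; this happens at most
  \<open>2k\<close> times per pair, so all insertions together take time \<open>O(k N (N + N\<^bsup>1+1/k\<^esup>))\<close>.
\<close>

subsection \<open>Weakest preconditions with a clock\<close>

text \<open>The obstacle is time. Deciding each of up to \<open>n * n\<close> edges by a fresh
  search in a graph with about \<open>n powr (1 + 1 / k)\<close> edges would be too slow by a factor
  of about \<open>n / k\<close>. The maintained table decides an edge by one lookup, and its upkeep
  is paid for by a potential instead of by the edges. The closed tour, not the tree, is cut into
  clusters: its successive pieces of length above \<open>D\<close> are disjoint, which bounds their
  number by \<open>2 * M / D\<close>, plus one for the last piece. The first threshold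
  \<open>2 * q * M / n\<close> is small enough that the light edges kept with singleton clusters
  weigh \<open>O(q * M * n powr (1 / k))\<close> in total. The scales stop once \<open>D\<close>
  reaches \<open>2 * M\<close>. An edge still untreated then weighs at least
  \<open>q * D / 2\<close>, and the tree alone bypasses it at cost \<open>2 * M\<close>, at most
  \<open>2 / q\<close> times its weight. While the loop runs, \<open>D < 2 * M\<close> forces
  \<open>2 ^ i < n\<close> for every \<open>i > 0\<close>, so the number of scales is bounded
  without computing a logarithm. The machine neither multiplies naturals nor rounds reals.
  Thresholds therefore arise by doubling and row offsets by repeated addition.\<close>

definition wp :: "com \<Rightarrow> (nat \<Rightarrow> state \<Rightarrow> bool) \<Rightarrow> nat \<Rightarrow> state \<Rightarrow> bool" where
  "wp c Q t s \<longleftrightarrow> (\<exists>T s'. exec c s T s' \<and> Q (t + T) s')"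

lemma wp_Skip [simp]: "wp Skip Q t s \<longleftrightarrow> Q (Suc t) s"
  unfolding wp_def by (metis Suc_eq_plus1 exec.Skip exec_SkipE)

lemma wp_NAssign [simp]:
  "wp (NAssign x e) Q t s \<longleftrightarrow> Q (Suc t) (s\<lparr>nvar := (nvar s)(x := nval e s)\<rparr>)"
  unfolding wp_def by (metis Suc_eq_plus1 exec.NAssign exec_NAssignE)

lemma wp_RAssign [simp]:
  "wp (RAssign x e) Q t s \<longleftrightarrow> Q (Suc t) (s\<lparr>rvar := (rvar s)(x := rval e s)\<rparr>)"
  unfolding wp_def by (metis Suc_eq_plus1 exec.RAssign exec_RAssignE)

lemma wp_NStore [simp]:
  "wp (NStore a i e) Q t s \<longleftrightarrow>
     Q (Suc t) (s\<lparr>narr := (narr s)(a := (narr s a)(nval i s := nval e s))\<rparr>)"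
  unfolding wp_def by (metis Suc_eq_plus1 exec.NStore exec_NStoreE)

lemma wp_RStore [simp]:
  "wp (RStore a i e) Q t s \<longleftrightarrow>
     Q (Suc t) (s\<lparr>rarr := (rarr s)(a := (rarr s a)(nval i s := rval e s))\<rparr>)"
  unfolding wp_def by (metis Suc_eq_plus1 exec.RStore exec_RStoreE)

text \<open>The clock is an argument of \<open>wp\<close> and postconditions read absolute time, so
  sequential composition is plain composition of predicate transformers. The existence of a run
  makes this total correctness.\<close>

lemma wp_Seq [simp]: "wp (Seq c1 c2) Q = wp c1 (wp c2 Q)"
proof (intro ext)
  show "wp (Seq c1 c2) Q t s \<longleftrightarrow> wp c1 (wp c2 Q) t s" for t s
    unfolding wp_def by (fastforce intro: exec.Seq elim!: exec_SeqE simp: add.assoc)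
qed

lemma wp_Cond [simp]:
  "wp (Cond b c1 c2) Q t s \<longleftrightarrow> (if bval b s then wp c1 Q (Suc t) s else wp c2 Q (Suc t) s)"
proof
  assume "wp (Cond b c1 c2) Q t s"
  then obtain T s' where "exec (Cond b c1 c2) s T s'" "Q (t + T) s'" unfolding wp_def by blast
  then show "if bval b s then wp c1 Q (Suc t) s else wp c2 Q (Suc t) s"
    by (auto simp: wp_def elim!: exec_CondE; blast)
next
  assume "if bval b s then wp c1 Q (Suc t) s else wp c2 Q (Suc t) s"
  then show "wp (Cond b c1 c2) Q t s"
    unfolding wp_def by (metis add_Suc_shift exec.CondFalse exec.CondTrue)
qed

section \<open>Frame conditions: memory that a program leaves alone\<close>

primrec nvars_of :: "com \<Rightarrow> name set" where
  "nvars_of Skip = {}"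
| "nvars_of (NAssign x e) = {x}"
| "nvars_of (RAssign x e) = {}"
| "nvars_of (NStore a i e) = {}"
| "nvars_of (RStore a i e) = {}"
| "nvars_of (Seq c1 c2) = nvars_of c1 \<union> nvars_of c2"
| "nvars_of (Cond b c1 c2) = nvars_of c1 \<union> nvars_of c2"
| "nvars_of (While b c) = nvars_of c"

primrec rvars_of :: "com \<Rightarrow> name set" where
  "rvars_of Skip = {}"
| "rvars_of (NAssign x e) = {}"
| "rvars_of (RAssign x e) = {x}"
| "rvars_of (NStore a i e) = {}"
| "rvars_of (RStore a i e) = {}"
| "rvars_of (Seq c1 c2) = rvars_of c1 \<union> rvars_of c2"
| "rvars_of (Cond b c1 c2) = rvars_of c1 \<union> rvars_of c2"
| "rvars_of (While b c) = rvars_of c"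

primrec narrs_of :: "com \<Rightarrow> name set" where
  "narrs_of Skip = {}"
| "narrs_of (NAssign x e) = {}"
| "narrs_of (RAssign x e) = {}"
| "narrs_of (NStore a i e) = {a}"
| "narrs_of (RStore a i e) = {}"
| "narrs_of (Seq c1 c2) = narrs_of c1 \<union> narrs_of c2"
| "narrs_of (Cond b c1 c2) = narrs_of c1 \<union> narrs_of c2"
| "narrs_of (While b c) = narrs_of c"

primrec rarrs_of :: "com \<Rightarrow> name set" where
  "rarrs_of Skip = {}"
| "rarrs_of (NAssign x e) = {}"
| "rarrs_of (RAssign x e) = {}"
| "rarrs_of (NStore a i e) = {}"
| "rarrs_of (RStore a i e) = {a}"
| "rarrs_of (Seq c1 c2) = rarrs_of c1 \<union> rarrs_of c2"
| "rarrs_of (Cond b c1 c2) = rarrs_of c1 \<union> rarrs_of c2"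
| "rarrs_of (While b c) = rarrs_of c"

text \<open>With this frame a specification lists only what changes; all other facts about the
  memory are recovered through \<open>wp_consequence\<close> and the loop rules.\<close>

definition same :: "com \<Rightarrow> state \<Rightarrow> state \<Rightarrow> bool" where
  "same c s s' \<longleftrightarrow>
     (\<forall>x. x \<notin> nvars_of c \<longrightarrow> nvar s' x = nvar s x) \<and>
     (\<forall>x. x \<notin> rvars_of c \<longrightarrow> rvar s' x = rvar s x) \<and>
     (\<forall>x. x \<notin> narrs_of c \<longrightarrow> narr s' x = narr s x) \<and>
     (\<forall>x. x \<notin> rarrs_of c \<longrightarrow> rarr s' x = rarr s x)"

lemma same_refl: "same c s s"
  by (simp add: same_def)

lemma same_trans: "same c s s' \<Longrightarrow> same c s' s'' \<Longrightarrow> same c s s''"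
  by (simp add: same_def)

lemma exec_same: "exec c s T s' \<Longrightarrow> same c s s'"
  by (induction rule: exec.induct) (auto simp: same_def)

lemma wp_consequence:
  assumes "wp c P t s"
    and "\<And>t' s'. P t' s' \<Longrightarrow> same c s s' \<Longrightarrow> Q t' s'"
  shows "wp c Q t s"
  using assms unfolding wp_def by (blast dest: exec_same)

text \<open>Every iteration takes time, so an upper bound on the clock guarantees termination.\<close>

lemma wp_While:
  assumes init: "I t s"
    and step: "\<And>t s'. I t s' \<Longrightarrow> same (While b c) s s' \<Longrightarrow> bval b s' \<Longrightarrow>
        t \<le> B \<and> wp c I (Suc t) s'"
    and final: "\<And>t s'. I t s' \<Longrightarrow> same (While b c) s s' \<Longrightarrow> \<not> bval b s' \<Longrightarrow> Q (Suc t) s'"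
  shows "wp (While b c) Q t s"
proof -
  have "wp (While b c) Q u s'" if "I u s'" "same (While b c) s s'" for u s'
    using that
  proof (induction "Suc B - u" arbitrary: u s' rule: less_induct)
    case less
    show ?case
    proof (cases "bval b s'")
      case False
      with less.prems final show ?thesis
        unfolding wp_def by (metis Suc_eq_plus1 exec.WhileFalse)
    next
      case True
      from step[OF less.prems True] obtain T s1 where
        B: "u \<le> B" and e: "exec c s' T s1" and I: "I (Suc u + T) s1"
        unfolding wp_def by blast
      from e have "same c s' s1" by (rule exec_same)
      then have "same (While b c) s' s1" by (simp add: same_def)
      with less.prems have "same (While b c) s s1" by (blast intro: same_trans)
      with less.hyps[of "Suc u + T" s1] B I have "wp (While b c) Q (Suc u + T) s1" by simp
      then obtain T' s2 where "exec (While b c) s1 T' s2" "Q (Suc u + T + T') s2"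
        unfolding wp_def by blast
      with e True show ?thesis
        unfolding wp_def
        by (intro exI[of _ "Suc (T + T')"] exI[of _ s2]) (auto intro: exec.WhileTrue simp: add.assoc)
    qed
  qed
  with init show ?thesis by (blast intro: same_refl)
qed

section \<open>Counted loops\<close>

definition For :: "name \<Rightarrow> nexp \<Rightarrow> com \<Rightarrow> com" where
  "For x e c = Seq (NAssign x (NConst 0))
     (While (NLess (NVar x) e) (Seq c (NAssign x (NAdd (NVar x) (NConst 1)))))"

lemma mods_For [simp]:
  "nvars_of (For x e c) = insert x (nvars_of c)" "rvars_of (For x e c) = rvars_of c"
  "narrs_of (For x e c) = narrs_of c" "rarrs_of (For x e c) = rarrs_of c"
  by (auto simp: For_def)

text \<open>The counter is an argument \<open>i\<close> of the invariant, and \<open>indep\<close>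
  makes the invariant blind to the variable itself, so the body is verified without its increment.
  \<open>Suc t\<close> charges the loop test, \<open>Suc t'\<close> the increment. The limit
  \<open>e\<close> is evaluated again in every round, hence the hypothesis
  \<open>bound\<close>.\<close>

lemma wp_For:
  assumes x: "x \<notin> nvars_of c"
    and indep: "\<And>i t s v. I i t (s\<lparr>nvar := (nvar s)(x := v)\<rparr>) = I i t s"
    and bound: "\<And>s'. same (For x e c) s s' \<Longrightarrow> nval e s' = N"
    and init: "I 0 (Suc t) s"
    and step: "\<And>i t s'. i < N \<Longrightarrow> nvar s' x = i \<Longrightarrow> I i t s' \<Longrightarrow> same (For x e c) s s' \<Longrightarrow>
        t \<le> B \<and> wp c (\<lambda>t' s''. I (Suc i) (Suc t') s'') (Suc t) s'"
    and final: "\<And>t s'. I N t s' \<Longrightarrow> same (For x e c) s s' \<Longrightarrow> Q (Suc t) s'"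
  shows "wp (For x e c) Q t s"
proof -
  let ?s = "s\<lparr>nvar := (nvar s)(x := 0)\<rparr>"
  let ?c = "Seq c (NAssign x (NAdd (NVar x) (NConst 1)))"
  have tr: "same (For x e c) s s'" if "same (While (NLess (NVar x) e) ?c) ?s s'" for s'
    using that by (auto simp: same_def)
  have "wp (While (NLess (NVar x) e) ?c) Q (Suc t) ?s"
  proof (rule wp_While[where I = "\<lambda>t s. nvar s x \<le> N \<and> I (nvar s x) t s" and B = B])
    show "nvar ?s x \<le> N \<and> I (nvar ?s x) (Suc t) ?s"
      using init by (simp add: indep)
  next
    fix u s'
    assume I: "nvar s' x \<le> N \<and> I (nvar s' x) u s'"
      and s: "same (While (NLess (NVar x) e) ?c) ?s s'"
      and b: "bval (NLess (NVar x) e) s'"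
    from b bound[OF tr[OF s]] have "nvar s' x < N" by simp
    from step[OF this refl _ tr[OF s]] I
    have *: "u \<le> B" "wp c (\<lambda>t' s''. I (Suc (nvar s' x)) (Suc t') s'') (Suc u) s'" by auto
    from *(2) have "wp c (wp (NAssign x (NAdd (NVar x) (NConst 1)))
        (\<lambda>t s. nvar s x \<le> N \<and> I (nvar s x) t s)) (Suc u) s'"
    proof (rule wp_consequence)
      fix t' s''
      assume "I (Suc (nvar s' x)) (Suc t') s''" "same c s' s''"
      with x \<open>nvar s' x < N\<close> show "wp (NAssign x (NAdd (NVar x) (NConst 1)))
        (\<lambda>t s. nvar s x \<le> N \<and> I (nvar s x) t s) t' s''"
        by (simp add: indep same_def)
    qed
    with * show "u \<le> B \<and> wp ?c (\<lambda>t s. nvar s x \<le> N \<and> I (nvar s x) t s) (Suc u) s'"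
      by simp
  next
    fix u s'
    assume I: "nvar s' x \<le> N \<and> I (nvar s' x) u s'"
      and s: "same (While (NLess (NVar x) e) ?c) ?s s'"
      and b: "\<not> bval (NLess (NVar x) e) s'"
    from b bound[OF tr[OF s]] I have "nvar s' x = N" by simp
    with final[OF _ tr[OF s]] I show "Q (Suc u) s'" by simp
  qed
  then show ?thesis by (simp add: For_def)
qed

subsection \<open>Graphs without short cycles\<close>

text \<open>Walks of exactly \<open>j\<close> hops are pairs in \<open>adj_rel G ^^ j\<close>, so
  hop distances are treated without lists of vertices.\<close>

definition adj_rel :: "'a set set \<Rightarrow> ('a \<times> 'a) set" where
  "adj_rel G = {(x, y). {x, y} \<in> G}"

lemma adj_rel_iff [simp]: "(x, y) \<in> adj_rel G \<longleftrightarrow> {x, y} \<in> G"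
  by (simp add: adj_rel_def)

lemma adj_rel_mono: "G \<subseteq> H \<Longrightarrow> adj_rel G \<subseteq> adj_rel H"
  by (auto simp: adj_rel_def)

lemma adj_rel_converse: "(adj_rel G)\<inverse> = adj_rel G"
  by (auto simp: insert_commute)

lemma relpow_adj_rel_sym: "(x, y) \<in> adj_rel G ^^ j \<Longrightarrow> (y, x) \<in> adj_rel G ^^ j"
proof (induction j arbitrary: y)
  case (Suc j)
  from Suc.prems obtain z where z: "(x, z) \<in> adj_rel G ^^ j" "{z, y} \<in> G" by auto
  from Suc.IH[OF z(1)] z(2) show ?case by (intro relpow_Suc_I2[of y z]) (auto simp: insert_commute)
qed simp

lemma rtrancl_adj_rel_sym: "(x, y) \<in> (adj_rel G)\<^sup>* \<Longrightarrow> (y, x) \<in> (adj_rel G)\<^sup>*"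
  by (metis adj_rel_converse converse_iff rtrancl_converse)

lemma relpow_mono': "(x, y) \<in> R ^^ j \<Longrightarrow> R \<subseteq> S \<Longrightarrow> (x, y) \<in> S ^^ j"
  for R S :: "('a \<times> 'a) set"
  by (induction j arbitrary: y) auto

lemma relpow_trans: "(x, y) \<in> R ^^ i \<Longrightarrow> (y, z) \<in> R ^^ j \<Longrightarrow> (x, z) \<in> R ^^ (i + j)"
  for R :: "('a \<times> 'a) set"
  by (auto simp: relpow_add)

text \<open>A walk that uses the new edge is cut at its first entry into and its last exit from that
  edge. What lies between is dropped, so the two remaining pieces avoid the edge and are together
  only shorter, whence the inequality in place of an equation.\<close>

lemma relpow_insert_edge:
  fixes R :: "('a \<times> 'a) set"
  assumes "(x, y) \<in> (R \<union> {(a, b), (b, a)}) ^^ j"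
  shows "(\<exists>j'\<le>j. (x, y) \<in> R ^^ j') \<or>
    (\<exists>i l. i + l + 1 \<le> j \<and>
       ((x, a) \<in> R ^^ i \<and> (b, y) \<in> R ^^ l \<or> (x, b) \<in> R ^^ i \<and> (a, y) \<in> R ^^ l))"
  using assms
proof (induction j arbitrary: x)
  case 0
  then show ?case by auto
next
  case (Suc j)
  from Suc.prems obtain z where xz: "(x, z) \<in> R \<union> {(a, b), (b, a)}"
    and zy: "(z, y) \<in> (R \<union> {(a, b), (b, a)}) ^^ j"
    by (meson relpow_Suc_D2)
  have pre: "(x, c) \<in> R ^^ Suc i" if "(x, z) \<in> R" "(z, c) \<in> R ^^ i" for c i
    using that by (meson relpow_Suc_I2)
  have z: "(c, c) \<in> R ^^ 0" for c by simp
  consider (R) "(x, z) \<in> R" | (ab) "x = a" "z = b" | (ba) "x = b" "z = a" using xz by blast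
  then show ?case
  proof cases
    case R
    from Suc.IH[OF zy] show ?thesis
    proof (elim disjE exE conjE)
      fix j' assume "j' \<le> j" "(z, y) \<in> R ^^ j'"
      with pre[OF R] show ?thesis by (meson Suc_le_mono)
    next
      fix i l assume "i + l + 1 \<le> j" "(z, a) \<in> R ^^ i" "(b, y) \<in> R ^^ l"
      with pre[OF R] have "Suc i + l + 1 \<le> Suc j" "(x, a) \<in> R ^^ Suc i" "(b, y) \<in> R ^^ l" by auto
      then show ?thesis by blast
    next
      fix i l assume "i + l + 1 \<le> j" "(z, b) \<in> R ^^ i" "(a, y) \<in> R ^^ l"
      with pre[OF R] have "Suc i + l + 1 \<le> Suc j" "(x, b) \<in> R ^^ Suc i" "(a, y) \<in> R ^^ l" by auto
      then show ?thesis by blast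
    qed
  next
    case ab
    from Suc.IH[OF zy] show ?thesis
    proof (elim disjE exE conjE)
      fix j' assume "j' \<le> j" "(z, y) \<in> R ^^ j'"
      with ab have "0 + j' + 1 \<le> Suc j" "(x, a) \<in> R ^^ 0" "(b, y) \<in> R ^^ j'" by auto
      then show ?thesis by blast
    next
      fix i l assume "i + l + 1 \<le> j" "(b, y) \<in> R ^^ l"
      with ab have "0 + l + 1 \<le> Suc j" "(x, a) \<in> R ^^ 0" "(b, y) \<in> R ^^ l" by auto
      then show ?thesis by blast
    next
      fix i l assume "i + l + 1 \<le> j" "(a, y) \<in> R ^^ l"
      with ab have "l \<le> Suc j" "(x, y) \<in> R ^^ l" by auto
      then show ?thesis by blast
    qed
  next
    case ba
    from Suc.IH[OF zy] show ?thesis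
    proof (elim disjE exE conjE)
      fix j' assume "j' \<le> j" "(z, y) \<in> R ^^ j'"
      with ba have "0 + j' + 1 \<le> Suc j" "(x, b) \<in> R ^^ 0" "(a, y) \<in> R ^^ j'" by auto
      then show ?thesis by blast
    next
      fix i l assume "i + l + 1 \<le> j" "(b, y) \<in> R ^^ l"
      with ba have "l \<le> Suc j" "(x, y) \<in> R ^^ l" by auto
      then show ?thesis by blast
    next
      fix i l assume "i + l + 1 \<le> j" "(a, y) \<in> R ^^ l"
      with ba have "0 + l + 1 \<le> Suc j" "(x, b) \<in> R ^^ 0" "(a, y) \<in> R ^^ l" by auto
      then show ?thesis by blast
    qed
  qed
qed

text \<open>This is girth above \<open>2 * k\<close>, expressed without cycles: a cycle of length
  \<open>j + 1\<close> through an edge is a walk of \<open>j\<close> hops around it. The form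
  matches the test of the algorithm.\<close>

definition high_girth :: "nat \<Rightarrow> 'a set set \<Rightarrow> bool" where
  "high_girth k G \<longleftrightarrow>
     (\<forall>x y. {x, y} \<in> G \<longrightarrow> (\<forall>j<2 * k. (x, y) \<notin> adj_rel (G - {{x, y}}) ^^ j))"

lemma high_girth_empty: "high_girth k {}"
  by (simp add: high_girth_def)

lemma high_girth_subset: "high_girth k G \<Longrightarrow> H \<subseteq> G \<Longrightarrow> high_girth k H"
  unfolding high_girth_def
  by (meson Diff_mono adj_rel_mono order_refl relpow_mono' subsetD)

text \<open>A short bypass of an old edge \<open>{x, y}\<close> must run through
  \<open>{a, b}\<close>. Its two pieces, joined by \<open>{x, y}\<close> itself, form a walk from
  \<open>a\<close> to \<open>b\<close> in the old graph that is no longer, contradicting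
  \<open>ab\<close>.\<close>

lemma high_girth_insert:
  assumes G: "high_girth k G" and ab: "\<And>j. j < 2 * k \<Longrightarrow> (a, b) \<notin> adj_rel G ^^ j"
  shows "high_girth k (insert {a, b} G)"
  unfolding high_girth_def
proof (intro allI impI notI)
  fix x y j
  assume xy: "{x, y} \<in> insert {a, b} G" and j: "j < 2 * k"
    and walk: "(x, y) \<in> adj_rel (insert {a, b} G - {{x, y}}) ^^ j"
  show False
  proof (cases "{x, y} = {a, b}")
    case True
    then have "insert {a, b} G - {{x, y}} \<subseteq> G" by auto
    with walk have "(x, y) \<in> adj_rel G ^^ j" by (meson adj_rel_mono relpow_mono')
    with True ab[OF j] show False by (metis doubleton_eq_iff relpow_adj_rel_sym)
  next
    case False
    let ?R = "adj_rel (G - {{x, y}})"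
    from False xy have xyG: "{x, y} \<in> G" by simp
    have "adj_rel (insert {a, b} G - {{x, y}}) \<subseteq> ?R \<union> {(a, b), (b, a)}"
      by (auto simp: doubleton_eq_iff)
    with walk have "(x, y) \<in> (?R \<union> {(a, b), (b, a)}) ^^ j" by (rule relpow_mono')
    note * = relpow_insert_edge[OF this]
    have up: "(c, d) \<in> adj_rel G ^^ i" if "(c, d) \<in> ?R ^^ i" for c d i
      using that by (meson Diff_subset adj_rel_mono relpow_mono')
    from xyG have e1: "(x, y) \<in> adj_rel G ^^ 1" "(y, x) \<in> adj_rel G ^^ 1"
      by (auto simp: insert_commute)
    from * show False
    proof (elim disjE exE conjE)
      fix j' assume "j' \<le> j" "(x, y) \<in> ?R ^^ j'"
      with G xyG j show False by (auto simp: high_girth_def)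
    next
      fix i l assume il: "i + l + 1 \<le> j" "(x, a) \<in> ?R ^^ i" "(b, y) \<in> ?R ^^ l"
      then have "(a, b) \<in> adj_rel G ^^ (i + (1 + l))"
        by (intro relpow_trans[of a x] relpow_trans[of x y] e1) (auto intro: up relpow_adj_rel_sym)
      with ab[of "i + (1 + l)"] il j show False by simp
    next
      fix i l assume il: "i + l + 1 \<le> j" "(x, b) \<in> ?R ^^ i" "(a, y) \<in> ?R ^^ l"
      then have "(a, b) \<in> adj_rel G ^^ (l + (1 + i))"
        by (intro relpow_trans[of a y] relpow_trans[of y x] e1) (auto intro: up)
      with ab[of "l + (1 + i)"] il j show False by simp
    qed
  qed
qed

section \<open>The Moore bound for graphs without short cycles\<close>

definition nbrs :: "'a set set \<Rightarrow> 'a \<Rightarrow> 'a set" where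
  "nbrs G x = {y. {x, y} \<in> G}"

definition simple_on :: "'a set \<Rightarrow> 'a set set \<Rightarrow> bool" where
  "simple_on X G \<longleftrightarrow> (\<forall>e\<in>G. e \<subseteq> X \<and> card e = 2)"

lemma simple_on_subset: "simple_on X G \<Longrightarrow> H \<subseteq> G \<Longrightarrow> simple_on X H"
  by (auto simp: simple_on_def)

lemma simple_on_edge: "simple_on X G \<Longrightarrow> {x, y} \<in> G \<Longrightarrow> x \<in> X \<and> y \<in> X \<and> x \<noteq> y"
  by (fastforce simp: simple_on_def)

lemma simple_on_finite: "finite X \<Longrightarrow> simple_on X G \<Longrightarrow> finite G"
  by (rule finite_subset[of _ "Pow X"]) (auto simp: simple_on_def)

lemma nbrs_subset: "simple_on X G \<Longrightarrow> nbrs G x \<subseteq> X - {x}"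
  by (auto simp: nbrs_def dest: simple_on_edge)

text \<open>Deleting a vertex of degree at most \<open>D\<close> loses at most \<open>D\<close>
  edges and lowers \<open>D * card X\<close> by \<open>D\<close>, so the strict inequality survives.
  It fails on the empty vertex set, hence the deletions stop at a nonempty graph. Isolated vertices
  are exempted because a subgraph is only a set of edges here.\<close>

lemma min_degree_subgraph:
  assumes "finite X" "simple_on X G" "D * card X < card G"
  shows "\<exists>H\<subseteq>G. H \<noteq> {} \<and> (\<forall>x. nbrs H x \<noteq> {} \<longrightarrow> D < card (nbrs H x))"
  using assms
proof (induction "card X" arbitrary: X G)
  case 0
  then have "X = {}" by simp
  with 0 have "e \<notin> G" for e by (auto simp: simple_on_def)
  then have "G = {}" by blast
  with 0 show ?case by simp
next
  case (Suc c)
  show ?case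
  proof (cases "\<forall>x. nbrs G x \<noteq> {} \<longrightarrow> D < card (nbrs G x)")
    case True
    with Suc.prems show ?thesis by (intro exI[of _ G]) auto
  next
    case False
    then obtain x y where x: "card (nbrs G x) \<le> D" and "y \<in> nbrs G x"
      by (meson equals0I not_le)
    then have xX: "x \<in> X" using simple_on_edge[OF Suc.prems(2), of x y] by (simp add: nbrs_def)
    let ?G = "{e \<in> G. x \<notin> e}"
    have fin: "finite G" "finite (nbrs G x)"
      using simple_on_finite[OF Suc.prems(1,2)] Suc.prems(1)
      by (auto intro: finite_subset[OF nbrs_subset[OF Suc.prems(2)]])
    have "{e \<in> G. x \<in> e} \<subseteq> (\<lambda>y. {x, y}) ` nbrs G x"
    proof
      fix e assume e: "e \<in> {e \<in> G. x \<in> e}"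
      then have "card e = 2" using Suc.prems by (auto simp: simple_on_def)
      then obtain p r where "e = {p, r}" by (meson card_2_iff)
      with e show "e \<in> (\<lambda>y. {x, y}) ` nbrs G x" by (auto simp: nbrs_def insert_commute)
    qed
    then have "card {e \<in> G. x \<in> e} \<le> D"
      using surj_card_le[OF fin(2)] x by fastforce
    moreover have "card G = card ?G + card {e \<in> G. x \<in> e}"
      using fin by (subst card_Un_disjoint[symmetric]) (auto intro: arg_cong[where f = card])
    moreover have "card X = Suc (card (X - {x}))"
      using xX Suc.prems by (metis card.remove)
    then have "D * card X = D * card (X - {x}) + D" by simp
    ultimately have "D * card (X - {x}) < card ?G" using Suc.prems by linarith
    moreover have "simple_on (X - {x}) ?G" using Suc.prems by (auto simp: simple_on_def)
    moreover have "c = card (X - {x})" using Suc.hyps(2) xX Suc.prems by simp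
    ultimately obtain H where "H \<subseteq> ?G" "H \<noteq> {}" "\<forall>x. nbrs H x \<noteq> {} \<longrightarrow> D < card (nbrs H x)"
      using Suc.hyps(1)[of "X - {x}" ?G] Suc.prems by auto
    then show ?thesis by blast
  qed
qed

text \<open>The inner vertices of a shortest path to \<open>z\<close> are at distance less than
  \<open>i \<le> j\<close> from \<open>r\<close>, whereas \<open>x\<close> is at distance at least
  \<open>j\<close>.\<close>

lemma shortest_path_avoids:
  assumes x: "\<And>i. i < j \<Longrightarrow> (r, x) \<notin> adj_rel G ^^ i"
    and "(r, z) \<in> adj_rel G ^^ i" "\<And>i'. i' < i \<Longrightarrow> (r, z) \<notin> adj_rel G ^^ i'" "i \<le> j" "z \<noteq> x"
  shows "(r, z) \<in> adj_rel {e \<in> G. x \<notin> e} ^^ i"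
  using assms(2-)
proof (induction i arbitrary: z)
  case 0
  then show ?case by simp
next
  case (Suc i)
  then obtain y where y: "(r, y) \<in> adj_rel G ^^ i" "{y, z} \<in> G" by auto
  have "(r, y) \<notin> adj_rel G ^^ i'" if "i' < i" for i'
    using that Suc.prems(2)[of "Suc i'"] y(2) by auto
  moreover have "y \<noteq> x" using x[of i] y Suc.prems by auto
  ultimately have "(r, y) \<in> adj_rel {e \<in> G. x \<notin> e} ^^ i" using Suc y by simp
  then show ?case using y \<open>y \<noteq> x\<close> Suc.prems by auto
qed

text \<open>Two such neighbours would be reached from \<open>r\<close> by shortest paths avoiding
  \<open>x\<close>. Going from one to \<open>r\<close> and on to the other and to \<open>x\<close>
  takes at most \<open>2 * j + 1 < 2 * k\<close> hops without the edge from the first to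
  \<open>x\<close>, so this edge would lie on a short cycle.\<close>

lemma one_back_edge:
  assumes G: "high_girth k G" "simple_on X G" and j: "j < k"
    and x: "\<And>i. i < j \<Longrightarrow> (r, x) \<notin> adj_rel G ^^ i"
    and z: "{x, z1} \<in> G" "{x, z2} \<in> G"
    and d: "(r, z1) \<in> adj_rel G ^^ i1" "(r, z2) \<in> adj_rel G ^^ i2" "i1 \<le> j" "i2 \<le> j"
  shows "z1 = z2"
proof (rule ccontr)
  assume ne: "z1 \<noteq> z2"
  have *: "\<exists>i\<le>j. (r, z) \<in> adj_rel {e \<in> G. x \<notin> e} ^^ i"
    if z: "{x, z} \<in> G" and d: "(r, z) \<in> adj_rel G ^^ i" "i \<le> j" for z i
  proof -
    let ?i = "LEAST i. (r, z) \<in> adj_rel G ^^ i"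
    have "(r, z) \<in> adj_rel G ^^ ?i" using d(1) by (rule LeastI)
    moreover have "?i \<le> j" using d by (meson Least_le order_trans)
    moreover have "\<And>i'. i' < ?i \<Longrightarrow> (r, z) \<notin> adj_rel G ^^ i'" by (meson not_less_Least)
    moreover have "z \<noteq> x" using simple_on_edge[OF G(2) z] by blast
    ultimately show ?thesis using shortest_path_avoids[OF x] by blast
  qed
  obtain a b where ab: "(r, z1) \<in> adj_rel {e \<in> G. x \<notin> e} ^^ a" "(r, z2) \<in> adj_rel {e \<in> G. x \<notin> e} ^^ b"
    "a \<le> j" "b \<le> j"
    using *[OF z(1) d(1,3)] *[OF z(2) d(2,4)] by blast
  have sub: "adj_rel {e \<in> G. x \<notin> e} \<subseteq> adj_rel (G - {{z1, x}})" by (auto simp: adj_rel_def)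
  have "(z1, x) \<in> adj_rel (G - {{z1, x}}) ^^ (a + (b + 1))"
  proof (intro relpow_trans)
    show "(z1, r) \<in> adj_rel (G - {{z1, x}}) ^^ a"
      using relpow_adj_rel_sym[OF ab(1)] sub by (rule relpow_mono')
    show "(r, z2) \<in> adj_rel (G - {{z1, x}}) ^^ b" using ab(2) sub by (rule relpow_mono')
    show "(z2, x) \<in> adj_rel (G - {{z1, x}}) ^^ 1"
      using z ne by (auto simp: doubleton_eq_iff insert_commute)
  qed
  moreover have "{z1, x} \<in> G" using z by (simp add: insert_commute)
  moreover have "a + (b + 1) < 2 * k" using ab j by simp
  ultimately show False using G(1) unfolding high_girth_def by blast
qed

text \<open>In a subgraph with degrees above \<open>D\<close>, the breadth-first levels
  \<open>L i\<close> grow by the factor \<open>D\<close> for \<open>k\<close> rounds.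
  \<open>one_back_edge\<close> is used twice: a vertex of level \<open>i\<close> has at most one
  neighbour outside level \<open>i + 1\<close>, and a vertex of level \<open>i + 1\<close> has only
  one neighbour in level \<open>i\<close>, so no vertex is counted twice.\<close>

lemma high_girth_card_le:
  assumes X: "finite X" and G: "simple_on X G" "high_girth k G"
    and k: "1 \<le> k" and D: "card X \<le> D ^ k"
  shows "card G \<le> D * card X"
proof (rule ccontr)
  assume "\<not> ?thesis"
  then obtain H where H: "H \<subseteq> G" "H \<noteq> {}" and deg: "\<And>x. nbrs H x \<noteq> {} \<Longrightarrow> D < card (nbrs H x)"
    using min_degree_subgraph[OF X G(1), of D] by (auto simp: not_le)
  have sH: "simple_on X H" and gH: "high_girth k H"
    using H G simple_on_subset high_girth_subset by blast+
  obtain e where "e \<in> H" using H by blast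
  with sH obtain r r' where r: "{r, r'} \<in> H" by (metis card_2_iff simple_on_def)
  define L where "L i = {y. (r, y) \<in> adj_rel H ^^ i \<and> (\<forall>j<i. (r, y) \<notin> adj_rel H ^^ j)}" for i
  have LX: "L i \<subseteq> X" for i
  proof
    fix y assume "y \<in> L i"
    then show "y \<in> X"
      using simple_on_edge[OF sH] r by (cases i) (auto simp: L_def)
  qed
  then have finL: "finite (L i)" for i using X finite_subset by blast
  have fin: "finite (nbrs H x)" for x using nbrs_subset[OF sH] X by (meson finite_Diff finite_subset)
  have nonempty: "nbrs H y \<noteq> {}" if "y \<in> L i" for y i
    using that r by (cases i) (auto simp: L_def nbrs_def insert_commute)
  have grow: "D * card (L i) \<le> card (L (Suc i))" if i: "i < k" for i
  proof -
    have "D \<le> card (nbrs H x \<inter> L (Suc i))" if x: "x \<in> L i" for x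
    proof -
      have "z1 = z2" if "z1 \<in> nbrs H x - L (Suc i)" "z2 \<in> nbrs H x - L (Suc i)" for z1 z2
      proof -
        have *: "\<exists>j\<le>i. (r, z) \<in> adj_rel H ^^ j" if "z \<in> nbrs H x - L (Suc i)" for z
          using that x by (auto simp: nbrs_def L_def less_Suc_eq_le)
        from *[OF that(1)] *[OF that(2)] obtain j1 j2 where
          "j1 \<le> i" "(r, z1) \<in> adj_rel H ^^ j1" "j2 \<le> i" "(r, z2) \<in> adj_rel H ^^ j2" by blast
        moreover have "\<And>j. j < i \<Longrightarrow> (r, x) \<notin> adj_rel H ^^ j" using x by (simp add: L_def)
        ultimately show ?thesis
          using one_back_edge[OF gH sH i, of r x z1 z2] that by (simp add: nbrs_def)
      qed
      then have "card (nbrs H x - L (Suc i)) \<le> Suc 0"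
        using card_le_Suc0_iff_eq fin by (metis finite_Diff)
      moreover have "D < card (nbrs H x)" using deg nonempty[OF x] by simp
      moreover have "card (nbrs H x) = card (nbrs H x \<inter> L (Suc i)) + card (nbrs H x - L (Suc i))"
        using fin by (rule card_Int_Diff)
      ultimately show ?thesis by linarith
    qed
    then have "D * card (L i) \<le> (\<Sum>x\<in>L i. card (nbrs H x \<inter> L (Suc i)))"
      using sum_bounded_below[of "L i" D] by (simp add: mult.commute)
    also have "\<dots> = card (\<Union>x\<in>L i. nbrs H x \<inter> L (Suc i))"
    proof (rule card_UN_disjoint[symmetric])
      show "\<forall>x\<in>L i. \<forall>y\<in>L i. x \<noteq> y \<longrightarrow> nbrs H x \<inter> L (Suc i) \<inter> (nbrs H y \<inter> L (Suc i)) = {}"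
      proof (intro ballI impI equals0I)
        fix x y z assume xy: "x \<in> L i" "y \<in> L i" "x \<noteq> y"
          and z: "z \<in> nbrs H x \<inter> L (Suc i) \<inter> (nbrs H y \<inter> L (Suc i))"
        have "\<And>j. j < i \<Longrightarrow> (r, z) \<notin> adj_rel H ^^ j" using z by (auto simp: L_def)
        moreover have "{z, x} \<in> H" "{z, y} \<in> H" using z by (auto simp: nbrs_def insert_commute)
        moreover have "(r, x) \<in> adj_rel H ^^ i" "(r, y) \<in> adj_rel H ^^ i" using xy by (auto simp: L_def)
        ultimately show False using one_back_edge[OF gH sH i, of r z x y] xy(3) by blast
      qed
    qed (use finL fin in auto)
    also have "\<dots> \<le> card (L (Suc i))" using finL by (intro card_mono) auto
    finally show ?thesis .
  qed
  have L0: "L 0 = {r}" by (auto simp: L_def)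
  have "D ^ i \<le> card (L i)" if "i \<le> k" for i
    using that
  proof (induction i)
    case (Suc i)
    then have "D * D ^ i \<le> D * card (L i)" by simp
    also have "\<dots> \<le> card (L (Suc i))" using grow Suc.prems by simp
    finally show ?case by simp
  qed (simp add: L0)
  then have "D ^ k \<le> card (L k)" by simp
  \<comment> \<open>The root supplies the one vertex beyond \<open>D ^ k\<close> that turns the
    bound into a contradiction.\<close>
  moreover have "r \<notin> L k" using k by (auto simp: L_def intro!: exI[of _ 0])
  then have "card (insert r (L k)) = Suc (card (L k))" using finL by simp
  moreover have "card (insert r (L k)) \<le> card X"
    using LX[of k] LX[of 0] L0 X by (intro card_mono) auto
  ultimately show False using D by linarith
qed

subsection \<open>Weighted walks\<close>

text \<open>Weighted walks are handled in this list-free form throughout; lists of vertices occur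
  only where the given notions of distance and connectedness are unfolded.\<close>

inductive wreach :: "('a set \<Rightarrow> real) \<Rightarrow> 'a set set \<Rightarrow> 'a \<Rightarrow> 'a \<Rightarrow> real \<Rightarrow> bool" for \<omega> H where
  wreach_refl: "wreach \<omega> H x x 0"
| wreach_step: "{x, y} \<in> H \<Longrightarrow> wreach \<omega> H y z L \<Longrightarrow> wreach \<omega> H x z (\<omega> {x, y} + L)"

lemma wreach_trans: "wreach \<omega> H x y L \<Longrightarrow> wreach \<omega> H y z L' \<Longrightarrow> wreach \<omega> H x z (L + L')"
  by (induction rule: wreach.induct) (auto simp: add.assoc intro: wreach_step)

lemma wreach_edge: "{x, y} \<in> H \<Longrightarrow> wreach \<omega> H x y (\<omega> {x, y})"
  using wreach_step[OF _ wreach_refl] by fastforce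

lemma wreach_sym: "wreach \<omega> H x y L \<Longrightarrow> wreach \<omega> H y x L"
proof (induction rule: wreach.induct)
  case (wreach_step x y z L)
  then have "wreach \<omega> H y x (\<omega> {y, x})" by (intro wreach_edge) (simp add: insert_commute)
  from wreach_trans[OF wreach_step.IH this] show ?case by (simp add: insert_commute add.commute)
qed (rule wreach_refl)

lemma wreach_mono: "wreach \<omega> H x y L \<Longrightarrow> H \<subseteq> H' \<Longrightarrow> wreach \<omega> H' x y L"
  by (induction rule: wreach.induct) (auto intro: wreach.intros)

definition near :: "('a set \<Rightarrow> real) \<Rightarrow> 'a set set \<Rightarrow> 'a \<Rightarrow> 'a \<Rightarrow> real \<Rightarrow> bool" where
  "near \<omega> H x y L \<longleftrightarrow> (\<exists>L'\<le>L. wreach \<omega> H x y L')"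

lemma nearI: "wreach \<omega> H x y L' \<Longrightarrow> L' \<le> L \<Longrightarrow> near \<omega> H x y L"
  by (auto simp: near_def)

lemma nearE:
  assumes "near \<omega> H x y L"
  obtains L' where "L' \<le> L" "wreach \<omega> H x y L'"
  using assms by (auto simp: near_def)

lemma near_refl: "0 \<le> L \<Longrightarrow> near \<omega> H x x L"
  by (rule nearI[OF wreach_refl])

lemma near_trans: "near \<omega> H x y L \<Longrightarrow> near \<omega> H y z L' \<Longrightarrow> near \<omega> H x z (L + L')"
  by (elim nearE) (rule nearI[OF wreach_trans], auto)

lemma near_edge: "{x, y} \<in> H \<Longrightarrow> near \<omega> H x y (\<omega> {x, y})"
  by (rule nearI[OF wreach_edge]) auto

lemma near_sym: "near \<omega> H x y L \<Longrightarrow> near \<omega> H y x L"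
  by (elim nearE) (rule nearI[OF wreach_sym])

lemma near_mono: "near \<omega> H x y L \<Longrightarrow> H \<subseteq> H' \<Longrightarrow> L \<le> L' \<Longrightarrow> near \<omega> H' x y L'"
  by (auto simp: near_def intro: wreach_mono order_trans)

lemma walk_Cons:
  "walk V E (x # y # p) \<longleftrightarrow> x \<in> V \<and> {x, y} \<in> E \<and> walk V E (y # p)"
proof -
  have *: "(\<forall>i. P i) \<longleftrightarrow> P 0 \<and> (\<forall>i. P (Suc i))" for P :: "nat \<Rightarrow> bool"
    by (metis not0_implies_Suc)
  have "(\<forall>i. Suc i < length (x # y # p) \<longrightarrow> {(x # y # p) ! i, (x # y # p) ! Suc i} \<in> E) \<longleftrightarrow>
    {x, y} \<in> E \<and> (\<forall>i. Suc i < length (y # p) \<longrightarrow> {(y # p) ! i, (y # p) ! Suc i} \<in> E)"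
    by (subst *) auto
  then show ?thesis unfolding walk_def by auto
qed

lemma walk_weight_Cons:
  "walk_weight \<omega> (x # y # p) = \<omega> {x, y} + walk_weight \<omega> (y # p)"
  by (simp add: walk_weight_def sum.lessThan_Suc_shift del: sum.lessThan_Suc)

lemma walk_wreach:
  "walk V E p \<Longrightarrow> wreach \<omega> E (hd p) (last p) (walk_weight \<omega> p)"
proof (induction p)
  case (Cons x p)
  show ?case
  proof (cases p)
    case Nil
    then show ?thesis by (simp add: walk_weight_def wreach_refl)
  next
    case (Cons y p')
    with Cons.prems Cons.IH show ?thesis
      by (auto simp: walk_Cons walk_weight_Cons intro!: wreach_step)
  qed
qed (simp add: walk_def)

lemma wreach_walk:
  assumes "wreach \<omega> H x y L" "x \<in> V" "\<And>e. e \<in> H \<Longrightarrow> e \<subseteq> V"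
  shows "\<exists>p\<in>walks_between V H x y. walk_weight \<omega> p = L"
  using assms(1,2)
proof (induction rule: wreach.induct)
  case (wreach_refl x)
  then show ?case
    by (intro bexI[of _ "[x]"]) (auto simp: walks_between_def walk_def walk_weight_def)
next
  case (wreach_step x y z L)
  with assms(3) have "y \<in> V" by blast
  with wreach_step obtain p where p: "walk V H p" "hd p = y" "last p = z" "walk_weight \<omega> p = L"
    by (auto simp: walks_between_def)
  then obtain p' where "p = y # p'" by (metis list.collapse walk_def)
  with p wreach_step show ?case
    by (intro bexI[of _ "x # p"]) (auto simp: walks_between_def walk_Cons walk_weight_Cons)
qed

lemma rtrancl_wreach: "(x, y) \<in> (adj_rel H)\<^sup>* \<Longrightarrow> \<exists>L. wreach \<omega> H x y L"
  by (induction rule: converse_rtrancl_induct) (auto intro: wreach.intros)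

lemma wreach_rtrancl: "wreach \<omega> H x y L \<Longrightarrow> (x, y) \<in> (adj_rel H)\<^sup>*"
  by (induction rule: wreach.induct) (auto intro: converse_rtrancl_into_rtrancl)

lemma connected_graph_iff:
  assumes "\<And>e. e \<in> E \<Longrightarrow> e \<subseteq> V"
  shows "connected_graph V E \<longleftrightarrow> V \<noteq> {} \<and> (\<forall>u\<in>V. \<forall>v\<in>V. (u, v) \<in> (adj_rel E)\<^sup>*)"
proof -
  have "walks_between V E u v \<noteq> {} \<longleftrightarrow> (u, v) \<in> (adj_rel E)\<^sup>*" if "u \<in> V" for u v
  proof
    assume "walks_between V E u v \<noteq> {}"
    then show "(u, v) \<in> (adj_rel E)\<^sup>*"
      by (auto simp: walks_between_def dest!: walk_wreach[where \<omega> = "\<lambda>_. 0"] wreach_rtrancl)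
  next
    assume "(u, v) \<in> (adj_rel E)\<^sup>*"
    then show "walks_between V E u v \<noteq> {}"
      using rtrancl_wreach[of u v E "\<lambda>_. 0"] wreach_walk[OF _ that assms] by blast
  qed
  then show ?thesis by (auto simp: connected_graph_def)
qed

lemma weighted_graphD:
  assumes "weighted_graph V E \<omega>"
  shows "finite V" "finite E" "\<And>e. e \<in> E \<Longrightarrow> e \<subseteq> V" "\<And>e. e \<in> E \<Longrightarrow> card e = 2"
    "\<And>e. e \<in> E \<Longrightarrow> 0 < \<omega> e"
proof -
  show "finite V" using assms by (simp add: weighted_graph_def)
  moreover have "E \<subseteq> Pow V" using assms by (auto simp: weighted_graph_def)
  ultimately show "finite E" by (meson finite_Pow_iff finite_subset)
qed (use assms in \<open>auto simp: weighted_graph_def\<close>)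

text \<open>The hypothesis compares with the weight of an edge, which may exceed the distance of its
  ends. Replacing every edge of an arbitrary walk in \<open>E\<close> by its detour gives the bound
  for the walk, and the infimum over all walks is compared after dividing by
  \<open>t\<close>.\<close>

lemma spannerI:
  assumes G: "weighted_graph V E \<omega>" and H: "H \<subseteq> E" and t: "1 \<le> t"
    and st: "\<And>u v. {u, v} \<in> E \<Longrightarrow> near \<omega> H u v (t * \<omega> {u, v})"
  shows "spanner t V E \<omega> H"
  unfolding spanner_def
proof (intro conjI allI impI H t)
  fix u v assume uv: "{u, v} \<in> E"
  have walks: "near \<omega> H x y (t * L)" if "wreach \<omega> E x y L" for x y L
    using that
  proof (induction rule: wreach.induct)
    case (wreach_step x y z L)
    from near_trans[OF st wreach_step.IH, of x] wreach_step show ?case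
      by (simp add: distrib_left)
  qed (simp add: near_refl)
  have "graph_dist V H \<omega> u v \<le> ereal t * ereal (walk_weight \<omega> p)"
    if p: "p \<in> walks_between V E u v" for p
  proof -
    from p have "wreach \<omega> E u v (walk_weight \<omega> p)"
      using walk_wreach by (auto simp: walks_between_def)
    from walks[OF this] obtain L where L: "L \<le> t * walk_weight \<omega> p" "wreach \<omega> H u v L"
      by (auto simp: near_def)
    have "u \<in> V" using weighted_graphD(3)[OF G uv] by simp
    then obtain p' where p': "p' \<in> walks_between V H u v" "walk_weight \<omega> p' = L"
      using wreach_walk[OF L(2)] H weighted_graphD(3)[OF G] by (meson subsetD)
    from p' L show ?thesis
      unfolding graph_dist_def by (intro INF_lower2[of p']) auto
  qed
  then have "graph_dist V H \<omega> u v / ereal t \<le> ereal (walk_weight \<omega> p)"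
    if "p \<in> walks_between V E u v" for p
    using that t by (subst ereal_divide_le_pos) auto
  then have "graph_dist V H \<omega> u v / ereal t \<le> graph_dist V E \<omega> u v"
    unfolding graph_dist_def[of V E] by (rule INF_greatest)
  then show "graph_dist V H \<omega> u v \<le> ereal t * graph_dist V E \<omega> u v"
    using t by (subst (asm) ereal_divide_le_pos) auto
qed


subsection \<open>Minimum spanning trees\<close>

lemma rtrancl_adj_rel_subst:
  assumes r: "(a, b) \<in> (adj_rel T)\<^sup>*" and H: "H \<subseteq> insert {a, b} T"
  shows "adj_rel H \<subseteq> (adj_rel T)\<^sup>*"
proof
  fix z assume z: "z \<in> adj_rel H"
  obtain x y where xy: "z = (x, y)" by fastforce
  show "z \<in> (adj_rel T)\<^sup>*"
  proof (cases "{x, y} = {a, b}")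
    case True
    with r rtrancl_adj_rel_sym[OF r] show ?thesis by (auto simp: xy doubleton_eq_iff)
  next
    case False
    with z H have "(x, y) \<in> adj_rel T" by (auto simp: xy)
    then show ?thesis unfolding xy by (rule r_into_rtrancl)
  qed
qed

text \<open>A connected edge set of least cardinality has no cycle, since the closing edge of a
  cycle could be dropped. Existence is needed because \<open>mst_weight\<close> is a
  \<open>Min\<close>, which says nothing about an empty set.\<close>

lemma exists_spanning_tree:
  assumes G: "weighted_graph V E \<omega>" and c: "connected_graph V E"
  shows "\<exists>T. spanning_tree V E T"
proof -
  note gD = weighted_graphD[OF G]
  obtain T where T: "T \<subseteq> E" "connected_graph V T"
    and min: "\<And>T'. T' \<subseteq> E \<Longrightarrow> connected_graph V T' \<Longrightarrow> card T \<le> card T'"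
    using ex_has_least_nat[of "\<lambda>T. T \<subseteq> E \<and> connected_graph V T" E card] c by blast
  have ss: "e \<subseteq> V" if "e \<in> T" for e using that T gD(3) by blast
  have "\<not> cycle T p" for p
  proof
    assume "cycle T p"
    then have p: "3 \<le> length p" "distinct p" "\<And>i. Suc i < length p \<Longrightarrow> {p ! i, p ! Suc i} \<in> T"
      "{last p, hd p} \<in> T" by (auto simp: cycle_def)
    let ?e = "{last p, hd p}" and ?T = "T - {{last p, hd p}}"
    from p(1) have "p \<noteq> []" by auto
    then have ends: "hd p = p ! 0" "last p = p ! (length p - 1)"
      by (simp_all add: hd_conv_nth last_conv_nth)
    have "{p ! i, p ! Suc i} \<in> ?T" if "Suc i < length p" for i
    proof -
      have len: "i < length p" "0 < length p" "length p - 1 < length p" using that by auto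
      \<comment> \<open>The closing edge is not an edge of the path itself: the vertices are
        distinct, and there are at least three of them.\<close>
      have "{p ! i, p ! Suc i} \<noteq> ?e"
      proof
        assume "{p ! i, p ! Suc i} = ?e"
        then consider "p ! i = p ! (length p - 1)" | "p ! i = p ! 0" "p ! Suc i = p ! (length p - 1)"
          unfolding ends doubleton_eq_iff by blast
        then show False
        proof cases
          case 1
          then have "i = length p - 1" using nth_eq_iff_index_eq[OF p(2) len(1,3)] by blast
          with that show False by simp
        next
          case 2
          have "i = 0" using 2(1) nth_eq_iff_index_eq[OF p(2) len(1,2)] by blast
          moreover have "Suc i = length p - 1" using 2(2) nth_eq_iff_index_eq[OF p(2) that len(3)] by blast
          ultimately show False using p(1) by simp
        qed
      qed
      with p(3)[OF that] show ?thesis by simp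
    qed
    then have "(p ! 0, p ! i) \<in> (adj_rel ?T)\<^sup>*" if "i < length p" for i
      using that by (induction i) (auto intro: rtrancl_into_rtrancl)
    from this[of "length p - 1"] p(1) have r: "(hd p, last p) \<in> (adj_rel ?T)\<^sup>*"
      by (auto simp: ends)
    have "adj_rel T \<subseteq> (adj_rel ?T)\<^sup>*"
      by (rule rtrancl_adj_rel_subst[OF rtrancl_adj_rel_sym[OF r]]) blast
    then have "(adj_rel T)\<^sup>* \<subseteq> (adj_rel ?T)\<^sup>*" by (rule rtrancl_subset_rtrancl)
    moreover have ss': "e \<subseteq> V" if "e \<in> ?T" for e using that ss by simp
    moreover have "V \<noteq> {} \<and> (\<forall>u\<in>V. \<forall>v\<in>V. (u, v) \<in> (adj_rel T)\<^sup>*)"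
      using T(2) connected_graph_iff[of T V] ss by blast
    ultimately have "connected_graph V ?T"
      using connected_graph_iff[of ?T V] by blast
    with min[of ?T] T have "card T \<le> card ?T" by blast
    moreover have "card ?T < card T"
      using p(4) finite_subset[OF T(1) gD(2)] by (intro card_Diff1_less)
    ultimately show False by simp
  qed
  with T show ?thesis by (auto simp: spanning_tree_def)
qed

lemma mst_weight_attained:
  assumes G: "weighted_graph V E \<omega>" and c: "connected_graph V E"
  obtains T where "T \<subseteq> E" "connected_graph V T" "mst_weight V E \<omega> = total_weight \<omega> T"
proof -
  have "finite {T. spanning_tree V E T}"
    by (rule finite_subset[of _ "Pow E"])
      (use weighted_graphD(2)[OF G] in \<open>auto simp: spanning_tree_def\<close>)
  then have "Min (total_weight \<omega> ` {T. spanning_tree V E T}) \<in> total_weight \<omega> ` {T. spanning_tree V E T}"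
    using exists_spanning_tree[OF assms] by (intro Min_in) auto
  then obtain T where "spanning_tree V E T" "mst_weight V E \<omega> = total_weight \<omega> T"
    by (auto simp: mst_weight_def)
  then show ?thesis using that[of T] by (simp add: spanning_tree_def)
qed

text \<open>The walk is cut at its last departure from \<open>C\<close>. The remainder stays outside
  \<open>C\<close>, so it survives when the crossing edge is removed, which is what the exchange
  argument requires.\<close>

lemma last_exit:
  assumes "(x, v) \<in> R\<^sup>*" "v \<notin> C"
  defines "R' \<equiv> {(p, q). p \<notin> C \<and> q \<notin> C \<and> (p, q) \<in> R}"
  shows "x \<notin> C \<and> (x, v) \<in> R'\<^sup>* \<or> (\<exists>a b. a \<in> C \<and> b \<notin> C \<and> (a, b) \<in> R \<and> (b, v) \<in> R'\<^sup>*)"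
  using assms(1)
proof (induction rule: converse_rtrancl_induct)
  case (step x z)
  show ?case
  proof (cases "z \<notin> C \<and> (z, v) \<in> R'\<^sup>*")
    case True
    show ?thesis
    proof (cases "x \<in> C")
      case False
      with True step(1) have "(x, z) \<in> R'" by (simp add: R'_def)
      with True False show ?thesis by (meson converse_rtrancl_into_rtrancl)
    qed (use True step(1) in blast)
  qed (use step.IH in blast)
qed (use assms(2) in simp)

section \<open>Optimality of Kruskal's algorithm\<close>

primrec kruskal :: "'a set set \<Rightarrow> ('a \<times> 'a) list \<Rightarrow> 'a set set" where
  "kruskal K [] = K"
| "kruskal K (e # es) =
     kruskal (if (fst e, snd e) \<in> (adj_rel K)\<^sup>* then K else insert {fst e, snd e} K) es"

lemma kruskal_append: "kruskal K (es @ es') = kruskal (kruskal K es) es'"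
  by (induction es arbitrary: K) auto

text \<open>The competitor \<open>S\<close> need not be a tree; it only has to contain
  \<open>K\<close>, to draw on \<open>K\<close> and the remaining edges, and to connect the ends of
  the latter. At every edge \<open>S\<close> is replaced by a competitor of no greater weight that
  agrees with the decision taken; once the list is empty, \<open>S = K\<close>.\<close>

lemma kruskal_optimal:
  assumes "sorted (map (\<lambda>e. \<omega> {fst e, snd e}) es)" "\<And>e. e \<in> set es \<Longrightarrow> 0 < \<omega> {fst e, snd e}"
    and "finite S" "K \<subseteq> S" "S \<subseteq> K \<union> (\<lambda>e. {fst e, snd e}) ` set es"
    and "\<And>e. e \<in> set es \<Longrightarrow> (fst e, snd e) \<in> (adj_rel S)\<^sup>*"
  shows "total_weight \<omega> (kruskal K es) \<le> total_weight \<omega> S"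
  using assms
proof (induction es arbitrary: K S)
  case Nil
  then have "S = K" by auto
  then show ?case by simp
next
  case (Cons e es)
  obtain u v where e: "e = (u, v)" by fastforce
  have swap: "total_weight \<omega> (kruskal K' es) \<le> total_weight \<omega> S"
    if "finite S'" "K' \<subseteq> S'" "S' \<subseteq> K' \<union> (\<lambda>e. {fst e, snd e}) ` set es"
      "adj_rel S \<subseteq> (adj_rel S')\<^sup>*" "total_weight \<omega> S' \<le> total_weight \<omega> S" for S' K'
  proof -
    from that(4) have "(adj_rel S)\<^sup>* \<subseteq> (adj_rel S')\<^sup>*" by (rule rtrancl_subset_rtrancl)
    then have "total_weight \<omega> (kruskal K' es) \<le> total_weight \<omega> S'"
      using that Cons.prems by (intro Cons.IH) auto
    with that(5) show ?thesis by simp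
  qed
  show ?case
  proof (cases "(u, v) \<in> (adj_rel K)\<^sup>*")
    case True
    show ?thesis
    proof (cases "{u, v} \<in> S \<and> {u, v} \<notin> K")
      case False
      then have "S \<subseteq> K \<union> (\<lambda>e. {fst e, snd e}) ` set es" using Cons.prems(5) e by auto
      with True swap[of S K] Cons.prems show ?thesis by (auto simp: e)
    next
      case uv: True
      \<comment> \<open>The rejected edge is redundant in \<open>S\<close>, as \<open>K\<close>
        joins its ends. Positivity of its weight makes dropping it harmless.\<close>
      let ?S = "S - {{u, v}}"
      have KS: "K \<subseteq> ?S" using Cons.prems(4) uv by blast
      from True have r: "(u, v) \<in> (adj_rel ?S)\<^sup>*"
        using rtrancl_mono[OF adj_rel_mono[OF KS]] by blast
      have "adj_rel S \<subseteq> (adj_rel ?S)\<^sup>*"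
        by (rule rtrancl_adj_rel_subst[OF r]) blast
      moreover have "total_weight \<omega> S = \<omega> {u, v} + total_weight \<omega> ?S"
        unfolding total_weight_def using uv Cons.prems(3) by (intro sum.remove) auto
      then have "total_weight \<omega> ?S \<le> total_weight \<omega> S" using Cons.prems(2)[of e] e by simp
      ultimately have "total_weight \<omega> (kruskal K es) \<le> total_weight \<omega> S"
        using KS Cons.prems(3,5) e by (intro swap[of ?S]) auto
      with True show ?thesis by (simp add: e)
    qed
  next
    case False
    show ?thesis
    proof (cases "{u, v} \<in> S")
      case True
      then have "total_weight \<omega> (kruskal (insert {u, v} K) es) \<le> total_weight \<omega> S"
        using Cons.prems(3,4,5) e by (intro swap[of S]) auto
      with False show ?thesis by (simp add: e)
    next
      case uvS: False
      let ?C = "{x. (u, x) \<in> (adj_rel K)\<^sup>*}"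
      let ?R' = "{(p, q). p \<notin> ?C \<and> q \<notin> ?C \<and> (p, q) \<in> adj_rel S}"
      have "(u, v) \<in> (adj_rel S)\<^sup>*" using Cons.prems(6)[of e] e by simp
      from last_exit[OF this, of ?C] False obtain a b where
        ab: "(u, a) \<in> (adj_rel K)\<^sup>*" "(u, b) \<notin> (adj_rel K)\<^sup>*" "{a, b} \<in> S" and bv: "(b, v) \<in> ?R'\<^sup>*"
        by auto
      \<comment> \<open>The edge leaves the \<open>K\<close>-component of \<open>u\<close>, so it
        comes from the list; not being \<open>{u, v}\<close>, it comes later and is at least as
        heavy.\<close>
      have abK: "{a, b} \<notin> K" using ab(1,2) by (meson adj_rel_iff rtrancl_into_rtrancl)
      with ab(3) Cons.prems(5) have "{a, b} \<in> (\<lambda>e. {fst e, snd e}) ` set (e # es)" by blast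
      moreover have "{a, b} \<noteq> {u, v}" using ab(3) uvS by auto
      ultimately obtain f where f: "f \<in> set es" "{a, b} = {fst f, snd f}" by (auto simp: e)
      have le: "\<omega> {u, v} \<le> \<omega> {a, b}" using Cons.prems(1) f by (auto simp: e)
      let ?S = "insert {u, v} (S - {{a, b}})"
      have KS: "K \<subseteq> ?S" using Cons.prems(4) abK by blast
      have ua: "(u, a) \<in> (adj_rel ?S)\<^sup>*" using ab(1) rtrancl_mono[OF adj_rel_mono[OF KS]] by blast
      \<comment> \<open>Steps of \<open>?R'\<close> have both ends outside the component, whereas
        \<open>a\<close> lies inside, so none of them is the removed edge.\<close>
      have "?R' \<subseteq> adj_rel ?S" using ab(1) by (auto simp: adj_rel_def doubleton_eq_iff)
      with bv have "(b, v) \<in> (adj_rel ?S)\<^sup>*" using rtrancl_mono by blast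
      moreover have "(u, v) \<in> (adj_rel ?S)\<^sup>*" by auto
      ultimately have r: "(a, b) \<in> (adj_rel ?S)\<^sup>*"
        using ua by (meson rtrancl_adj_rel_sym rtrancl_trans)
      have "adj_rel S \<subseteq> (adj_rel ?S)\<^sup>*"
        by (rule rtrancl_adj_rel_subst[OF r]) blast
      moreover have "total_weight \<omega> S = \<omega> {a, b} + total_weight \<omega> (S - {{a, b}})"
        unfolding total_weight_def using ab Cons.prems(3) by (intro sum.remove) auto
      then have "total_weight \<omega> ?S \<le> total_weight \<omega> S"
        using le uvS Cons.prems(3) by (simp add: total_weight_def)
      ultimately have "total_weight \<omega> (kruskal (insert {u, v} K) es) \<le> total_weight \<omega> S"
        using KS Cons.prems(3,5) by (intro swap[of ?S]) (auto simp: e)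
      with False show ?thesis by (simp add: e)
    qed
  qed
qed

lemma kruskal_le_mst_weight:
  assumes G: "weighted_graph V E \<omega>" and c: "connected_graph V E"
    and es: "lists_edges es E" and sorted: "sorted (map (\<omega> \<circ> edge) es)"
  shows "total_weight \<omega> (kruskal {} es) \<le> mst_weight V E \<omega>"
proof -
  note gD = weighted_graphD[OF G]
  from es have E: "edge ` set es = E" by (simp add: lists_edges_def)
  have ed: "edge = (\<lambda>e. {fst e, snd e})" by (auto simp: edge_def)
  obtain T where T: "T \<subseteq> E" "connected_graph V T" "mst_weight V E \<omega> = total_weight \<omega> T"
    using mst_weight_attained[OF G c] .
  have ss: "e \<subseteq> V" if "e \<in> T" for e using that T gD(3) by blast
  have "total_weight \<omega> (kruskal {} es) \<le> total_weight \<omega> T"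
  proof (rule kruskal_optimal)
    show "sorted (map (\<lambda>e. \<omega> {fst e, snd e}) es)" using sorted by (simp add: ed comp_def)
    show "T \<subseteq> {} \<union> (\<lambda>e. {fst e, snd e}) ` set es" using T(1) E unfolding ed by blast
    show "finite T" using T gD(2) finite_subset by blast
    fix e assume "e \<in> set es"
    then have eE: "{fst e, snd e} \<in> E" using E by (auto simp: edge_def)
    then show "0 < \<omega> {fst e, snd e}" by (rule gD(5))
    from eE have "fst e \<in> V" "snd e \<in> V" using gD(3) by blast+
    then show "(fst e, snd e) \<in> (adj_rel T)\<^sup>*" using T(2) connected_graph_iff[of T V] ss by blast
  qed simp
  then show ?thesis using T(3) by simp
qed

subsection \<open>Merge sort\<close>

abbreviation inc :: "name \<Rightarrow> com" where
  "inc x \<equiv> NAssign x (NAdd (NVar x) (NConst 1))"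

definition merge_step :: com where
  "merge_step =
     Seq (Cond (BAnd (NLess (NVar ''i'') (NVar ''mid''))
            (BNot (BAnd (NLess (NVar ''j'') (NVar ''hi''))
               (RLess (RGet ''wgt'' (NGet ''ord'' (NVar ''j'')))
                      (RGet ''wgt'' (NGet ''ord'' (NVar ''i'')))))))
       (Seq (NStore ''tmp'' (NVar ''o'') (NGet ''ord'' (NVar ''i''))) (inc ''i''))
       (Seq (NStore ''tmp'' (NVar ''o'') (NGet ''ord'' (NVar ''j''))) (inc ''j'')))
     (inc ''o'')"

definition merge_runs :: com where
  "merge_runs =
     Seq (NAssign ''i'' (NVar ''lo'')) (Seq (NAssign ''j'' (NVar ''mid''))
     (Seq (NAssign ''o'' (NVar ''lo'')) (While (NLess (NVar ''o'') (NVar ''hi'')) merge_step)))"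

text \<open>The read positions are \<open>i\<close> and \<open>j\<close>, the write position is
  \<open>p\<close>. The second inequality, every written key is at most every unread key, carries
  sortedness to the next write. The last conjunct protects the runs merged earlier in the same
  pass.\<close>

definition merge_inv ::
  "(nat \<Rightarrow> real) \<Rightarrow> (nat \<Rightarrow> nat) \<Rightarrow> (nat \<Rightarrow> nat) \<Rightarrow> nat \<Rightarrow> nat \<Rightarrow> nat \<Rightarrow>
   nat \<Rightarrow> nat \<Rightarrow> nat \<Rightarrow> (nat \<Rightarrow> nat) \<Rightarrow> bool" where
  "merge_inv key A B0 lo mid hi i j p B \<longleftrightarrow>
     lo \<le> i \<and> i \<le> mid \<and> mid \<le> j \<and> j \<le> hi \<and> p + mid = i + j \<and>
     mset (map B [lo..<p]) = mset (map A [lo..<i]) + mset (map A [mid..<j]) \<and>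
     (\<forall>x y. lo \<le> x \<longrightarrow> x \<le> y \<longrightarrow> y < p \<longrightarrow> key (B x) \<le> key (B y)) \<and>
     (\<forall>x y. lo \<le> x \<longrightarrow> x < p \<longrightarrow> i \<le> y \<and> y < mid \<or> j \<le> y \<and> y < hi \<longrightarrow> key (B x) \<le> key (A y)) \<and>
     (\<forall>x<lo. B x = B0 x)"

lemma map_upd_upt_snoc: "l \<le> p \<Longrightarrow> map (B(p := v)) [l..<Suc p] = map B [l..<p] @ [v]"
  by (auto intro!: map_cong)

lemma merge_inv_step_left:
  assumes I: "merge_inv key A B0 lo mid hi i j p B"
    and sA: "\<And>x y. lo \<le> x \<Longrightarrow> x \<le> y \<Longrightarrow> y < mid \<Longrightarrow> key (A x) \<le> key (A y)"
    and sB: "\<And>x y. mid \<le> x \<Longrightarrow> x \<le> y \<Longrightarrow> y < hi \<Longrightarrow> key (A x) \<le> key (A y)"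
    and i: "i < mid" and le: "j < hi \<Longrightarrow> key (A i) \<le> key (A j)"
  shows "merge_inv key A B0 lo mid hi (Suc i) j (Suc p) (B(p := A i))"
proof -
  note J = I[unfolded merge_inv_def]
  have p: "lo \<le> p" using J by linarith
  have "mset (map (B(p := A i)) [lo..<Suc p]) = mset (map A [lo..<Suc i]) + mset (map A [mid..<j])"
    using J by (subst map_upd_upt_snoc[OF p]) simp
  moreover have "key ((B(p := A i)) x) \<le> key ((B(p := A i)) y)" if "lo \<le> x" "x \<le> y" "y < Suc p" for x y
    using J that i by (cases "y = p"; cases "x = p") auto
  moreover have "key ((B(p := A i)) x) \<le> key (A y)"
    if "lo \<le> x" "x < Suc p" "Suc i \<le> y \<and> y < mid \<or> j \<le> y \<and> y < hi" for x y
  proof (cases "x = p")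
    case True
    have "key (A i) \<le> key (A y)"
    proof (cases "Suc i \<le> y \<and> y < mid")
      case True
      with J sA show ?thesis by simp
    next
      case False
      with that have y: "j \<le> y" "y < hi" by auto
      then have "key (A i) \<le> key (A j)" using le by simp
      also have "\<dots> \<le> key (A y)" using y J sB by simp
      finally show ?thesis .
    qed
    with True show ?thesis by simp
  next
    case False
    with J that show ?thesis by auto
  qed
  ultimately show ?thesis using J i p unfolding merge_inv_def by auto
qed

lemma merge_inv_step_right:
  assumes I: "merge_inv key A B0 lo mid hi i j p B"
    and sA: "\<And>x y. lo \<le> x \<Longrightarrow> x \<le> y \<Longrightarrow> y < mid \<Longrightarrow> key (A x) \<le> key (A y)"
    and sB: "\<And>x y. mid \<le> x \<Longrightarrow> x \<le> y \<Longrightarrow> y < hi \<Longrightarrow> key (A x) \<le> key (A y)"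
    and j: "j < hi" and le: "i < mid \<Longrightarrow> key (A j) \<le> key (A i)"
  shows "merge_inv key A B0 lo mid hi i (Suc j) (Suc p) (B(p := A j))"
proof -
  note J = I[unfolded merge_inv_def]
  have p: "lo \<le> p" using J by linarith
  have "mset (map (B(p := A j)) [lo..<Suc p]) = mset (map A [lo..<i]) + mset (map A [mid..<Suc j])"
    using J by (subst map_upd_upt_snoc[OF p]) simp
  moreover have "key ((B(p := A j)) x) \<le> key ((B(p := A j)) y)" if "lo \<le> x" "x \<le> y" "y < Suc p" for x y
    using J that j by (cases "y = p"; cases "x = p") auto
  moreover have "key ((B(p := A j)) x) \<le> key (A y)"
    if "lo \<le> x" "x < Suc p" "i \<le> y \<and> y < mid \<or> Suc j \<le> y \<and> y < hi" for x y
  proof (cases "x = p")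
    case True
    have "key (A j) \<le> key (A y)"
    proof (cases "Suc j \<le> y \<and> y < hi")
      case True
      with J sB show ?thesis by simp
    next
      case False
      with that have y: "i \<le> y" "y < mid" by auto
      then have "key (A j) \<le> key (A i)" using le by simp
      also have "\<dots> \<le> key (A y)" using y J sA by simp
      finally show ?thesis .
    qed
    with True show ?thesis by simp
  next
    case False
    with J that show ?thesis by auto
  qed
  ultimately show ?thesis using J j p unfolding merge_inv_def by auto
qed

lemma wp_merge_runs:
  fixes s :: state
  defines "lo \<equiv> nvar s ''lo''" and "mid \<equiv> nvar s ''mid''" and "hi \<equiv> nvar s ''hi''"
    and "A \<equiv> narr s ''ord''" and "key \<equiv> rarr s ''wgt''" and "B0 \<equiv> narr s ''tmp''"
  assumes le: "lo \<le> mid" "mid \<le> hi"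
    and sA: "\<And>x y. lo \<le> x \<Longrightarrow> x \<le> y \<Longrightarrow> y < mid \<Longrightarrow> key (A x) \<le> key (A y)"
    and sB: "\<And>x y. mid \<le> x \<Longrightarrow> x \<le> y \<Longrightarrow> y < hi \<Longrightarrow> key (A x) \<le> key (A y)"
  shows "wp merge_runs (\<lambda>t' s'. t' \<le> t + 5 * (hi - lo) + 4 \<and>
    merge_inv key A B0 lo mid hi mid hi hi (narr s' ''tmp'')) t s"
proof -
  \<comment> \<open>One round costs five steps: loop test, conditional and three
    assignments.\<close>
  let ?I = "\<lambda>u s'. u \<le> t + 5 * (nvar s' ''o'' - lo) + 3 \<and> nvar s' ''o'' \<le> hi \<and>
    merge_inv key A B0 lo mid hi (nvar s' ''i'') (nvar s' ''j'') (nvar s' ''o'') (narr s' ''tmp'')"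
  let ?s = "s\<lparr>nvar := (nvar s)(''i'' := lo, ''j'' := mid, ''o'' := lo)\<rparr>"
  have "wp (While (NLess (NVar ''o'') (NVar ''hi'')) merge_step)
    (\<lambda>t' s'. t' \<le> t + 5 * (hi - lo) + 4 \<and>
      merge_inv key A B0 lo mid hi mid hi hi (narr s' ''tmp'')) (t + 3) ?s"
  proof (rule wp_While[where I = ?I and B = "t + 5 * (hi - lo) + 3"], goal_cases)
    case 1
    show ?case using le by (simp add: merge_inv_def B0_def)
  next
    case (2 u s')
    have c: "nvar s' ''mid'' = mid" "nvar s' ''hi'' = hi" "narr s' ''ord'' = A" "rarr s' ''wgt'' = key"
      using 2(2) by (simp_all add: same_def merge_step_def mid_def hi_def A_def key_def)
    let ?i = "nvar s' ''i''" and ?j = "nvar s' ''j''" and ?o = "nvar s' ''o''"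
    have I: "merge_inv key A B0 lo mid hi ?i ?j ?o (narr s' ''tmp'')" using 2(1) by simp
    note J = I[unfolded merge_inv_def]
    have o: "?o < hi" using 2(3) c by simp
    have lo: "lo \<le> ?o" using J by linarith
    have "u \<le> t + 5 * (?o - lo) + 3" using 2(1) by simp
    moreover have "Suc ?o - lo = Suc (?o - lo)" "?o - lo \<le> hi - lo" using o lo by auto
    ultimately have u: "u \<le> t + 5 * (hi - lo) + 3" "Suc (Suc u) \<le> t + 5 * (Suc ?o - lo)" by linarith+
    show ?case
    proof (cases "?i < mid \<and> \<not> (?j < hi \<and> key (A ?j) < key (A ?i))")
      case True
      then have "merge_inv key A B0 lo mid hi (Suc ?i) ?j (Suc ?o) ((narr s' ''tmp'')(?o := A ?i))"
        by (intro merge_inv_step_left[OF I sA sB]) auto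
      with True u o lo show ?thesis by (simp add: merge_step_def c)
    next
      case False
      then have "?j < hi" using J o by auto
      with False have "merge_inv key A B0 lo mid hi ?i (Suc ?j) (Suc ?o) ((narr s' ''tmp'')(?o := A ?j))"
        by (intro merge_inv_step_right[OF I sA sB]) auto
      with False u o lo show ?thesis by (auto simp add: merge_step_def c)
    qed
  next
    case (3 u s')
    have c: "nvar s' ''hi'' = hi" using 3(2) by (simp add: same_def merge_step_def hi_def)
    with 3 have o: "nvar s' ''o'' = hi" by simp
    with 3 have I: "merge_inv key A B0 lo mid hi (nvar s' ''i'') (nvar s' ''j'') hi (narr s' ''tmp'')" by simp
    then have "nvar s' ''i'' = mid" "nvar s' ''j'' = hi" unfolding merge_inv_def by linarith+
    with I 3(1) o show ?case by simp
  qed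
  then show ?thesis by (simp add: merge_runs_def lo_def mid_def hi_def numeral_3_eq_3)
qed

definition set_mid_hi :: com where
  "set_mid_hi =
     Seq (NAssign ''mid'' (NAdd (NVar ''lo'') (NVar ''wd'')))
     (Seq (Cond (NLess (NVar ''m'') (NVar ''mid'')) (NAssign ''mid'' (NVar ''m'')) Skip)
     (Seq (NAssign ''hi'' (NAdd (NVar ''mid'') (NVar ''wd'')))
          (Cond (NLess (NVar ''m'') (NVar ''hi'')) (NAssign ''hi'' (NVar ''m'')) Skip)))"

definition merge_pass :: com where
  "merge_pass =
     Seq (NAssign ''lo'' (NConst 0)) (While (NLess (NVar ''lo'') (NVar ''m''))
       (Seq set_mid_hi (Seq merge_runs (NAssign ''lo'' (NVar ''hi'')))))"

text \<open>The blocks are aligned at multiples of \<open>w\<close>; the last one may be cut off at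
  \<open>m\<close>.\<close>

definition runs_sorted :: "(nat \<Rightarrow> real) \<Rightarrow> nat \<Rightarrow> (nat \<Rightarrow> nat) \<Rightarrow> nat \<Rightarrow> bool" where
  "runs_sorted key w A m \<longleftrightarrow>
     (\<forall>b x y. w * b \<le> x \<longrightarrow> x \<le> y \<longrightarrow> y < w * Suc b \<longrightarrow> y < m \<longrightarrow> key (A x) \<le> key (A y))"

lemma wp_set_mid_hi:
  "wp set_mid_hi (\<lambda>t' s'. t' = t + 6 \<and> nvar s' ''mid'' = min (nvar s ''m'') (nvar s ''lo'' + nvar s ''wd'') \<and>
     nvar s' ''hi'' = min (nvar s ''m'') (min (nvar s ''m'') (nvar s ''lo'' + nvar s ''wd'') + nvar s ''wd'')) t s"
  by (auto simp: set_mid_hi_def min_def)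

lemma runs_sorted_extend:
  assumes R: "runs_sorted key w B0 lo" and lo: "lo = w * b0" and hi: "hi \<le> w * Suc b0"
    and B: "\<And>x. x < lo \<Longrightarrow> B x = B0 x"
    and s: "\<And>x y. lo \<le> x \<Longrightarrow> x \<le> y \<Longrightarrow> y < hi \<Longrightarrow> key (B x) \<le> key (B y)"
  shows "runs_sorted key w B hi"
  unfolding runs_sorted_def
proof (intro allI impI)
  fix b x y assume a: "w * b \<le> x" "x \<le> y" "y < w * Suc b" "y < hi"
  show "key (B x) \<le> key (B y)"
  proof (cases "y < lo")
    case True
    then have "key (B0 x) \<le> key (B0 y)" using R a unfolding runs_sorted_def by blast
    with True B a show ?thesis by simp
  next
    case False
    then have "w * b0 < w * Suc b" "w * b < w * Suc b0" using lo hi a by linarith+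
    then have "b0 = b" by (metis less_Suc_eq_le mult_less_cancel1 order_antisym)
    with s a lo show ?thesis by simp
  qed
qed

lemma mset_map_upt_split:
  "l \<le> i \<Longrightarrow> i \<le> r \<Longrightarrow> mset (map f [l..<r]) = mset (map f [l..<i]) + mset (map f [i..<r])"
  by (metis map_append mset_append upt_add_eq_append le_add_diff_inverse)

lemma wp_merge_pass:
  fixes s :: state
  defines "m \<equiv> nvar s ''m''" and "w \<equiv> nvar s ''wd''"
    and "A \<equiv> narr s ''ord''" and "key \<equiv> rarr s ''wgt''"
  assumes w: "0 < w" and R: "runs_sorted key w A m"
  shows "wp merge_pass (\<lambda>t' s'. t' \<le> t + 17 * m + 2 \<and>
    runs_sorted key (2 * w) (narr s' ''tmp'') m \<and>
    mset (map (narr s' ''tmp'') [0..<m]) = mset (map A [0..<m])) t s"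
proof -
  \<comment> \<open>Merging one pair of runs costs at most \<open>5 * (hi - lo) + 12\<close> steps.
    Since \<open>hi > lo\<close>, this is at most 17 per position.\<close>
  let ?I = "\<lambda>u s'. u \<le> t + 17 * nvar s' ''lo'' + 1 \<and> nvar s' ''lo'' \<le> m \<and>
    (nvar s' ''lo'' = m \<or> (\<exists>b. nvar s' ''lo'' = 2 * w * b)) \<and>
    runs_sorted key (2 * w) (narr s' ''tmp'') (nvar s' ''lo'') \<and>
    mset (map (narr s' ''tmp'') [0..<nvar s' ''lo'']) = mset (map A [0..<nvar s' ''lo''])"
  let ?s = "s\<lparr>nvar := (nvar s)(''lo'' := 0)\<rparr>"
  let ?c = "Seq set_mid_hi (Seq merge_runs (NAssign ''lo'' (NVar ''hi'')))"
  have "wp (While (NLess (NVar ''lo'') (NVar ''m'')) ?c)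
    (\<lambda>t' s'. t' \<le> t + 17 * m + 2 \<and> runs_sorted key (2 * w) (narr s' ''tmp'') m \<and>
    mset (map (narr s' ''tmp'') [0..<m]) = mset (map A [0..<m])) (Suc t) ?s"
  proof (rule wp_While[where I = ?I and B = "t + 17 * m + 1"], goal_cases)
    case 1
    show ?case by (auto simp: runs_sorted_def)
  next
    case (2 u s')
    have c: "nvar s' ''m'' = m" "nvar s' ''wd'' = w" "narr s' ''ord'' = A" "rarr s' ''wgt'' = key"
      using 2(2) by (simp_all add: same_def merge_runs_def merge_step_def set_mid_hi_def
          m_def w_def A_def key_def)
    let ?lo = "nvar s' ''lo''"
    define mid where "mid = min m (?lo + w)"
    define hi where "hi = min m (mid + w)"
    from 2(3) c have lom: "?lo < m" by simp
    with 2(1) obtain b where b: "?lo = 2 * w * b" by auto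
    have ord: "?lo < mid" "mid \<le> hi" "hi \<le> m" using lom w by (auto simp: mid_def hi_def)
    have sA: "key (A x) \<le> key (A y)" if "?lo \<le> x" "x \<le> y" "y < mid" for x y
    proof -
      have "w * (2 * b) \<le> x" "y < w * Suc (2 * b)" "y < m" using that b by (auto simp: mid_def)
      with R that show ?thesis unfolding runs_sorted_def by blast
    qed
    have sB: "key (A x) \<le> key (A y)" if "mid \<le> x" "x \<le> y" "y < hi" for x y
    proof -
      have "y < m" "mid = ?lo + w" using that by (auto simp: hi_def mid_def)
      then have "w * Suc (2 * b) \<le> x" "y < w * Suc (Suc (2 * b))" "y < m"
        using that b by (auto simp: hi_def)
      with R that show ?thesis unfolding runs_sorted_def by blast
    qed
    have step: "?I (Suc t') (s''\<lparr>nvar := (nvar s'')(''lo'' := nvar s'' ''hi'')\<rparr>)"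
      if t': "t' \<le> Suc u + 6 + 5 * (hi - ?lo) + 4" and hi'': "nvar s'' ''hi'' = hi"
        and M: "merge_inv key A (narr s' ''tmp'') ?lo mid hi mid hi hi (narr s'' ''tmp'')" for t' s''
    proof -
      have "u \<le> t + 17 * ?lo + 1" using 2(1) by simp
      with t' ord have "Suc t' \<le> t + 17 * hi + 1" by linarith
      moreover have "hi = m \<or> (\<exists>b. hi = 2 * w * b)"
      proof (cases "hi = m")
        case False
        then have "hi = 2 * w * Suc b" using b by (auto simp: hi_def mid_def min_def split: if_splits)
        then show ?thesis by blast
      qed simp
      moreover have "runs_sorted key (2 * w) (narr s'' ''tmp'') hi"
      proof (rule runs_sorted_extend[where lo = ?lo and ?b0.0 = b and ?B0.0 = "narr s' ''tmp''"])
        show "hi \<le> 2 * w * Suc b" using b by (auto simp: hi_def mid_def)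
      qed (use 2(1) b M in \<open>auto simp: merge_inv_def\<close>)
      moreover have "mset (map (narr s'' ''tmp'') [0..<hi]) = mset (map A [0..<hi])"
      proof -
        have "map (narr s'' ''tmp'') [0..<?lo] = map (narr s' ''tmp'') [0..<?lo]"
          using M by (auto simp: merge_inv_def)
        moreover have "mset (map (narr s'' ''tmp'') [?lo..<hi]) = mset (map A [?lo..<hi])"
          using M ord mset_map_upt_split[of ?lo mid hi A] by (simp add: merge_inv_def)
        moreover have "mset (map (narr s' ''tmp'') [0..<?lo]) = mset (map A [0..<?lo])"
          using 2(1) by blast
        moreover have "mset (map f [0..<hi]) = mset (map f [0..<?lo]) + mset (map f [?lo..<hi])"
          for f :: "nat \<Rightarrow> nat"
          using ord by (intro mset_map_upt_split) auto
        ultimately show ?thesis by metis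
      qed
      ultimately show ?thesis using hi'' ord by simp
    qed
    have "wp set_mid_hi (wp merge_runs (wp (NAssign ''lo'' (NVar ''hi'')) ?I)) (Suc u) s'"
    proof (rule wp_consequence[OF wp_set_mid_hi], goal_cases)
      case (1 t1 s1)
      then have s1: "t1 = Suc u + 6" "nvar s1 ''mid'' = mid" "nvar s1 ''hi'' = hi"
        "nvar s1 ''lo'' = ?lo" "narr s1 ''tmp'' = narr s' ''tmp''" "narr s1 ''ord'' = A"
        "rarr s1 ''wgt'' = key"
        by (simp_all add: c mid_def hi_def same_def set_mid_hi_def)
      show ?case
      proof (rule wp_consequence[OF wp_merge_runs], goal_cases)
        case (5 t2 s2)
        then have "nvar s2 ''hi'' = hi" using s1 by (simp add: same_def merge_runs_def merge_step_def)
        with step[of t2 s2] 5 s1 c show ?case by simp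
      qed (use s1 c ord sA sB in simp_all)
    qed
    moreover have "u \<le> t + 17 * ?lo + 1" using 2(1) by simp
    with lom have "u \<le> t + 17 * m + 1" by linarith
    ultimately show ?case by simp
  next
    case (3 u s')
    have "nvar s' ''m'' = m"
      using 3(2) by (simp add: same_def merge_runs_def merge_step_def set_mid_hi_def m_def)
    with 3 have "nvar s' ''lo'' = m" by simp
    with 3(1) show ?case by simp
  qed
  then show ?thesis by (simp add: merge_pass_def)
qed

text \<open>The sort works bottom-up, as the language has no recursion. The permutation
  \<open>ord\<close> is sorted rather than the edges, so the input arrays stay intact.\<close>

definition merge_sort :: com where
  "merge_sort =
     Seq (For ''i'' (NVar ''m'') (NStore ''ord'' (NVar ''i'') (NVar ''i'')))
     (Seq (NAssign ''wd'' (NConst 1))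
       (While (NLess (NVar ''wd'') (NVar ''m''))
         (Seq merge_pass
         (Seq (For ''i'' (NVar ''m'') (NStore ''ord'' (NVar ''i'') (NGet ''tmp'' (NVar ''i''))))
              (NAssign ''wd'' (NAdd (NVar ''wd'') (NVar ''wd'')))))))"

lemma wp_copy:
  "wp (For ''i'' (NVar ''m'') (NStore ''ord'' (NVar ''i'') (NGet ''tmp'' (NVar ''i''))))
     (\<lambda>t' s'. t' = t + 3 * nvar s ''m'' + 2 \<and> (\<forall>x<nvar s ''m''. narr s' ''ord'' x = narr s ''tmp'' x)) t s"
proof (rule wp_For[where I = "\<lambda>i t' s'. t' = t + 3 * i + 1 \<and>
    (\<forall>x<i. narr s' ''ord'' x = narr s ''tmp'' x)" and N = "nvar s ''m''" and B = "t + 3 * nvar s ''m'' + 1"],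
    goal_cases)
  case (5 i u s')
  then have "narr s' ''tmp'' = narr s ''tmp''" by (simp add: same_def)
  with 5 show ?case by (auto simp: less_Suc_eq)
qed (auto simp: same_def)

lemma wp_init_ord:
  "wp (For ''i'' (NVar ''m'') (NStore ''ord'' (NVar ''i'') (NVar ''i'')))
     (\<lambda>t' s'. t' = t + 3 * nvar s ''m'' + 2 \<and> (\<forall>x<nvar s ''m''. narr s' ''ord'' x = x)) t s"
  by (rule wp_For[where I = "\<lambda>i t' s'. t' = t + 3 * i + 1 \<and>
    (\<forall>x<i. narr s' ''ord'' x = x)" and N = "nvar s ''m''" and B = "t + 3 * nvar s ''m'' + 1"])
    (auto simp: same_def less_Suc_eq)

lemma runs_sorted_cong:
  "(\<And>x. x < m \<Longrightarrow> A x = B x) \<Longrightarrow> runs_sorted key w A m \<longleftrightarrow> runs_sorted key w B m"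
  by (auto simp: runs_sorted_def)

text \<open>The number \<open>p\<close> of passes is certified by \<open>2 ^ (p - 1) < m\<close>,
  which holds because the width before the last pass was below \<open>m\<close>. It becomes a real
  bound only in \<open>log_bound\<close>.\<close>

lemma wp_merge_sort:
  fixes s :: state
  defines "m \<equiv> nvar s ''m''" and "key \<equiv> rarr s ''wgt''"
  shows "wp merge_sort (\<lambda>t' s'.
    (\<exists>p. (p = 0 \<or> 2 ^ (p - 1) < m) \<and> t' \<le> t + 3 * m + 4 + p * (20 * m + 6)) \<and>
    mset (map (narr s' ''ord'') [0..<m]) = mset [0..<m] \<and>
    (\<forall>x y. x \<le> y \<longrightarrow> y < m \<longrightarrow> key (narr s' ''ord'' x) \<le> key (narr s' ''ord'' y))) t s"
proof -
  let ?I = "\<lambda>u s'. \<exists>p. (p = 0 \<or> 2 ^ (p - 1) < m) \<and> nvar s' ''wd'' = 2 ^ p \<and>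
    u \<le> t + 3 * m + 3 + p * (20 * m + 6) \<and> runs_sorted key (2 ^ p) (narr s' ''ord'') m \<and>
    mset (map (narr s' ''ord'') [0..<m]) = mset [0..<m]"
  let ?copy = "For ''i'' (NVar ''m'') (NStore ''ord'' (NVar ''i'') (NGet ''tmp'' (NVar ''i'')))"
  let ?c = "Seq merge_pass (Seq ?copy (NAssign ''wd'' (NAdd (NVar ''wd'') (NVar ''wd''))))"
  let ?Q = "\<lambda>t' s'.
    (\<exists>p. (p = 0 \<or> 2 ^ (p - 1) < m) \<and> t' \<le> t + 3 * m + 4 + p * (20 * m + 6)) \<and>
    mset (map (narr s' ''ord'') [0..<m]) = mset [0..<m] \<and>
    (\<forall>x y. x \<le> y \<longrightarrow> y < m \<longrightarrow> key (narr s' ''ord'' x) \<le> key (narr s' ''ord'' y))"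
  have "wp (While (NLess (NVar ''wd'') (NVar ''m'')) ?c) ?Q t0 s0"
    if t0: "t0 = t + 3 * m + 3" and s0: "nvar s0 ''wd'' = 1" "nvar s0 ''m'' = m" "rarr s0 ''wgt'' = key"
      "\<And>x. x < m \<Longrightarrow> narr s0 ''ord'' x = x" for t0 s0
  proof (rule wp_While[where I = ?I and B = "t + 3 * m + 3 + m * (20 * m + 6)"], goal_cases)
    case 1
    have "map (narr s0 ''ord'') [0..<m] = map id [0..<m]" using s0 by (intro map_cong) auto
    moreover have "runs_sorted key (Suc 0) A m" for A
      unfolding runs_sorted_def by (auto dest: le_antisym)
    ultimately show ?case using t0 s0 by (intro exI[of _ 0]) simp
  next
    case (2 u s')
    have c: "nvar s' ''m'' = m" "rarr s' ''wgt'' = key"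
      using 2(2) s0 by (simp_all add: same_def merge_pass_def merge_runs_def merge_step_def
          set_mid_hi_def m_def key_def)
    from 2(1) obtain p where p: "p = 0 \<or> 2 ^ (p - 1) < m" "nvar s' ''wd'' = 2 ^ p"
      "u \<le> t + 3 * m + 3 + p * (20 * m + 6)" "runs_sorted key (2 ^ p) (narr s' ''ord'') m"
      "mset (map (narr s' ''ord'') [0..<m]) = mset [0..<m]" by blast
    from 2(3) c p have pm: "2 ^ p < m" by simp
    then have "p \<le> m" by (meson less_exp less_imp_le order_trans)
    then have "p * (20 * m + 6) \<le> m * (20 * m + 6)" by (rule mult_le_mono1)
    with p(3) have "u \<le> t + 3 * m + 3 + m * (20 * m + 6)" by linarith
    moreover have "wp merge_pass (wp ?copy (wp (NAssign ''wd'' (NAdd (NVar ''wd'') (NVar ''wd''))) ?I)) (Suc u) s'"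
    proof (rule wp_consequence[OF wp_merge_pass], goal_cases)
      case (3 t1 s1)
      have s1: "nvar s1 ''m'' = m" "nvar s1 ''wd'' = 2 ^ p"
        using 3(2) c p(2) by (simp_all add: same_def merge_pass_def merge_runs_def merge_step_def set_mid_hi_def)
      from 3(1) c p have r: "runs_sorted key (2 * 2 ^ p) (narr s1 ''tmp'') m" "t1 \<le> Suc u + 17 * m + 2"
        "mset (map (narr s1 ''tmp'') [0..<m]) = mset [0..<m]" by simp_all
      show ?case
      proof (rule wp_consequence[OF wp_copy], goal_cases)
        case (1 t2 s2)
        have s2: "nvar s2 ''wd'' = 2 ^ p" "\<And>x. x < m \<Longrightarrow> narr s2 ''ord'' x = narr s1 ''tmp'' x"
          "t2 = t1 + 3 * m + 2" using 1 s1 by (simp_all add: same_def)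
        have "map (narr s2 ''ord'') [0..<m] = map (narr s1 ''tmp'') [0..<m]"
          using s2 by (intro map_cong) auto
        then have "mset (map (narr s2 ''ord'') [0..<m]) = mset [0..<m]"
          using r(3) by (simp only:)
        moreover have "runs_sorted key (2 ^ Suc p) (narr s2 ''ord'') m"
          using r(1) runs_sorted_cong[of m "narr s2 ''ord''" "narr s1 ''tmp''"] s2 by simp
        moreover have "Suc t2 \<le> t + 3 * m + 3 + Suc p * (20 * m + 6)"
          using r(2) s2(3) p(3) by simp
        ultimately show ?case using s2(1) pm
          by (simp del: mset_map mset_upt) (rule exI[of _ "Suc p"], simp)
      qed
    qed (use p c in auto)
    ultimately show ?case by simp
  next
    case (3 u s')
    have c: "nvar s' ''m'' = m"
      using 3(2) s0 by (simp add: same_def merge_pass_def merge_runs_def merge_step_def set_mid_hi_def m_def)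
    from 3(1) obtain p where p: "p = 0 \<or> 2 ^ (p - 1) < m" "nvar s' ''wd'' = 2 ^ p"
      "u \<le> t + 3 * m + 3 + p * (20 * m + 6)" "runs_sorted key (2 ^ p) (narr s' ''ord'') m"
      "mset (map (narr s' ''ord'') [0..<m]) = mset [0..<m]" by blast
    with 3(3) c have pm: "m \<le> 2 ^ p" by simp
    have "key (narr s' ''ord'' x) \<le> key (narr s' ''ord'' y)" if "x \<le> y" "y < m" for x y
      using p(4)[unfolded runs_sorted_def, rule_format, of 0 x y] that pm by simp
    moreover have "Suc u \<le> t + 3 * m + 4 + p * (20 * m + 6)" using p(3) by simp
    ultimately show ?case using p by blast
  qed
  note loop = this
  show ?thesis unfolding merge_sort_def wp_Seq
  proof (rule wp_consequence[OF wp_init_ord], goal_cases)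
    case (1 t' s')
    then have "wp (While (NLess (NVar ''wd'') (NVar ''m'')) ?c) ?Q (Suc t')
        (s'\<lparr>nvar := (nvar s')(''wd'' := 1)\<rparr>)"
      by (intro loop) (simp_all add: same_def m_def key_def)
    then show ?case by simp
  qed
qed

definition gather :: com where
  "gather = For ''i'' (NVar ''m'')
     (Seq (NStore ''a'' (NVar ''i'') (NGet ''src'' (NGet ''ord'' (NVar ''i''))))
     (Seq (NStore ''b'' (NVar ''i'') (NGet ''dst'' (NGet ''ord'' (NVar ''i''))))
          (RStore ''w'' (NVar ''i'') (RGet ''wgt'' (NGet ''ord'' (NVar ''i''))))))"

definition edge_arrays :: "state \<Rightarrow> (nat set \<Rightarrow> real) \<Rightarrow> (nat \<times> nat) list \<Rightarrow> bool" where
  "edge_arrays s \<omega> es \<longleftrightarrow> nvar s ''m'' = length es \<and>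
     (\<forall>i<length es. narr s ''a'' i = fst (es ! i) \<and> narr s ''b'' i = snd (es ! i) \<and>
        rarr s ''w'' i = \<omega> (edge (es ! i)))"

lemma wp_gather:
  "wp gather (\<lambda>t' s'. t' = t + 5 * nvar s ''m'' + 2 \<and> (\<forall>i<nvar s ''m''.
       narr s' ''a'' i = narr s ''src'' (narr s ''ord'' i) \<and>
       narr s' ''b'' i = narr s ''dst'' (narr s ''ord'' i) \<and>
       rarr s' ''w'' i = rarr s ''wgt'' (narr s ''ord'' i))) t s"
  unfolding gather_def
proof (rule wp_For[where N = "nvar s ''m''" and B = "t + 5 * nvar s ''m'' + 1" and
   I = "\<lambda>i t' s'. t' = t + 5 * i + 1 \<and> (\<forall>x<i.
       narr s' ''a'' x = narr s ''src'' (narr s ''ord'' x) \<and>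
       narr s' ''b'' x = narr s ''dst'' (narr s ''ord'' x) \<and>
       rarr s' ''w'' x = rarr s ''wgt'' (narr s ''ord'' x))"], goal_cases)
  case (5 i u s')
  then have "narr s' ''src'' = narr s ''src''" "narr s' ''dst'' = narr s ''dst''"
    "narr s' ''ord'' = narr s ''ord''" "rarr s' ''wgt'' = rarr s ''wgt''" by (simp_all add: same_def)
  with 5 show ?case by (simp add: less_Suc_eq)
qed (auto simp: same_def)

definition sort_edges :: com where
  "sort_edges = Seq merge_sort gather"

lemma wp_sort_edges:
  assumes m: "nvar s ''m'' = length es"
    and arr: "\<And>i. i < length es \<Longrightarrow> narr s ''src'' i = fst (es ! i)"
      "\<And>i. i < length es \<Longrightarrow> narr s ''dst'' i = snd (es ! i)"
      "\<And>i. i < length es \<Longrightarrow> rarr s ''wgt'' i = \<omega> (edge (es ! i))"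
  shows "wp sort_edges (\<lambda>t' s'. \<exists>es' p. mset es' = mset es \<and> sorted (map (\<omega> \<circ> edge) es') \<and>
    edge_arrays s' \<omega> es' \<and> (p = 0 \<or> 2 ^ (p - 1) < length es) \<and>
    t' \<le> t + 8 * length es + 6 + p * (20 * length es + 6)) t s"
  unfolding sort_edges_def wp_Seq
proof (rule wp_consequence[OF wp_merge_sort], goal_cases)
  case (1 t1 s1)
  let ?m = "length es"
  let ?A = "narr s1 ''ord''"
  from 1(1) m obtain p where p: "p = 0 \<or> 2 ^ (p - 1) < ?m" "t1 \<le> t + 3 * ?m + 4 + p * (20 * ?m + 6)" by auto
  have perm: "mset (map ?A [0..<?m]) = mset [0..<?m]"
    and srt: "\<And>x y. x \<le> y \<Longrightarrow> y < ?m \<Longrightarrow> rarr s ''wgt'' (?A x) \<le> rarr s ''wgt'' (?A y)"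
    using 1(1) m by auto
  from mset_eq_setD[OF perm] have A: "?A ` {..<?m} = {..<?m}" by (simp add: atLeast0LessThan)
  then have A': "?A i < ?m" if "i < ?m" for i using that by blast
  have s1: "nvar s1 ''m'' = ?m" "narr s1 ''src'' = narr s ''src''" "narr s1 ''dst'' = narr s ''dst''"
    "rarr s1 ''wgt'' = rarr s ''wgt''"
    using 1(2) m by (simp_all add: same_def merge_sort_def merge_pass_def merge_runs_def merge_step_def set_mid_hi_def)
  let ?es = "map (\<lambda>i. es ! ?A i) [0..<?m]"
  have "mset ?es = image_mset ((!) es) (mset (map ?A [0..<?m]))"
    by (simp add: multiset.map_comp comp_def)
  also have "\<dots> = mset (map ((!) es) [0..<?m])" unfolding perm by simp
  finally have mset: "mset ?es = mset es" by (simp add: map_nth)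
  have srt': "sorted (map (\<omega> \<circ> edge) ?es)"
    using srt A' arr(3) by (auto simp: sorted_iff_nth_mono)
  have ea: "edge_arrays s2 \<omega> ?es"
    if "same gather s1 s2" "\<forall>i<nvar s1 ''m''.
       narr s2 ''a'' i = narr s1 ''src'' (narr s1 ''ord'' i) \<and>
       narr s2 ''b'' i = narr s1 ''dst'' (narr s1 ''ord'' i) \<and>
       rarr s2 ''w'' i = rarr s1 ''wgt'' (narr s1 ''ord'' i)" for s2
    using that s1 A' arr by (simp add: edge_arrays_def same_def gather_def)
  show ?case
  proof (rule wp_consequence[OF wp_gather], goal_cases)
    case (1 t2 s2)
    then have "t2 \<le> t + 8 * ?m + 6 + p * (20 * ?m + 6)" using p(2) s1(1) by simp
    moreover have "edge_arrays s2 \<omega> ?es" by (rule ea[OF 1(2) conjunct2[OF 1(1)]])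
    ultimately show ?case using p(1) mset srt'
      by (intro exI[of _ ?es] exI[of _ p] conjI)
  qed
qed

subsection \<open>The tour and Kruskal's algorithm\<close>

text \<open>If the orbit of \<open>0\<close> repeated a value within the first \<open>n\<close>
  iterates, it would be confined to fewer than \<open>n\<close> points and could not reach all of
  them. Reachability thus already gives injectivity, which the invariant of the tour need not
  record.\<close>

lemma iterates_bij_betw:
  fixes f :: "nat \<Rightarrow> nat"
  assumes n: "0 < n" and f: "\<And>x. x < n \<Longrightarrow> f x < n"
    and reach: "\<And>y. y < n \<Longrightarrow> (0, y) \<in> {(x, f x) | x. x < n}\<^sup>*"
  shows "bij_betw (\<lambda>i. (f ^^ i) 0) {..<n} {..<n}"
proof -
  let ?x = "\<lambda>i. (f ^^ i) 0"
  have lt: "?x i < n" for i by (induction i) (use n f in auto)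
  have surj: "\<exists>i. y = ?x i" if "y < n" for y
    using reach[OF that]
  proof (induction rule: rtrancl_induct)
    case base
    show ?case by (intro exI[of _ 0]) simp
  next
    case (step y z)
    then obtain i where "z = f (?x i)" by auto
    then show ?case by (intro exI[of _ "Suc i"]) simp
  qed
  have inj: "inj_on ?x {..<n}"
  proof (rule ccontr)
    assume "\<not> inj_on ?x {..<n}"
    then obtain i j where ij: "i < j" "j < n" "?x i = ?x j"
      unfolding inj_on_def by (metis lessThan_iff nat_neq_iff)
    have "?x l \<in> ?x ` {..<j}" for l
    proof (induction l)
      case 0
      show ?case using ij by (intro image_eqI[of _ _ 0]) auto
    next
      case (Suc l)
      then obtain p where p: "p < j" "?x l = ?x p" by auto
      then have "?x (Suc l) = ?x (Suc p)" by simp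
      moreover have "?x (Suc p) \<in> ?x ` {..<j}"
      proof (cases "Suc p = j")
        case True
        with ij show ?thesis by (intro image_eqI[of _ _ i]) auto
      next
        case False
        with p show ?thesis by (intro image_eqI[of _ _ "Suc p"]) auto
      qed
      ultimately show ?case by simp
    qed
    then have "{..<n} \<subseteq> ?x ` {..<j}" using surj by blast
    then have "card {..<n} \<le> card (?x ` {..<j})" by (intro card_mono) auto
    also have "\<dots> \<le> j" using card_image_le[of "{..<j}" ?x] by simp
    finally show False using ij by simp
  qed
  moreover have "?x ` {..<n} = {..<n}"
    using lt inj by (intro card_subset_eq) (auto simp: card_image)
  ultimately show ?thesis by (simp add: bij_betw_def)
qed

lemma kruskal_subset: "kruskal K es \<subseteq> K \<union> edge ` set es"
proof (induction es arbitrary: K)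
  case (Cons e es)
  from Cons[of K] Cons[of "insert {fst e, snd e} K"] show ?case by (auto simp: edge_def)
qed simp

lemma kruskal_mono: "K \<subseteq> kruskal K es"
proof (induction es arbitrary: K)
  case (Cons e es)
  from Cons[of K] Cons[of "insert {fst e, snd e} K"] show ?case by simp
qed simp

lemma kruskal_spans: "e \<in> set es \<Longrightarrow> (fst e, snd e) \<in> (adj_rel (kruskal K es))\<^sup>*"
proof (induction es arbitrary: K)
  case (Cons e' es)
  show ?case
  proof (cases "e \<in> set es")
    case True
    then show ?thesis using Cons.IH by simp
  next
    case False
    with Cons.prems have e: "e' = e" by simp
    let ?K = "if (fst e, snd e) \<in> (adj_rel K)\<^sup>* then K else insert {fst e, snd e} K"
    have "(fst e, snd e) \<in> (adj_rel (insert {fst e, snd e} K))\<^sup>*"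
      by (rule r_into_rtrancl) (simp del: prod.collapse)
    then have "(fst e, snd e) \<in> (adj_rel ?K)\<^sup>*" by (simp del: prod.collapse)
    then have "(fst e, snd e) \<in> (adj_rel (kruskal ?K es))\<^sup>*"
      using rtrancl_mono[OF adj_rel_mono[OF kruskal_mono]] by blast
    then show ?thesis by (simp add: e)
  qed
qed simp

text \<open>Mutual reachability under \<open>nx\<close> within a component says that the component
  is one cycle of \<open>nx\<close>. \<open>len x\<close> is merely an upper bound for the distance
  from \<open>x\<close> to \<open>nx x\<close> in the forest, and each forest edge contributes twice
  to the sum.\<close>

definition kruskal_inv ::
  "(nat set \<Rightarrow> real) \<Rightarrow> nat \<Rightarrow> nat set set \<Rightarrow> (nat \<Rightarrow> nat) \<Rightarrow> (nat \<Rightarrow> nat) \<Rightarrow> (nat \<Rightarrow> real) \<Rightarrow>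
   real \<Rightarrow> nat \<Rightarrow> bool" where
  "kruskal_inv \<omega> n K lab nx len M cnt \<longleftrightarrow>
     simple_on {..<n} K \<and>
     (\<forall>x<n. \<forall>y<n. lab x = lab y \<longleftrightarrow> (x, y) \<in> (adj_rel K)\<^sup>*) \<and>
     card (lab ` {..<n}) + cnt = n \<and> M = total_weight \<omega> K \<and>
     (\<forall>x<n. nx x < n \<and> near \<omega> K x (nx x) (len x) \<and> 0 \<le> len x) \<and>
     (\<forall>x<n. \<forall>y<n. lab x = lab y \<longrightarrow> (x, y) \<in> {(x, nx x) | x. x < n}\<^sup>*) \<and>
     (\<Sum>x<n. len x) = 2 * M"

lemma kruskal_inv_init:
  assumes "\<And>x. x < n \<Longrightarrow> lab x = x" "\<And>x. x < n \<Longrightarrow> nx x = x"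
  shows "kruskal_inv \<omega> n {} lab nx (\<lambda>_. 0) 0 0"
proof -
  have "lab ` {..<n} = {..<n}" using assms by force
  moreover have "adj_rel ({} :: nat set set) = {}" by auto
  ultimately show ?thesis
    unfolding kruskal_inv_def using assms
    by (auto simp: simple_on_def total_weight_def intro: near_refl)
qed

lemma near_rtrancl: "near \<omega> K x y L \<Longrightarrow> (x, y) \<in> (adj_rel K)\<^sup>*"
  by (elim nearE) (rule wreach_rtrancl)

text \<open>Exchanging the successors of \<open>u\<close> and \<open>v\<close> on two disjoint
  cycles yields one cycle. Each old arc is simulated in the new graph: \<open>u\<close> goes to
  \<open>nx v\<close>, along the old cycle to \<open>v\<close>, and from there to
  \<open>nx u\<close>.\<close>

lemma splice_reach:
  fixes nx :: "nat \<Rightarrow> nat"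
  assumes uv: "u < n" "v < n" "lab u \<noteq> lab v"
    and nx: "\<And>x. x < n \<Longrightarrow> nx x < n \<and> lab (nx x) = lab x"
    and reach: "\<And>x y. x < n \<Longrightarrow> y < n \<Longrightarrow> lab x = lab y \<Longrightarrow> (x, y) \<in> {(x, nx x) | x. x < n}\<^sup>*"
    and xy: "x < n" "y < n" "lab x = lab y \<or> {lab x, lab y} = {lab u, lab v}"
  shows "(x, y) \<in> {(x, (nx(u := nx v, v := nx u)) x) | x. x < n}\<^sup>*"
proof -
  define R where "R = {(x, nx x) | x. x < n}"
  define R' where "R' = {(x, (nx(u := nx v, v := nx u)) x) | x. x < n}"
  note reach = reach[folded R_def]
  \<comment> \<open>Until \<open>z\<close> is reached the walk meets neither \<open>u\<close> nor
    \<open>v\<close>: one of them is \<open>z\<close>, the other has a different label. So only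
    unchanged arcs are used.\<close>
  have to: "x < n \<Longrightarrow> (x, z) \<in> R'\<^sup>*"
    if "(x, z) \<in> R\<^sup>*" "lab x = lab z" "z = u \<or> z = v" for x z
    using that
  proof (induction rule: converse_rtrancl_induct)
    case (step x y)
    then have y: "y = nx x" "y < n" "lab y = lab x" using nx by (auto simp: R_def)
    show ?case
    proof (cases "x = z")
      case False
      with step.prems uv(3) have "x \<noteq> u" "x \<noteq> v" by auto
      then have "(x, y) \<in> R'" using step.hyps y by (auto simp: R_def R'_def)
      moreover have "(y, z) \<in> R'\<^sup>*" using step.IH step.prems y by simp
      ultimately show ?thesis by (rule converse_rtrancl_into_rtrancl)
    qed simp
  qed simp
  have u: "(nx u, u) \<in> R'\<^sup>*" "(nx v, v) \<in> R'\<^sup>*"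
    using to reach nx uv by simp_all
  have uv': "(u, nx v) \<in> R'" "(v, nx u) \<in> R'" using uv by (auto simp: R'_def)
  have cross: "(u, v) \<in> R'\<^sup>*" "(v, u) \<in> R'\<^sup>*"
    using converse_rtrancl_into_rtrancl[OF uv'(1) u(2)]
      converse_rtrancl_into_rtrancl[OF uv'(2) u(1)] by blast+
  have "R \<subseteq> R'\<^sup>*"
  proof
    fix e assume "e \<in> R"
    then obtain x where x: "x < n" "e = (x, nx x)" by (auto simp: R_def)
    consider "x = u" | "x = v" | "x \<noteq> u" "x \<noteq> v" by blast
    then show "e \<in> R'\<^sup>*"
    proof cases
      case 1
      with x rtrancl_into_rtrancl[OF cross(1) uv'(2)] show ?thesis by simp
    next
      case 2
      with x rtrancl_into_rtrancl[OF cross(2) uv'(1)] show ?thesis by simp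
    next
      case 3
      with x have "e \<in> R'" by (auto simp: R'_def)
      then show ?thesis by blast
    qed
  qed
  then have sub: "R\<^sup>* \<subseteq> R'\<^sup>*" by (rule rtrancl_subset_rtrancl)
  from xy(3) consider "lab x = lab y" | "lab x = lab u" "lab v = lab y"
    | "lab x = lab v" "lab u = lab y" by (auto simp: doubleton_eq_iff)
  then have "(x, y) \<in> R'\<^sup>*"
  proof cases
    case 1
    with reach xy sub show ?thesis by blast
  next
    case 2
    then have "(x, u) \<in> R'\<^sup>*" "(v, y) \<in> R'\<^sup>*" using reach xy uv sub by blast+
    with cross show ?thesis by (meson rtrancl_trans)
  next
    case 3
    then have "(x, v) \<in> R'\<^sup>*" "(u, y) \<in> R'\<^sup>*" using reach xy uv sub by blast+
    with cross show ?thesis by (meson rtrancl_trans)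
  qed
  then show ?thesis unfolding R'_def .
qed

lemma kruskal_inv_insert:
  assumes I: "kruskal_inv \<omega> n K lab nx len M cnt"
    and uv: "u < n" "v < n" "lab u \<noteq> lab v" and w: "0 < \<omega> {u, v}"
    and lab': "\<And>x. x < n \<Longrightarrow> lab' x = (if lab x = lab v then lab u else lab x)"
  shows "kruskal_inv \<omega> n (insert {u, v} K) lab' (nx(u := nx v, v := nx u))
    (len(u := len v + \<omega> {u, v}, v := len u + \<omega> {u, v})) (M + \<omega> {u, v}) (Suc cnt)"
proof -
  let ?K = "insert {u, v} K" and ?nx = "nx(u := nx v, v := nx u)"
    and ?len = "len(u := len v + \<omega> {u, v}, v := len u + \<omega> {u, v})"
  have K: "simple_on {..<n} K"
    and conn: "\<And>x y. x < n \<Longrightarrow> y < n \<Longrightarrow> lab x = lab y \<longleftrightarrow> (x, y) \<in> (adj_rel K)\<^sup>*"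
    and card: "card (lab ` {..<n}) + cnt = n" and M: "M = total_weight \<omega> K"
    and nx: "\<And>x. x < n \<Longrightarrow> nx x < n" "\<And>x. x < n \<Longrightarrow> near \<omega> K x (nx x) (len x)"
      "\<And>x. x < n \<Longrightarrow> 0 \<le> len x"
    and reach: "\<And>x y. x < n \<Longrightarrow> y < n \<Longrightarrow> lab x = lab y \<Longrightarrow> (x, y) \<in> {(x, nx x) | x. x < n}\<^sup>*"
    and len: "(\<Sum>x<n. len x) = 2 * M"
    using I unfolding kruskal_inv_def by blast+
  have ne: "u \<noteq> v" using uv by auto
  have K': "simple_on {..<n} ?K" using K uv ne by (auto simp: simple_on_def)
  have sub: "(adj_rel K)\<^sup>* \<subseteq> (adj_rel ?K)\<^sup>*" by (intro rtrancl_mono adj_rel_mono) blast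
  have conn': "lab' x = lab' y \<longleftrightarrow> (x, y) \<in> (adj_rel ?K)\<^sup>*" if xy: "x < n" "y < n" for x y
  proof
    assume "(x, y) \<in> (adj_rel ?K)\<^sup>*"
    then show "lab' x = lab' y" using xy(2)
    proof (induction rule: rtrancl_induct)
      case (step y z)
      from step.hyps(2) have yz: "{y, z} \<in> ?K" by simp
      then have lt: "y < n" using simple_on_edge[OF K'] by blast
      have "lab' y = lab' z"
      proof (cases "{y, z} \<in> K")
        case True
        then have "lab y = lab z" using conn[OF lt step.prems] by auto
        then show ?thesis using lab' lt step.prems by simp
      next
        case False
        with yz have "{y, z} = {u, v}" by simp
        then show ?thesis using lab' uv by (auto simp: doubleton_eq_iff)
      qed
      with step lt show ?case by simp
    qed simp
  next
    assume eq: "lab' x = lab' y"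
    have e: "(u, v) \<in> (adj_rel ?K)\<^sup>*" "(v, u) \<in> (adj_rel ?K)\<^sup>*"
      by (auto simp: insert_commute intro!: r_into_rtrancl)
    have c: "(p, q) \<in> (adj_rel ?K)\<^sup>*" if "p < n" "q < n" "lab p = lab q" for p q
      using that conn sub by blast
    consider "lab x = lab y" | "lab x = lab v" "lab u = lab y" | "lab x = lab u" "lab v = lab y"
      using eq lab' xy by (auto split: if_splits)
    then show "(x, y) \<in> (adj_rel ?K)\<^sup>*"
    proof cases
      case 1
      with c xy show ?thesis by blast
    next
      case 2
      then have "(x, v) \<in> (adj_rel ?K)\<^sup>*" "(u, y) \<in> (adj_rel ?K)\<^sup>*" using c xy uv by blast+
      with e show ?thesis by (meson rtrancl_trans)
    next
      case 3
      then have "(x, u) \<in> (adj_rel ?K)\<^sup>*" "(v, y) \<in> (adj_rel ?K)\<^sup>*" using c xy uv by blast+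
      with e show ?thesis by (meson rtrancl_trans)
    qed
  qed
  have "lab' ` {..<n} = lab ` {..<n} - {lab v}"
  proof -
    have "lab' x \<in> lab ` {..<n} - {lab v}" if "x < n" for x using lab' uv that by auto
    moreover have "lab x \<in> lab' ` {..<n}" if "x < n" "lab x \<noteq> lab v" for x
      using lab' that by (intro image_eqI[of _ _ x]) auto
    ultimately show ?thesis by auto
  qed
  then have "Suc (card (lab' ` {..<n})) = card (lab ` {..<n})"
    using uv by (metis card_Suc_Diff1 finite_imageI finite_lessThan image_eqI lessThan_iff)
  then have card': "card (lab' ` {..<n}) + Suc cnt = n" using card by simp
  have "{u, v} \<notin> K" using conn[of u v] uv by auto
  then have M': "M + \<omega> {u, v} = total_weight \<omega> ?K"
    using M simple_on_finite[OF _ K] by (simp add: total_weight_def)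
  have near': "near \<omega> ?K x (?nx x) (?len x)" if "x < n" for x
  proof -
    have up: "near \<omega> ?K x (nx x) (len x)" if "x < n" for x
      using nx(2)[OF that] by (rule near_mono) auto
    have e: "near \<omega> ?K u v (\<omega> {u, v})" by (rule near_edge) simp
    consider "x = u" | "x = v" | "x \<noteq> u" "x \<noteq> v" by blast
    then show ?thesis
    proof cases
      case 1
      with near_trans[OF e up[OF uv(2)]] ne show ?thesis by (simp add: add.commute)
    next
      case 2
      with near_trans[OF near_sym[OF e] up[OF uv(1)]] ne show ?thesis by (simp add: add.commute)
    next
      case 3
      with up[OF that] show ?thesis by simp
    qed
  qed
  have "lab (nx x) = lab x" if "x < n" for x
    using conn[OF that nx(1)[OF that]] near_rtrancl[OF nx(2)[OF that]] by simp
  then have reach': "(x, y) \<in> {(x, ?nx x) | x. x < n}\<^sup>*" if "x < n" "y < n" "lab' x = lab' y" for x y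
    using that lab' nx(1) reach by (intro splice_reach[OF uv]) (auto split: if_splits)
  have len': "(\<Sum>x<n. ?len x) = 2 * (M + \<omega> {u, v})"
  proof -
    \<comment> \<open>Only the summands at \<open>u\<close> and \<open>v\<close> change; they swap
      their old lengths and each gains the weight of the new edge.\<close>
    have split: "(\<Sum>x<n. f x) = f u + (f v + (\<Sum>x\<in>{..<n} - {u} - {v}. f x))" for f :: "nat \<Rightarrow> real"
      using uv ne by (subst sum.remove[of _ u], simp, simp, subst sum.remove[of _ v]) auto
    have "(\<Sum>x\<in>{..<n} - {u} - {v}. ?len x) = (\<Sum>x\<in>{..<n} - {u} - {v}. len x)"
      by (intro sum.cong) auto
    with split[of ?len] split[of len] len ne show ?thesis by (simp add: algebra_simps)
  qed
  show ?thesis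
    unfolding kruskal_inv_def
    using K' conn' card' M' near' reach' len' nx(1,3) w uv by auto
qed

definition outs :: "(nat \<Rightarrow> nat) \<Rightarrow> (nat \<Rightarrow> nat) \<Rightarrow> nat \<Rightarrow> nat set set" where
  "outs f g m = (\<lambda>i. {f i, g i}) ` {..<m}"

lemma output_edges_eq: "output_edges s = outs (narr s ''out_src'') (narr s ''out_dst'') (nvar s ''out_m'')"
  by (simp add: output_edges_def outs_def)

lemma outs_insert [simp]: "outs (f(m := u)) (g(m := v)) (Suc m) = insert {u, v} (outs f g m)"
  by (auto simp: outs_def lessThan_Suc)

text \<open>Natural numbers cannot be multiplied on the machine, so the row offsets
  \<open>x * n\<close> are accumulated in \<open>acc\<close>.\<close>

definition init_arrays :: com where
  "init_arrays = For ''x'' (NVar ''n'')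
     (Seq (NStore ''comp'' (NVar ''x'') (NVar ''x''))
     (Seq (NStore ''nx'' (NVar ''x'') (NVar ''x''))
     (Seq (NStore ''row'' (NVar ''x'') (NVar ''acc''))
          (NAssign ''acc'' (NAdd (NVar ''acc'') (NVar ''n''))))))"

lemma wp_init_arrays:
  assumes "nvar s ''acc'' = 0"
  shows "wp init_arrays (\<lambda>t' s'. t' = t + 6 * nvar s ''n'' + 2 \<and> (\<forall>x<nvar s ''n''.
     narr s' ''comp'' x = x \<and> narr s' ''nx'' x = x \<and> narr s' ''row'' x = x * nvar s ''n'')) t s"
  unfolding init_arrays_def
proof (rule wp_For[where N = "nvar s ''n''" and B = "t + 6 * nvar s ''n'' + 1" and
   I = "\<lambda>i t' s'. t' = t + 6 * i + 1 \<and> nvar s' ''acc'' = i * nvar s ''n'' \<and> (\<forall>x<i.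
     narr s' ''comp'' x = x \<and> narr s' ''nx'' x = x \<and> narr s' ''row'' x = x * nvar s ''n'')"], goal_cases)
  case (5 i u s')
  then have "nvar s' ''n'' = nvar s ''n''" by (simp add: same_def)
  with 5 show ?case by (simp add: less_Suc_eq)
qed (use assms in \<open>auto simp: same_def\<close>)

abbreviation NEq :: "nexp \<Rightarrow> nexp \<Rightarrow> bexp" where
  "NEq x y \<equiv> BAnd (BNot (NLess x y)) (BNot (NLess y x))"

text \<open>A full pass over the labels suffices: it is run at most \<open>n\<close> times in all,
  once per accepted edge, and the resulting quadratic cost stays below the target.\<close>

definition relabel :: com where
  "relabel = For ''x'' (NVar ''n'')
     (Cond (NEq (NGet ''comp'' (NVar ''x'')) (NVar ''cv''))
        (NStore ''comp'' (NVar ''x'') (NVar ''cu'')) Skip)"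

lemma wp_relabel:
  "wp relabel (\<lambda>t' s'. t' = t + 4 * nvar s ''n'' + 2 \<and> (\<forall>x<nvar s ''n''. narr s' ''comp'' x =
      (if narr s ''comp'' x = nvar s ''cv'' then nvar s ''cu'' else narr s ''comp'' x))) t s"
  unfolding relabel_def
proof (rule wp_For[where N = "nvar s ''n''" and B = "t + 4 * nvar s ''n'' + 1" and
   I = "\<lambda>i t' s'. t' = t + 4 * i + 1 \<and> (\<forall>x. narr s' ''comp'' x =
      (if x < i \<and> narr s ''comp'' x = nvar s ''cv'' then nvar s ''cu'' else narr s ''comp'' x))"], goal_cases)
  case (5 i u s')
  then have "nvar s' ''cv'' = nvar s ''cv''" "nvar s' ''cu'' = nvar s ''cu''" by (simp_all add: same_def)
  with 5 show ?case by (auto simp: less_Suc_eq)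
qed (auto simp: same_def)

definition splice :: com where
  "splice =
     Seq (NStore ''out_src'' (NVar ''out_m'') (NVar ''u''))
     (Seq (NStore ''out_dst'' (NVar ''out_m'') (NVar ''v''))
     (Seq (inc ''out_m'')
     (Seq (RAssign ''mst'' (RAdd (RVar ''mst'') (RGet ''w'' (NVar ''i''))))
     (Seq (NAssign ''z'' (NGet ''nx'' (NVar ''u'')))
     (Seq (NStore ''nx'' (NVar ''u'') (NGet ''nx'' (NVar ''v'')))
     (Seq (NStore ''nx'' (NVar ''v'') (NVar ''z''))
     (Seq (RAssign ''r'' (RGet ''len'' (NVar ''u'')))
     (Seq (RStore ''len'' (NVar ''u'') (RAdd (RGet ''len'' (NVar ''v'')) (RGet ''w'' (NVar ''i''))))
     (Seq (RStore ''len'' (NVar ''v'') (RAdd (RVar ''r'') (RGet ''w'' (NVar ''i''))))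
          relabel)))))))))"

definition kruskal_loop :: com where
  "kruskal_loop = For ''i'' (NVar ''m'')
     (Seq (NAssign ''u'' (NGet ''a'' (NVar ''i'')))
     (Seq (NAssign ''v'' (NGet ''b'' (NVar ''i'')))
     (Seq (NAssign ''cu'' (NGet ''comp'' (NVar ''u'')))
     (Seq (NAssign ''cv'' (NGet ''comp'' (NVar ''v'')))
          (Cond (NEq (NVar ''cu'') (NVar ''cv'')) Skip splice)))))"

abbreviation kruskal_state :: "(nat set \<Rightarrow> real) \<Rightarrow> nat \<Rightarrow> nat set set \<Rightarrow> state \<Rightarrow> bool" where
  "kruskal_state \<omega> n K s \<equiv>
     kruskal_inv \<omega> n K (narr s ''comp'') (narr s ''nx'') (rarr s ''len'') (rvar s ''mst'') (nvar s ''out_m'') \<and>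
     output_edges s = K"

lemma kruskal_inv_component:
  assumes "kruskal_inv \<omega> n K lab nx len M cnt"
  shows "(x, y) \<in> (adj_rel K)\<^sup>* \<Longrightarrow> x < n \<Longrightarrow> y < n \<Longrightarrow> lab x = lab y"
    and "lab x = lab y \<Longrightarrow> x < n \<Longrightarrow> y < n \<Longrightarrow> (x, y) \<in> (adj_rel K)\<^sup>*"
  using assms unfolding kruskal_inv_def by blast+

lemma wp_splice:
  assumes I: "kruskal_state \<omega> n K s" and n: "nvar s ''n'' = n"
    and uv: "nvar s ''u'' = u" "nvar s ''v'' = v" "u < n" "v < n"
    and c: "nvar s ''cu'' = narr s ''comp'' u" "nvar s ''cv'' = narr s ''comp'' v"
      "narr s ''comp'' u \<noteq> narr s ''comp'' v"
    and w: "rarr s ''w'' (nvar s ''i'') = \<omega> {u, v}" "0 < \<omega> {u, v}"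
  shows "wp splice (\<lambda>t' s'. t' = t + 4 * n + 12 \<and> nvar s' ''out_m'' = Suc (nvar s ''out_m'') \<and>
    kruskal_state \<omega> n (insert {u, v} K) s') t s"
proof -
  have uv': "u \<noteq> v" using c by auto
  show ?thesis
    unfolding splice_def wp_Seq
    apply (simp add: uv w(1) uv' uv'[symmetric])
    apply (rule wp_consequence[OF wp_relabel])
    subgoal for t' s'
      using kruskal_inv_insert[OF conjunct1[OF I] uv(3,4) c(3) w(2), of "narr s' ''comp''"] I n uv c uv'
      by (simp add: same_def relabel_def output_edges_eq)
    done
qed

text \<open>Every edge costs at most 8 steps apart from merging. The merges are counted by
  \<open>out_m\<close>, which the label count in the invariant keeps at most
  \<open>n\<close>.\<close>

lemma wp_kruskal_loop:
  assumes es: "edge_arrays s \<omega> es" and n: "nvar s ''n'' = n"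
    and E: "\<And>e. e \<in> set es \<Longrightarrow> fst e < n \<and> snd e < n \<and> fst e \<noteq> snd e \<and> 0 < \<omega> (edge e)"
    and I: "kruskal_state \<omega> n {} s" and out: "nvar s ''out_m'' = 0"
  shows "wp kruskal_loop (\<lambda>t' s'. t' \<le> t + 8 * length es + (4 * n + 12) * n + 2 \<and>
    kruskal_state \<omega> n (kruskal {} es) s') t s"
  unfolding kruskal_loop_def
proof (rule wp_For[where N = "length es" and B = "t + 8 * length es + (4 * n + 12) * n + 1" and
   I = "\<lambda>i t' s'. t' \<le> t + 8 * i + (4 * n + 12) * nvar s' ''out_m'' + 1 \<and>
      kruskal_state \<omega> n (kruskal {} (take i es)) s'"], goal_cases)
  case 1
  show ?case by (simp add: splice_def relabel_def)
next
  case (2 i t s v)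
  show ?case by (simp add: output_edges_eq)
next
  case (3 s')
  then show ?case using es by (simp add: same_def splice_def relabel_def edge_arrays_def)
next
  case 4
  show ?case using I out by simp
next
  case (5 i u s')
  let ?e = "es ! i" and ?K = "kruskal {} (take i es)" and ?lab = "narr s' ''comp''"
  have e: "?e \<in> set es" using 5(1) by simp
  have ns: "nvar s' ''n'' = n" "narr s' ''a'' i = fst ?e" "narr s' ''b'' i = snd ?e"
    "rarr s' ''w'' i = \<omega> {fst ?e, snd ?e}"
    using 5 es n by (simp_all add: same_def splice_def relabel_def edge_arrays_def edge_def)
  have I': "kruskal_inv \<omega> n ?K ?lab (narr s' ''nx'') (rarr s' ''len'') (rvar s' ''mst'') (nvar s' ''out_m'')"
    and u: "u \<le> t + 8 * i + (4 * n + 12) * nvar s' ''out_m'' + 1"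
    and out': "output_edges s' = ?K" using 5(3) by auto
  have "nvar s' ''out_m'' \<le> n" using I' by (auto simp: kruskal_inv_def)
  then have "(4 * n + 12) * nvar s' ''out_m'' \<le> (4 * n + 12) * n" by (rule mult_le_mono2)
  then have ub: "u \<le> t + 8 * length es + (4 * n + 12) * n + 1" using u 5(1) by linarith
  have K: "kruskal {} (take (Suc i) es) =
    (if (fst ?e, snd ?e) \<in> (adj_rel ?K)\<^sup>* then ?K else insert {fst ?e, snd ?e} ?K)"
    using 5(1) by (simp add: take_Suc_conv_app_nth kruskal_append)
  have conn: "(fst ?e, snd ?e) \<in> (adj_rel ?K)\<^sup>* \<longleftrightarrow> ?lab (fst ?e) = ?lab (snd ?e)"
    using kruskal_inv_component[OF I'] E[OF e] by blast
  show ?case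
  proof (cases "?lab (fst ?e) = ?lab (snd ?e)")
    case True
    then show ?thesis using ub u I' out' conn ns 5(2) by (simp add: K output_edges_eq)
  next
    case False
    let ?s = "s'\<lparr>nvar := (nvar s')(''u'' := fst ?e, ''v'' := snd ?e, ''cu'' := ?lab (fst ?e),
      ''cv'' := ?lab (snd ?e))\<rparr>"
    have "wp splice (\<lambda>t' s''. Suc t' \<le> t + 8 * Suc i + (4 * n + 12) * nvar s'' ''out_m'' + 1 \<and>
      kruskal_state \<omega> n (kruskal {} (take (Suc i) es)) s'') (u + 6) ?s"
    proof (rule wp_consequence[OF wp_splice[where \<omega> = \<omega> and n = n and K = ?K and u = "fst ?e" and v = "snd ?e"]], goal_cases)
      case 1
      show ?case using I' out' by (simp add: output_edges_eq)
    next
      case (12 t' s'')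
      have Kn: "kruskal {} (take (Suc i) es) = insert {fst ?e, snd ?e} ?K"
        unfolding K using conn False by (simp del: prod.collapse)
      moreover have "Suc t' \<le> t + 8 * Suc i + (4 * n + 12) * nvar s'' ''out_m'' + 1"
        using 12(1) u by (simp add: algebra_simps)
      ultimately show ?case unfolding Kn using 12(1) by blast
    qed (use E[OF e] False ns 5(2) in \<open>auto simp: edge_def\<close>)
    then show ?thesis using ub False ns 5(2) by (auto simp: eval_nat_numeral)
  qed
next
  case (6 u s')
  have "nvar s' ''out_m'' \<le> n" using 6 by (auto simp: kruskal_inv_def)
  then have "(4 * n + 12) * nvar s' ''out_m'' \<le> (4 * n + 12) * n" by (rule mult_le_mono2)
  moreover have "u \<le> t + 8 * length es + (4 * n + 12) * nvar s' ''out_m'' + 1" using 6(1) by blast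
  ultimately have "Suc u \<le> t + 8 * length es + (4 * n + 12) * n + 2" by linarith
  moreover have "kruskal_state \<omega> n (kruskal {} es) s'" using 6(1) by simp
  ultimately show ?case by blast
qed

definition tour :: "(nat set \<Rightarrow> real) \<Rightarrow> nat \<Rightarrow> nat set set \<Rightarrow> (nat \<Rightarrow> nat) \<Rightarrow> (nat \<Rightarrow> real) \<Rightarrow> real \<Rightarrow> bool" where
  "tour \<omega> n K nx len M \<longleftrightarrow>
     bij_betw (\<lambda>i. (nx ^^ i) 0) {..<n} {..<n} \<and>
     (\<forall>x<n. nx x < n \<and> near \<omega> K x (nx x) (len x) \<and> 0 \<le> len x) \<and>
     (\<Sum>x<n. len x) = 2 * M"

text \<open>Connectedness leaves a single label, so the tours of the components have become one
  cycle through all vertices. That there is at least one label gives \<open>cnt < n\<close>.\<close>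

lemma kruskal_inv_tour:
  assumes I: "kruskal_inv \<omega> n (kruskal {} es) lab nx len M cnt"
    and G: "weighted_graph {..<n} E \<omega>" "connected_graph {..<n} E" and es: "lists_edges es E"
  shows "tour \<omega> n (kruskal {} es) nx len M" "cnt < n" "M = total_weight \<omega> (kruskal {} es)"
    "kruskal {} es \<subseteq> E"
proof -
  let ?K = "kruskal {} es"
  have E: "edge ` set es = E" using es by (simp add: lists_edges_def)
  have n: "0 < n" using G(2) by (auto simp: connected_graph_def)
  have "adj_rel E \<subseteq> (adj_rel ?K)\<^sup>*"
  proof
    fix z assume z: "z \<in> adj_rel E"
    obtain x y where xy: "z = (x, y)" by fastforce
    with z E obtain e where e: "e \<in> set es" "{x, y} = {fst e, snd e}" by (auto simp: edge_def)
    from kruskal_spans[OF e(1)] have r: "(fst e, snd e) \<in> (adj_rel ?K)\<^sup>*" .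
    with rtrancl_adj_rel_sym[OF r] e(2) show "z \<in> (adj_rel ?K)\<^sup>*" by (auto simp: xy doubleton_eq_iff)
  qed
  then have "(adj_rel E)\<^sup>* \<subseteq> (adj_rel ?K)\<^sup>*" by (rule rtrancl_subset_rtrancl)
  moreover have "(x, y) \<in> (adj_rel E)\<^sup>*" if "x < n" "y < n" for x y
    using that G(2) connected_graph_iff[of E "{..<n}"] weighted_graphD(3)[OF G(1)] by blast
  ultimately have lab: "lab x = lab y" if "x < n" "y < n" for x y
    using that kruskal_inv_component(1)[OF I] by blast
  then have reach: "(0, y) \<in> {(x, nx x) | x. x < n}\<^sup>*" if "y < n" for y
    using I n that unfolding kruskal_inv_def by blast
  have nx: "nx x < n" if "x < n" for x using I that unfolding kruskal_inv_def by blast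
  show "tour \<omega> n ?K nx len M"
    using I iterates_bij_betw[OF n nx reach] unfolding kruskal_inv_def tour_def by blast
  have "0 < card (lab ` {..<n})" using n by (simp add: card_gt_0_iff lessThan_empty_iff)
  then show "cnt < n" using I unfolding kruskal_inv_def by linarith
  show "M = total_weight \<omega> ?K" using I unfolding kruskal_inv_def by blast
  show "?K \<subseteq> E" using kruskal_subset[of "{}" es] E by simp
qed

subsection \<open>Clustering the tour\<close>

text \<open>\<open>c\<close> is the current cluster, and \<open>a\<close> is the length of the tour since it was opened.\<close>

definition cluster_inv ::
  "(nat set \<Rightarrow> real) \<Rightarrow> nat set set \<Rightarrow> (nat \<Rightarrow> nat) \<Rightarrow> (nat \<Rightarrow> real) \<Rightarrow> real \<Rightarrow> nat \<Rightarrow> nat \<Rightarrow> real \<Rightarrow>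
   (nat \<Rightarrow> nat) \<Rightarrow> bool" where
  "cluster_inv \<omega> K nx len D i c a cl \<longleftrightarrow>
     0 \<le> a \<and> c \<le> i - 1 \<and> (i = 0 \<longrightarrow> a = 0) \<and> real c * D + a \<le> (\<Sum>j<i. len ((nx ^^ j) 0)) \<and>
     (\<forall>j<i. cl ((nx ^^ j) 0) \<le> c) \<and>
     (\<forall>j<i. cl ((nx ^^ j) 0) = c \<longrightarrow> near \<omega> K ((nx ^^ j) 0) ((nx ^^ i) 0) a) \<and>
     (\<forall>j<i. \<forall>j'<i. cl ((nx ^^ j) 0) = cl ((nx ^^ j') 0) \<longrightarrow>
        near \<omega> K ((nx ^^ j) 0) ((nx ^^ j') 0) D)"

text \<open>A cluster is closed only once the tour since its first vertex exceeds \<open>D\<close>,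
  so the change of \<open>c * D\<close> is paid for by resetting \<open>a\<close>. A vertex joins
  only if \<open>a \<le> D\<close>, which bounds its distance to all earlier members.\<close>

lemma cluster_inv_step:
  assumes I: "cluster_inv \<omega> K nx len D i c a cl" and T: "tour \<omega> n K nx len M"
    and D: "0 \<le> D" and i: "i < n"
    and c': "c' = (if D < a then Suc c else c)" and a': "a' = (if D < a then 0 else a)"
  shows "cluster_inv \<omega> K nx len D (Suc i) c' (a' + len ((nx ^^ i) 0)) (cl((nx ^^ i) 0 := c'))"
proof -
  let ?P = "\<lambda>i. (nx ^^ i) 0"
  have P: "inj_on ?P {..<n}" "?P ` {..<n} = {..<n}" using T by (auto simp: tour_def bij_betw_def)
  have lt: "?P i < n" using P(2) i by blast
  have step: "near \<omega> K (?P i) (?P (Suc i)) (len (?P i))" "0 \<le> len (?P i)"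
    using T lt by (auto simp: tour_def)
  have I': "0 \<le> a" "c \<le> i - 1" "i = 0 \<Longrightarrow> a = 0" "real c * D + a \<le> (\<Sum>j<i. len (?P j))"
    "\<And>j. j < i \<Longrightarrow> cl (?P j) \<le> c"
    "\<And>j. j < i \<Longrightarrow> cl (?P j) = c \<Longrightarrow> near \<omega> K (?P j) (?P i) a"
    "\<And>j j'. j < i \<Longrightarrow> j' < i \<Longrightarrow> cl (?P j) = cl (?P j') \<Longrightarrow> near \<omega> K (?P j) (?P j') D"
    using I unfolding cluster_inv_def by blast+
  let ?cl = "cl(?P i := c')"
  have old: "?cl (?P j) = cl (?P j)" if "j < i" for j
    using inj_onD[OF P(1), of j i] that i by auto
  have new: "near \<omega> K (?P j) (?P i) a'" if "j < i" "cl (?P j) = c'" for j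
    using I'(5)[OF that(1)] I'(6)[OF that(1)] that c' a' by (auto split: if_splits)
  have a'D: "a' \<le> D" "0 \<le> a'" using a' D I'(1) by auto
  have diag: "near \<omega> K (?P j) (?P i) D" if "j < i" "cl (?P j) = c'" for j
    using new[OF that] by (rule near_mono) (use a'D in auto)
  \<comment> \<open>At \<open>i = 0\<close> the length \<open>a\<close> is \<open>0\<close>, so the
    first vertex opens no second cluster. This is what later keeps the number of clusters at most
    \<open>n\<close>.\<close>
  have "c' \<le> Suc i - 1" using c' I'(1-3) I'(2) D by (cases "i = 0") auto
  moreover have "real c' * D + (a' + len (?P i)) \<le> (\<Sum>j<Suc i. len (?P j))"
    using c' a' I'(4) by (auto simp: algebra_simps)
  moreover have "?cl (?P j) \<le> c'" if "j < Suc i" for j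
    using that old I'(5) c' by (cases "j = i") (auto simp: less_Suc_eq le_Suc_eq)
  moreover have "near \<omega> K (?P j) (?P (Suc i)) (a' + len (?P i))"
    if "j < Suc i" "?cl (?P j) = c'" for j
  proof (cases "j = i")
    case True
    from step(1) show ?thesis unfolding True by (rule near_mono) (use a'D in auto)
  next
    case False
    with that have "j < i" by simp
    with old that have "near \<omega> K (?P j) (?P i) a'" by (intro new) auto
    from near_trans[OF this step(1)] show ?thesis .
  qed
  moreover have "near \<omega> K (?P j) (?P j') D"
    if j: "j < Suc i" "j' < Suc i" "?cl (?P j) = ?cl (?P j')" for j j'
  proof -
    consider "j = i" "j' = i" | "j = i" "j' < i" | "j < i" "j' = i" | "j < i" "j' < i"
      using j by linarith
    then show ?thesis
    proof cases
      case 1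
      then show ?thesis by (simp add: near_refl D)
    next
      case 2
      then have "near \<omega> K (?P j') (?P i) D" using j(3) old[of j'] by (intro diag) auto
      from near_sym[OF this] 2 show ?thesis by simp
    next
      case 3
      then show ?thesis using j(3) old[of j] diag[of j] by auto
    next
      case 4
      then show ?thesis using j(3) old[of j] old[of j'] I'(7) by auto
    qed
  qed
  ultimately show ?thesis unfolding cluster_inv_def using a'D step(2) by auto
qed

definition build_clusters :: com where
  "build_clusters =
     Seq (NAssign ''x'' (NConst 0)) (Seq (NAssign ''c'' (NConst 0)) (Seq (RAssign ''sum'' (RNat (NConst 0)))
     (Seq (For ''i'' (NVar ''n'')
        (Seq (Cond (RLess (RVar ''D'') (RVar ''sum''))
             (Seq (inc ''c'') (RAssign ''sum'' (RNat (NConst 0)))) Skip)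
        (Seq (NStore ''cl'' (NVar ''x'') (NVar ''c''))
        (Seq (RAssign ''sum'' (RAdd (RVar ''sum'') (RGet ''len'' (NVar ''x''))))
             (NAssign ''x'' (NGet ''nx'' (NVar ''x'')))))))
     (NAssign ''N'' (NAdd (NVar ''c'') (NConst 1))))))"

definition clustering ::
  "(nat set \<Rightarrow> real) \<Rightarrow> nat \<Rightarrow> nat set set \<Rightarrow> real \<Rightarrow> real \<Rightarrow> nat \<Rightarrow> (nat \<Rightarrow> nat) \<Rightarrow> bool" where
  "clustering \<omega> n K M D N cl \<longleftrightarrow>
     1 \<le> N \<and> N \<le> n \<and> (real N - 1) * D \<le> 2 * M \<and> (\<forall>x<n. cl x < N) \<and>
     (\<forall>x<n. \<forall>y<n. cl x = cl y \<longrightarrow> near \<omega> K x y D)"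

lemma cluster_inv_clustering:
  assumes I: "cluster_inv \<omega> K nx len D n c a cl" and T: "tour \<omega> n K nx len M" and n: "0 < n"
  shows "clustering \<omega> n K M D (Suc c) cl"
proof -
  let ?P = "\<lambda>i. (nx ^^ i) 0"
  have P: "bij_betw ?P {..<n} {..<n}" using T by (simp add: tour_def)
  then have ex: "\<exists>j<n. x = ?P j" if "x < n" for x using that unfolding bij_betw_def by blast
  have "(\<Sum>j<n. len (?P j)) = (\<Sum>x<n. len x)" using P by (rule sum.reindex_bij_betw)
  also have "\<dots> = 2 * M" using T by (simp add: tour_def)
  finally have "real c * D + a \<le> 2 * M" "0 \<le> a" "c \<le> n - 1" using I by (auto simp: cluster_inv_def)
  moreover have "cl x < Suc c" if "x < n" for x
    using ex[OF that] I by (auto simp: cluster_inv_def less_Suc_eq_le)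
  moreover have "near \<omega> K x y D" if "x < n" "y < n" "cl x = cl y" for x y
    using ex[OF that(1)] ex[OF that(2)] that(3) I unfolding cluster_inv_def by blast
  ultimately show ?thesis using n by (auto simp: clustering_def)
qed

lemma wp_build_clusters:
  assumes T: "tour \<omega> n K (narr s ''nx'') (rarr s ''len'') M" and D: "rvar s ''D'' = D" "0 \<le> D"
    and n: "nvar s ''n'' = n" "0 < n"
  shows "wp build_clusters (\<lambda>t' s'. t' \<le> t + 9 * n + 6 \<and>
    clustering \<omega> n K M D (nvar s' ''N'') (narr s' ''cl'')) t s"
proof -
  let ?nx = "narr s ''nx''" and ?len = "rarr s ''len''"
  let ?s = "s\<lparr>nvar := (nvar s)(''x'' := 0, ''c'' := 0), rvar := (rvar s)(''sum'' := 0)\<rparr>"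
  let ?c = "Seq (Cond (RLess (RVar ''D'') (RVar ''sum''))
             (Seq (inc ''c'') (RAssign ''sum'' (RNat (NConst 0)))) Skip)
        (Seq (NStore ''cl'' (NVar ''x'') (NVar ''c''))
        (Seq (RAssign ''sum'' (RAdd (RVar ''sum'') (RGet ''len'' (NVar ''x''))))
             (NAssign ''x'' (NGet ''nx'' (NVar ''x'')))))"
  have "wp (For ''i'' (NVar ''n'') ?c) (\<lambda>t' s'. t' \<le> t + 9 * n + 5 \<and>
    clustering \<omega> n K M D (Suc (nvar s' ''c'')) (narr s' ''cl'')) (t + 3) ?s"
  proof (rule wp_For[where N = n and B = "t + 9 * n + 4" and
      I = "\<lambda>i t' s'. t' \<le> t + 9 * i + 4 \<and> nvar s' ''x'' = (?nx ^^ i) 0 \<and>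
        cluster_inv \<omega> K ?nx ?len D i (nvar s' ''c'') (rvar s' ''sum'') (narr s' ''cl'')"], goal_cases)
    case (5 i u s')
    then have c: "narr s' ''nx'' = ?nx" "rarr s' ''len'' = ?len" "rvar s' ''D'' = D"
      using D by (simp_all add: same_def)
    have I: "cluster_inv \<omega> K ?nx ?len D i (nvar s' ''c'') (rvar s' ''sum'') (narr s' ''cl'')"
      and x: "nvar s' ''x'' = (?nx ^^ i) 0" and u: "u \<le> t + 9 * i + 4" using 5 by auto
    note J = cluster_inv_step[OF I T D(2) 5(1) refl refl]
    show ?case
    proof (cases "D < rvar s' ''sum''")
      case True
      with J u x 5(1) show ?thesis by (simp add: c)
    next
      case False
      with J u x 5(1) show ?thesis by (simp add: c)
    qed
  next
    case (6 u s')
    then show ?case using cluster_inv_clustering[OF _ T n(2)] by auto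
  qed (use n D in \<open>auto simp: cluster_inv_def same_def\<close>)
  then have "wp (For ''i'' (NVar ''n'') ?c) (wp (NAssign ''N'' (NAdd (NVar ''c'') (NConst 1)))
    (\<lambda>t' s'. t' \<le> t + 9 * n + 6 \<and> clustering \<omega> n K M D (nvar s' ''N'') (narr s' ''cl''))) (t + 3) ?s"
    by (rule wp_consequence) simp
  then show ?thesis by (simp add: build_clusters_def eval_nat_numeral)
qed

subsection \<open>Incremental hop distances\<close>

text \<open>The sound half of a truncated distance row: a value below \<open>2 * k\<close> is
  witnessed by a walk of that length. The value \<open>2 * k\<close> claims nothing.\<close>

definition dist_inv :: "nat \<Rightarrow> nat \<Rightarrow> nat set set \<Rightarrow> nat \<Rightarrow> (nat \<Rightarrow> nat) \<Rightarrow> bool" where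
  "dist_inv k N G s f \<longleftrightarrow>
     f s = 0 \<and> (\<forall>v<N. f v \<le> 2 * k \<and> (f v < 2 * k \<longrightarrow> (s, v) \<in> adj_rel G ^^ f v))"

text \<open>The complementary half: with \<open>f s = 0\<close> and \<open>Z\<close> empty,
  \<open>f\<close> is a lower bound for hop distances. \<open>Z\<close> holds the oriented pairs
  that are still allowed to violate this during an update.\<close>

definition relaxed :: "nat set set \<Rightarrow> (nat \<Rightarrow> nat) \<Rightarrow> (nat \<times> nat) set \<Rightarrow> bool" where
  "relaxed G f Z \<longleftrightarrow> (\<forall>x y. {x, y} \<in> G \<longrightarrow> (x, y) \<in> Z \<or> f y \<le> Suc (f x))"

text \<open>Lowering \<open>f v\<close> by one releases \<open>Suc (dg v)\<close> units, enough for
  one scan of the neighbours of \<open>v\<close> including its overhead.\<close>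

definition potential :: "nat \<Rightarrow> (nat \<Rightarrow> nat) \<Rightarrow> (nat \<Rightarrow> nat) \<Rightarrow> nat" where
  "potential N dg f = (\<Sum>v<N. f v * Suc (dg v))"

lemma dist_inv_mono: "dist_inv k N G s f \<Longrightarrow> G \<subseteq> H \<Longrightarrow> dist_inv k N H s f"
  unfolding dist_inv_def by (meson adj_rel_mono relpow_mono')

lemma dist_inv_cong:
  assumes "dist_inv k N G s f" "s < N" "\<And>v. v < N \<Longrightarrow> g v = f v"
  shows "dist_inv k N G s g"
  using assms by (simp add: dist_inv_def)

lemma relaxed_cong:
  assumes "relaxed G f Z" "simple_on {..<N} G" "\<And>v. v < N \<Longrightarrow> g v = f v"
  shows "relaxed G g Z"
  unfolding relaxed_def
proof (intro allI impI)
  fix x y assume xy: "{x, y} \<in> G"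
  then have "x < N" "y < N" using simple_on_edge[OF assms(2)] by blast+
  then show "(x, y) \<in> Z \<or> g y \<le> Suc (g x)" using assms xy by (simp add: relaxed_def)
qed

lemma relaxed_dist_le:
  assumes "relaxed G f {}" "f s = 0"
  shows "(s, v) \<in> adj_rel G ^^ j \<Longrightarrow> f v \<le> j"
proof (induction j arbitrary: v)
  case (Suc j)
  from Suc.prems obtain u where u: "(s, u) \<in> adj_rel G ^^ j" "{u, v} \<in> G" by auto
  then have "f v \<le> Suc (f u)" using assms(1) by (auto simp: relaxed_def)
  with Suc.IH[OF u(1)] show ?case by simp
qed (use assms in simp)

lemma potential_update:
  assumes "y < N" "a < f y"
  shows "potential N dg (f(y := a)) + Suc (dg y) \<le> potential N dg f"
proof -
  have "(\<Sum>v\<in>{..<N} - {y}. (f(y := a)) v * Suc (dg v)) = (\<Sum>v\<in>{..<N} - {y}. f v * Suc (dg v))"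
    by (intro sum.cong) auto
  moreover have "(\<Sum>v<N. g v * Suc (dg v)) = g y * Suc (dg y) + (\<Sum>v\<in>{..<N} - {y}. g v * Suc (dg v))" for g
    using assms by (intro sum.remove) auto
  ultimately have "potential N dg f + a * Suc (dg y) = potential N dg (f(y := a)) + f y * Suc (dg y)"
    unfolding potential_def by (simp del: mult_Suc_right)
  moreover have "Suc a * Suc (dg y) \<le> f y * Suc (dg y)" using assms by (intro mult_le_mono1) simp
  ultimately show ?thesis by simp
qed

text \<open>The pairs in \<open>Z\<close> and those starting at a vertex on the stack may still be unrelaxed.
  The last but one conjunct is the amortised time bound.\<close>

definition prop_inv ::
  "nat \<Rightarrow> nat \<Rightarrow> nat set set \<Rightarrow> nat \<Rightarrow> (nat \<Rightarrow> nat) \<Rightarrow> nat \<Rightarrow> (nat \<Rightarrow> nat) \<Rightarrow> (nat \<times> nat) set \<Rightarrow> nat \<Rightarrow>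
   (nat \<Rightarrow> nat) \<Rightarrow> (nat \<Rightarrow> nat) \<Rightarrow> nat \<Rightarrow> nat \<Rightarrow> bool" where
  "prop_inv k N G s dg b d0 Z C d stk sp t \<longleftrightarrow>
     dist_inv k N G s (\<lambda>v. d (b + v)) \<and>
     relaxed G (\<lambda>v. d (b + v)) (stk ` {..<sp} \<times> UNIV \<union> Z) \<and> (\<forall>i<sp. stk i < N) \<and>
     t + 8 * (potential N dg (\<lambda>v. d (b + v)) + (\<Sum>i<sp. Suc (dg (stk i)))) \<le> C \<and>
     (\<forall>q. q < b \<or> b + N \<le> q \<longrightarrow> d q = d0 q)"

text \<open>Pairs may leave \<open>Z\<close> once they are relaxed or start on the stack. The
  condition on times says that the budget grows by at least as much as the clock.\<close>

lemma prop_inv_weaken: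
  assumes I: "prop_inv k N G s dg b d0 Z C d stk sp t"
    and Z: "\<And>x y. (x, y) \<in> Z \<Longrightarrow> {x, y} \<in> G \<Longrightarrow>
      x \<in> stk ` {..<sp} \<or> (x, y) \<in> Z' \<or> d (b + y) \<le> Suc (d (b + x))"
    and t: "t' + C \<le> t + C'"
  shows "prop_inv k N G s dg b d0 Z' C' d stk sp t'"
proof -
  have "relaxed G (\<lambda>v. d (b + v)) (stk ` {..<sp} \<times> UNIV \<union> Z')"
    unfolding relaxed_def
  proof (intro allI impI)
    fix x y assume xy: "{x, y} \<in> G"
    then have "(x, y) \<in> stk ` {..<sp} \<times> UNIV \<union> Z \<or> d (b + y) \<le> Suc (d (b + x))"
      using I unfolding prop_inv_def relaxed_def by blast
    with Z xy show "(x, y) \<in> stk ` {..<sp} \<times> UNIV \<union> Z' \<or> d (b + y) \<le> Suc (d (b + x))" by blast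
  qed
  with I t show ?thesis by (auto simp: prop_inv_def)
qed

text \<open>The decrease at \<open>y\<close> releases at least the amount charged for the new stack
  entry, so the sum in the time bound does not grow. Relaxation can break only for pairs leaving
  \<open>y\<close>, and \<open>y\<close> is now on the stack; entries may repeat there, each being
  charged separately.\<close>

lemma prop_inv_push:
  assumes I: "prop_inv k N G s dg b d0 Z C d stk sp t"
    and e: "{p, y} \<in> G" "p < N" "y < N" and lt: "Suc (d (b + p)) < d (b + y)"
    and t: "t' + C \<le> t + C'"
  shows "prop_inv k N G s dg b d0 (Z - {(p, y)}) C' (d(b + y := Suc (d (b + p)))) (stk(sp := y)) (Suc sp) t'"
proof -
  let ?f = "\<lambda>v. d (b + v)" and ?d = "d(b + y := Suc (d (b + p)))"
  have f: "(\<lambda>v. ?d (b + v)) = ?f(y := Suc (?f p))" by auto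
  have ne: "p \<noteq> y" using lt by auto
  note J = I[unfolded prop_inv_def]
  have "dist_inv k N G s (?f(y := Suc (?f p)))"
  proof -
    have D: "?f s = 0" "\<And>v. v < N \<Longrightarrow> ?f v \<le> 2 * k"
      "\<And>v. v < N \<Longrightarrow> ?f v < 2 * k \<Longrightarrow> (s, v) \<in> adj_rel G ^^ ?f v"
      using J by (auto simp: dist_inv_def)
    have "s \<noteq> y" using D(1) lt by auto
    have "?f p < 2 * k" "Suc (?f p) \<le> 2 * k" using D(2)[OF e(3)] lt by auto
    then have "(s, p) \<in> adj_rel G ^^ ?f p" using D(3) e(2) by blast
    then have "(s, y) \<in> adj_rel G ^^ Suc (?f p)" using e(1) by auto
    with D \<open>s \<noteq> y\<close> \<open>Suc (?f p) \<le> 2 * k\<close> show ?thesis by (auto simp: dist_inv_def)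
  qed
  moreover have "relaxed G (?f(y := Suc (?f p))) ((stk(sp := y)) ` {..<Suc sp} \<times> UNIV \<union> (Z - {(p, y)}))"
    unfolding relaxed_def
  proof (intro allI impI)
    fix u v assume uv: "{u, v} \<in> G"
    have S: "(stk(sp := y)) ` {..<Suc sp} = insert y (stk ` {..<sp})"
      by (auto simp: lessThan_Suc)
    from uv J have "(u, v) \<in> stk ` {..<sp} \<times> UNIV \<union> Z \<or> ?f v \<le> Suc (?f u)"
      unfolding relaxed_def by blast
    then show "(u, v) \<in> (stk(sp := y)) ` {..<Suc sp} \<times> UNIV \<union> (Z - {(p, y)}) \<or>
      (?f(y := Suc (?f p))) v \<le> Suc ((?f(y := Suc (?f p))) u)"
      unfolding S using ne lt by (cases "u = y"; cases "(u, v) = (p, y)") auto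
  qed
  moreover have "\<forall>i<Suc sp. (stk(sp := y)) i < N" using J e by (auto simp: less_Suc_eq)
  moreover have "t' + 8 * (potential N dg (?f(y := Suc (?f p))) + (\<Sum>i<Suc sp. Suc (dg ((stk(sp := y)) i)))) \<le> C'"
  proof -
    have "potential N dg (?f(y := Suc (?f p))) + Suc (dg y) \<le> potential N dg ?f"
      using e(3) lt by (rule potential_update)
    moreover have "(\<Sum>i<Suc sp. Suc (dg ((stk(sp := y)) i))) = (\<Sum>i<sp. Suc (dg (stk i))) + Suc (dg y)"
      by simp
    moreover have "t + 8 * (potential N dg ?f + (\<Sum>i<sp. Suc (dg (stk i)))) \<le> C" using J by blast
    moreover have "t' + 8 * (P' + S') \<le> C'"
      if "P' + e \<le> P" "S' = S + e" "t + 8 * (P + S) \<le> C" for P P' S S' e :: nat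
      using that t by simp
    ultimately show ?thesis by blast
  qed
  moreover have "\<forall>q. q < b \<or> b + N \<le> q \<longrightarrow> ?d q = d0 q" using J e by auto
  ultimately show ?thesis unfolding prop_inv_def f by blast
qed

section \<open>Propagating decreases through one row of the table\<close>

definition push_relax :: "name \<Rightarrow> name \<Rightarrow> com \<Rightarrow> com" where
  "push_relax p y c =
     Cond (NLess (NAdd (NGet ''d'' (NAdd (NVar ''rs'') (NVar p))) (NConst 1))
                 (NGet ''d'' (NAdd (NVar ''rs'') (NVar y))))
       (Seq (NStore ''d'' (NAdd (NVar ''rs'') (NVar y))
               (NAdd (NGet ''d'' (NAdd (NVar ''rs'') (NVar p))) (NConst 1)))
       (Seq (NStore ''stk'' (NVar ''sp'') (NVar y)) (inc ''sp''))) c"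

definition scan :: com where
  "scan = For ''j'' (NGet ''deg'' (NVar ''p''))
     (Seq (NAssign ''y'' (NGet ''adj'' (NAdd (NGet ''row'' (NVar ''p'')) (NVar ''j''))))
          (push_relax ''p'' ''y'' Skip))"

text \<open>The order of processing is irrelevant to the bound, since the potential pays for every
  decrease; a stack therefore serves as well as a queue.\<close>

definition propagate :: com where
  "propagate = While (NLess (NConst 0) (NVar ''sp''))
     (Seq (NAssign ''sp'' (NSub (NVar ''sp'') (NConst 1)))
     (Seq (NAssign ''p'' (NGet ''stk'' (NVar ''sp''))) scan))"

text \<open>Adjacency lists are stored with row stride \<open>n\<close>. The bijection excludes
  repetitions, so \<open>dg x\<close> is the degree and scan costs are proportional to it.\<close>

definition adj_rep :: "nat \<Rightarrow> nat \<Rightarrow> nat set set \<Rightarrow> (nat \<Rightarrow> nat) \<Rightarrow> (nat \<Rightarrow> nat) \<Rightarrow> bool" where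
  "adj_rep n N G adj dg \<longleftrightarrow> (\<forall>x<N. bij_betw (\<lambda>j. adj (x * n + j)) {..<dg x} (nbrs G x))"

text \<open>The exceptional set shrinks from all pairs starting at \<open>p\<close> to those whose
  second vertex has not been listed yet; after the last neighbour it contains no edge. A neighbour
  costs at most seven steps.\<close>

lemma wp_scan:
  assumes G: "simple_on {..<N} G" "adj_rep n N G (narr s ''adj'') (narr s ''deg'')"
    and row: "narr s ''row'' p = p * n" and p: "nvar s ''p'' = p" "p < N" and b: "nvar s ''rs'' = b"
    and I: "prop_inv k N G r (narr s ''deg'') b d0 ({p} \<times> UNIV) C (narr s ''d'') (narr s ''stk'') (nvar s ''sp'') t"
  shows "wp scan (\<lambda>t' s'. prop_inv k N G r (narr s ''deg'') b d0 {} (C + 7 * narr s ''deg'' p + 2)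
    (narr s' ''d'') (narr s' ''stk'') (nvar s' ''sp'') t') t s"
  unfolding scan_def
proof (rule wp_For[where N = "narr s ''deg'' p" and B = "C + 7 * narr s ''deg'' p + 1" and
   I = "\<lambda>i t' s'. prop_inv k N G r (narr s ''deg'') b d0 ({p} \<times> - (\<lambda>j. narr s ''adj'' (p * n + j)) ` {..<i})
     (C + 7 * i + 1) (narr s' ''d'') (narr s' ''stk'') (nvar s' ''sp'') t'"], goal_cases)
  case 4
  from I show ?case by (rule prop_inv_weaken) auto
next
  case (5 i u s')
  let ?dg = "narr s ''deg''" and ?A = "\<lambda>j. narr s ''adj'' (p * n + j)"
  have c: "narr s' ''adj'' = narr s ''adj''" "narr s' ''row'' p = p * n" "nvar s' ''p'' = p" "nvar s' ''rs'' = b"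
    using 5(4) row p b by (simp_all add: same_def push_relax_def)
  let ?y = "?A i"
  have "?y \<in> nbrs G p"
    using G(2) p 5(1) unfolding adj_rep_def bij_betw_def by blast
  then have e: "{p, ?y} \<in> G" by (simp add: nbrs_def)
  then have y: "?y < N" using simple_on_edge[OF G(1)] by blast
  have Z: "{p} \<times> - ?A ` {..<i} - {(p, ?y)} = {p} \<times> - ?A ` {..<Suc i}"
    by (auto simp: lessThan_Suc)
  have ub: "u \<le> C + 7 * ?dg p + 1" using 5(1,3) by (simp add: prop_inv_def)
  let ?d = "narr s' ''d''"
  show ?case
  proof (cases "Suc (?d (b + p)) < ?d (b + ?y)")
    case True
    have "prop_inv k N G r ?dg b d0 ({p} \<times> - ?A ` {..<Suc i}) (C + 7 * Suc i + 1)
      (?d(b + ?y := Suc (?d (b + p)))) ((narr s' ''stk'')(nvar s' ''sp'' := ?y)) (Suc (nvar s' ''sp'')) (u + 7)"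
      unfolding Z[symmetric] by (rule prop_inv_push[OF 5(3) e p(2) y True]) simp
    then show ?thesis using ub True 5(2) by (simp add: push_relax_def c eval_nat_numeral)
  next
    case False
    have "prop_inv k N G r ?dg b d0 ({p} \<times> - ?A ` {..<Suc i}) (C + 7 * Suc i + 1)
      ?d (narr s' ''stk'') (nvar s' ''sp'') (u + 5)"
      by (rule prop_inv_weaken[OF 5(3)]) (use False in \<open>auto simp: lessThan_Suc\<close>)
    then show ?thesis using ub False 5(2) by (simp add: push_relax_def c eval_nat_numeral)
  qed
next
  case (6 u s')
  have nb: "(\<lambda>j. narr s ''adj'' (p * n + j)) ` {..<narr s ''deg'' p} = nbrs G p"
    using G(2) p by (auto simp: adj_rep_def bij_betw_def)
  from 6(1) show ?case
    by (rule prop_inv_weaken) (unfold nb, auto simp: nbrs_def)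
qed (use p in \<open>auto simp: push_relax_def same_def\<close>)

lemma wp_propagate:
  assumes G: "simple_on {..<N} G" "adj_rep n N G (narr s ''adj'') (narr s ''deg'')"
    and row: "\<And>x. x < N \<Longrightarrow> narr s ''row'' x = x * n" and b: "nvar s ''rs'' = b"
    and I: "prop_inv k N G r (narr s ''deg'') b d0 {} C (narr s ''d'') (narr s ''stk'') (nvar s ''sp'') t"
  shows "wp propagate (\<lambda>t' s'. dist_inv k N G r (\<lambda>v. narr s' ''d'' (b + v)) \<and>
    relaxed G (\<lambda>v. narr s' ''d'' (b + v)) {} \<and>
    t' + 8 * potential N (narr s ''deg'') (\<lambda>v. narr s' ''d'' (b + v)) \<le> C + 1 \<and>
    (\<forall>q. q < b \<or> b + N \<le> q \<longrightarrow> narr s' ''d'' q = d0 q)) t s"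
  unfolding propagate_def
proof (rule wp_While[where B = C and I = "\<lambda>t' s'. prop_inv k N G r (narr s ''deg'') b d0 {} C
    (narr s' ''d'') (narr s' ''stk'') (nvar s' ''sp'') t'"], goal_cases)
  case 1
  show ?case by (rule I)
next
  case (2 u s')
  let ?dg = "narr s ''deg''" and ?d = "narr s' ''d''" and ?stk = "narr s' ''stk''"
  have c: "narr s' ''adj'' = narr s ''adj''" "narr s' ''row'' = narr s ''row''" "nvar s' ''rs'' = b"
    "narr s' ''deg'' = ?dg"
    using 2(2) b by (simp_all add: same_def scan_def push_relax_def)
  obtain sp where sp: "nvar s' ''sp'' = Suc sp" using 2(3) by (cases "nvar s' ''sp''") auto
  let ?p = "?stk sp"
  have J: "prop_inv k N G r ?dg b d0 {} C ?d ?stk (Suc sp) u" using 2(1) sp by simp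
  then have p: "?p < N" by (simp add: prop_inv_def)
  have le: "u + 8 * (potential N ?dg (\<lambda>v. ?d (b + v)) + ((\<Sum>i<sp. Suc (?dg (?stk i))) + Suc (?dg ?p))) \<le> C"
    using J by (simp add: prop_inv_def)
  \<comment> \<open>Popping \<open>?p\<close> frees \<open>8 * Suc (?dg ?p)\<close> units of the
    budget. The pop takes 3 steps and the scan at most \<open>7 * ?dg ?p + 2\<close>, which fits;
    this fixes the factor 8.\<close>
  define C' where "C' = C - 8 * Suc (?dg ?p)"
  have C: "C = C' + 8 * Suc (?dg ?p)" using le unfolding C'_def by simp
  have pop: "prop_inv k N G r ?dg b d0 ({?p} \<times> UNIV) (C' + 3) ?d ?stk sp (u + 3)"
  proof -
    have "relaxed G (\<lambda>v. ?d (b + v)) (?stk ` {..<sp} \<times> UNIV \<union> {?p} \<times> UNIV)"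
      using J unfolding prop_inv_def by (simp add: lessThan_Suc Un_commute Sigma_Un_distrib1[symmetric])
    then show ?thesis using J le C by (simp add: prop_inv_def)
  qed
  let ?s = "s'\<lparr>nvar := (nvar s')(''sp'' := sp, ''p'' := ?p)\<rparr>"
  have "wp scan (\<lambda>t' s''. prop_inv k N G r ?dg b d0 {} C (narr s'' ''d'') (narr s'' ''stk'') (nvar s'' ''sp'') t')
    (u + 3) ?s"
  proof (rule wp_consequence[OF wp_scan[where p = ?p and k = k and N = N and G = G and n = n and r = r and b = b
        and ?d0.0 = d0 and C = "C' + 3"]], goal_cases)
    case (8 t' s'')
    have "prop_inv k N G r ?dg b d0 {} (C' + 3 + 7 * ?dg ?p + 2)
      (narr s'' ''d'') (narr s'' ''stk'') (nvar s'' ''sp'') t'" using 8(1) c by simp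
    then show ?case by (rule prop_inv_weaken) (use C in auto)
  qed (use G row c p pop in simp_all)
  moreover have "u \<le> C" using le by simp
  ultimately show ?case by (simp add: sp eval_nat_numeral)
next
  case (3 u s')
  then show ?case by (simp add: prop_inv_def)
qed

definition update_row :: com where
  "update_row =
     Seq (NAssign ''rs'' (NGet ''row'' (NVar ''s''))) (Seq (NAssign ''sp'' (NConst 0))
     (Seq (push_relax ''ca'' ''cb'' (push_relax ''cb'' ''ca'' Skip)) propagate))"

text \<open>Only the two orientations of the new edge can be unrelaxed, and at most one is, since
  both strict inequalities together are contradictory. Correcting that one seeds the
  propagation.\<close>

lemma wp_update_row:
  assumes G: "simple_on {..<N} (insert {a, c} G)"
      "adj_rep n N (insert {a, c} G) (narr s ''adj'') (narr s ''deg'')"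
    and row: "\<And>x. x < N \<Longrightarrow> narr s ''row'' x = x * n"
    and v: "nvar s ''s'' = r" "r < N" "nvar s ''ca'' = a" "nvar s ''cb'' = c"
    and D: "dist_inv k N G r (\<lambda>v. narr s ''d'' (r * n + v))" "relaxed G (\<lambda>v. narr s ''d'' (r * n + v)) {}"
  shows "wp update_row (\<lambda>t' s'. dist_inv k N (insert {a, c} G) r (\<lambda>v. narr s' ''d'' (r * n + v)) \<and>
    relaxed (insert {a, c} G) (\<lambda>v. narr s' ''d'' (r * n + v)) {} \<and>
    t' + 8 * potential N (narr s ''deg'') (\<lambda>v. narr s' ''d'' (r * n + v)) \<le>
      t + 8 * potential N (narr s ''deg'') (\<lambda>v. narr s ''d'' (r * n + v)) + 8 \<and>
    (\<forall>q. q < r * n \<or> r * n + N \<le> q \<longrightarrow> narr s' ''d'' q = narr s ''d'' q)) t s"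
proof -
  let ?G = "insert {a, c} G" and ?d = "narr s ''d''" and ?b = "r * n" and ?dg = "narr s ''deg''"
  have lt: "a < N" "c < N" using simple_on_edge[OF G(1), of a c] by auto
  let ?C = "t + 7 + 8 * potential N ?dg (\<lambda>v. ?d (?b + v))"
  have start: "prop_inv k N ?G r ?dg ?b ?d {(a, c), (c, a)} ?C ?d (narr s ''stk'') 0 (t + 7)"
    using dist_inv_mono[OF D(1), of ?G] D(2)
    by (auto simp: prop_inv_def relaxed_def doubleton_eq_iff)
  define Q where "Q = (\<lambda>t' (s' :: state). dist_inv k N ?G r (\<lambda>v. narr s' ''d'' (?b + v)) \<and>
    relaxed ?G (\<lambda>v. narr s' ''d'' (?b + v)) {} \<and>
    t' + 8 * potential N ?dg (\<lambda>v. narr s' ''d'' (?b + v)) \<le>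
      t + 8 * potential N ?dg (\<lambda>v. ?d (?b + v)) + 8 \<and>
    (\<forall>q. q < ?b \<or> ?b + N \<le> q \<longrightarrow> narr s' ''d'' q = ?d q))"
  have run: "wp propagate Q t1 s1"
    if "prop_inv k N ?G r ?dg ?b ?d {} ?C (narr s1 ''d'') (narr s1 ''stk'') (nvar s1 ''sp'') t1"
      "narr s1 ''adj'' = narr s ''adj''" "narr s1 ''deg'' = ?dg" "narr s1 ''row'' = narr s ''row''"
      "nvar s1 ''rs'' = ?b" for t1 s1
  proof (rule wp_consequence[OF wp_propagate[where k = k and N = N and G = ?G and n = n and r = r and b = ?b
        and ?d0.0 = ?d and C = ?C]], goal_cases)
    case (6 t' s')
    then show ?case using that by (simp add: Q_def)
  qed (use that G row in simp_all)
  have b: "narr s ''row'' (nvar s ''s'') = ?b" using row v by simp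
  have ca: "{c, a} \<in> ?G" "{a, c} \<in> ?G" by (auto simp: insert_commute)
  consider (ac) "Suc (?d (?b + a)) < ?d (?b + c)"
    | (ca) "\<not> Suc (?d (?b + a)) < ?d (?b + c)" "Suc (?d (?b + c)) < ?d (?b + a)"
    | (none) "\<not> Suc (?d (?b + a)) < ?d (?b + c)" "\<not> Suc (?d (?b + c)) < ?d (?b + a)" by blast
  then show ?thesis
  proof cases
    case ac
    have "prop_inv k N ?G r ?dg ?b ?d ({(a, c), (c, a)} - {(a, c)}) ?C (?d(?b + c := Suc (?d (?b + a))))
      ((narr s ''stk'')(0 := c)) (Suc 0) (t + 6)"
      by (rule prop_inv_push[OF start ca(2) lt ac]) simp
    then have "prop_inv k N ?G r ?dg ?b ?d {} ?C (?d(?b + c := Suc (?d (?b + a))))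
      ((narr s ''stk'')(0 := c)) (Suc 0) (t + 6)"
      by (rule prop_inv_weaken) auto
    then have "wp propagate Q (t + 6) (s\<lparr>narr := (narr s)(''d'' := ?d(?b + c := Suc (?d (?b + a))), ''stk'' := (narr s ''stk'')(0 := c)),
        nvar := (nvar s)(''rs'' := ?b, ''sp'' := Suc 0)\<rparr>)"
      by (intro run) simp_all
    then have "wp update_row Q t s"
      using ac v b by (simp add: update_row_def push_relax_def eval_nat_numeral)
    then show ?thesis by (simp add: Q_def)
  next
    case ca
    have "prop_inv k N ?G r ?dg ?b ?d ({(a, c), (c, a)} - {(c, a)}) ?C (?d(?b + a := Suc (?d (?b + c))))
      ((narr s ''stk'')(0 := a)) (Suc 0) (t + 7)"
      by (rule prop_inv_push[OF start \<open>{c, a} \<in> ?G\<close> lt(2,1) ca(2)]) simp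
    then have "prop_inv k N ?G r ?dg ?b ?d {} ?C (?d(?b + a := Suc (?d (?b + c))))
      ((narr s ''stk'')(0 := a)) (Suc 0) (t + 7)"
      by (rule prop_inv_weaken) auto
    then have "wp propagate Q (t + 7) (s\<lparr>narr := (narr s)(''d'' := ?d(?b + a := Suc (?d (?b + c))), ''stk'' := (narr s ''stk'')(0 := a)),
        nvar := (nvar s)(''rs'' := ?b, ''sp'' := Suc 0)\<rparr>)"
      by (intro run) simp_all
    then have "wp update_row Q t s"
      using ca v b by (simp add: update_row_def push_relax_def eval_nat_numeral)
    then show ?thesis by (simp add: Q_def)
  next
    case none
    have "prop_inv k N ?G r ?dg ?b ?d {} ?C ?d (narr s ''stk'') 0 (t + 5)"
      by (rule prop_inv_weaken[OF start]) (use none in auto)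
    then have "wp propagate Q (t + 5) (s\<lparr>nvar := (nvar s)(''rs'' := ?b, ''sp'' := 0)\<rparr>)"
      by (intro run) simp_all
    then have "wp update_row Q t s"
      using none v b by (simp add: update_row_def push_relax_def eval_nat_numeral)
    then show ?thesis by (simp add: Q_def)
  qed
qed

lemma index_inj:
  fixes x y i j n :: nat
  assumes "x * n + i = y * n + j" "i < n" "j < n"
  shows "x = y \<and> i = j"
proof -
  have "(x * n + i) div n = x" "(y * n + j) div n = y" using assms(2,3) by simp_all
  then have "x = y" using assms(1) by metis
  with assms(1) show ?thesis by simp
qed

lemma row_disjoint:
  fixes x y i n N :: nat
  assumes "x \<noteq> y" "i < N" "N \<le> n"
  shows "x * n + i < y * n \<or> y * n + N \<le> x * n + i"
proof (rule ccontr)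
  assume "\<not> ?thesis"
  then have "y * n \<le> x * n + i" "x * n + i - y * n < N" by auto
  then have "x * n + i = y * n + (x * n + i - y * n)" "x * n + i - y * n < n" using assms by auto
  with index_inj[of x n i y "x * n + i - y * n"] assms show False by auto
qed

section \<open>The distance table and adjacency arrays of the cluster graph\<close>

definition graph_rep ::
  "nat \<Rightarrow> nat \<Rightarrow> nat \<Rightarrow> nat set set \<Rightarrow> (nat \<Rightarrow> nat) \<Rightarrow> (nat \<Rightarrow> nat) \<Rightarrow> (nat \<Rightarrow> nat) \<Rightarrow> bool" where
  "graph_rep k n N G d adj dg \<longleftrightarrow>
     N \<le> n \<and> simple_on {..<N} G \<and> high_girth k G \<and> adj_rep n N G adj dg \<and>
     (\<forall>r<N. dist_inv k N G r (\<lambda>v. d (r * n + v)) \<and> relaxed G (\<lambda>v. d (r * n + v)) {})"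

definition total_potential :: "nat \<Rightarrow> nat \<Rightarrow> (nat \<Rightarrow> nat) \<Rightarrow> (nat \<Rightarrow> nat) \<Rightarrow> nat" where
  "total_potential n N dg d = (\<Sum>r<N. potential N dg (\<lambda>v. d (r * n + v)))"

text \<open>A relaxed row bounds hop distances from below, so an entry that is not below
  \<open>2 * k\<close> certifies that no shorter walk exists. This supplies the girth condition when
  the edge is added.\<close>

lemma graph_rep_far:
  assumes "graph_rep k n N G d adj dg" "a < N" "\<not> d (a * n + b) < 2 * k" "j < 2 * k"
  shows "(a, b) \<notin> adj_rel G ^^ j"
  using assms relaxed_dist_le[of G "\<lambda>v. d (a * n + v)" a b j]
  by (auto simp: graph_rep_def dist_inv_def)

lemma graph_rep_near:
  assumes "graph_rep k n N G d adj dg" "a < N" "b < N" "d (a * n + b) < 2 * k"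
  shows "(a, b) \<in> adj_rel G ^^ d (a * n + b)"
  using assms by (auto simp: graph_rep_def dist_inv_def)

lemma bij_betw_append:
  assumes "bij_betw f {..<m} A" "v \<notin> A"
  shows "bij_betw (f(m := v)) {..<Suc m} (insert v A)"
proof -
  have "inj_on f {..<m}" "f ` {..<m} = A" using assms(1) by (auto simp: bij_betw_def)
  then have "inj_on (f(m := v)) {..<Suc m}"
    using assms(2) by (auto simp: inj_on_def less_Suc_eq)
  moreover have "(f(m := v)) ` {..<Suc m} = insert v A"
    using \<open>f ` {..<m} = A\<close> by (auto simp: lessThan_Suc)
  ultimately show ?thesis by (simp add: bij_betw_def)
qed

lemma adj_rep_deg_less:
  assumes "adj_rep n N G adj dg" "simple_on {..<N} G" "x < N"
  shows "dg x < N"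
proof -
  have "dg x = card (nbrs G x)"
    using assms unfolding adj_rep_def by (metis bij_betw_same_card card_lessThan)
  also have "\<dots> \<le> card ({..<N} - {x})"
    using nbrs_subset[OF assms(2)] by (intro card_mono) auto
  also have "\<dots> < N" using assms(3) by simp
  finally show ?thesis .
qed

text \<open>A degree in a simple graph on \<open>N \<le> n\<close> vertices is below
  \<open>n\<close>, so the slot behind the last neighbour still belongs to the same row.\<close>

lemma adj_rep_insert:
  assumes A: "adj_rep n N G adj dg" and G: "simple_on {..<N} G" and ab: "a < N" "b < N" "a \<noteq> b"
    and new: "{a, b} \<notin> G" and N: "N \<le> n"
  shows "adj_rep n N (insert {a, b} G)
    (adj(a * n + dg a := b, b * n + dg b := a)) (dg(a := Suc (dg a), b := Suc (dg b)))"
  unfolding adj_rep_def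
proof (intro allI impI)
  fix x assume x: "x < N"
  let ?adj = "adj(a * n + dg a := b, b * n + dg b := a)" and ?dg = "dg(a := Suc (dg a), b := Suc (dg b))"
  have lt: "dg y < n" if "y < N" for y using adj_rep_deg_less[OF A G that] N by simp
  have bij: "bij_betw (\<lambda>j. adj (x * n + j)) {..<dg x} (nbrs G x)" using A x by (simp add: adj_rep_def)
  have pos: "x * n + j = y * n + dg y \<longleftrightarrow> x = y \<and> j = dg y" if "j < n" "y < N" for j y
    using index_inj[of x n j y "dg y"] that lt[of y] by auto
  have adj: "?adj (x * n + j) = (if x = a \<and> j = dg a then b else if x = b \<and> j = dg b then a else adj (x * n + j))"
    if "j < n" for j
    using that ab by (simp add: pos)
  have app: "bij_betw (\<lambda>j. ?adj (x * n + j)) {..<Suc (dg x)} (insert v (nbrs G x))"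
    if "v \<notin> nbrs G x" and at: "?adj (x * n + dg x) = v"
      and below: "\<And>j. j < dg x \<Longrightarrow> ?adj (x * n + j) = adj (x * n + j)" for v
  proof -
    have base: "bij_betw ((\<lambda>j. adj (x * n + j))(dg x := v)) {..<Suc (dg x)} (insert v (nbrs G x))"
      using bij that(1) by (rule bij_betw_append)
    have eq: "?adj (x * n + j) = ((\<lambda>j. adj (x * n + j))(dg x := v)) j" if "j \<in> {..<Suc (dg x)}" for j
    proof (cases "j = dg x")
      case True
      then show ?thesis by (simp only: at fun_upd_same)
    next
      case False
      with that have "j < dg x" by simp
      from below[OF this] have "?adj (x * n + j) = adj (x * n + j)" .
      also have "\<dots> = ((\<lambda>j. adj (x * n + j))(dg x := v)) j" by (rule fun_upd_other[OF False, symmetric])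
      finally show ?thesis .
    qed
    show ?thesis using base by (subst bij_betw_cong[OF eq])
  qed
  have small: "j < n" if "j \<le> dg x" for j using that lt[OF x] by simp
  consider "x = a" | "x = b" | "x \<noteq> a" "x \<noteq> b" by blast
  then show "bij_betw (\<lambda>j. ?adj (x * n + j)) {..<?dg x} (nbrs (insert {a, b} G) x)"
  proof cases
    case 1
    have "nbrs (insert {a, b} G) x = insert b (nbrs G x)" using 1 ab(3) by (auto simp: nbrs_def doubleton_eq_iff)
    moreover have "bij_betw (\<lambda>j. ?adj (x * n + j)) {..<Suc (dg x)} (insert b (nbrs G x))"
    proof (rule app)
      show "b \<notin> nbrs G x" using new 1 by (simp add: nbrs_def)
      show "?adj (x * n + dg x) = b" using adj[OF small[of "dg x"]] 1 by simp
      show "?adj (x * n + j) = adj (x * n + j)" if "j < dg x" for j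
        using adj[OF small[of j]] 1 that ab by simp
    qed
    ultimately show ?thesis using 1 ab by simp
  next
    case 2
    have "nbrs (insert {a, b} G) x = insert a (nbrs G x)" using 2 ab(3) by (auto simp: nbrs_def doubleton_eq_iff)
    moreover have "bij_betw (\<lambda>j. ?adj (x * n + j)) {..<Suc (dg x)} (insert a (nbrs G x))"
    proof (rule app)
      show "a \<notin> nbrs G x" using new 2 by (simp add: nbrs_def insert_commute)
      show "?adj (x * n + dg x) = a" using adj[OF small[of "dg x"]] 2 ab by simp
      show "?adj (x * n + j) = adj (x * n + j)" if "j < dg x" for j
        using adj[OF small[of j]] 2 that ab by simp
    qed
    ultimately show ?thesis using 2 ab by simp
  next
    case 3
    have "nbrs (insert {a, b} G) x = nbrs G x" using 3 by (auto simp: nbrs_def doubleton_eq_iff)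
    moreover have eq: "?adj (x * n + j) = adj (x * n + j)" if "j \<in> {..<dg x}" for j
      using adj[OF small[of j]] 3 that by simp
    have "bij_betw (\<lambda>j. ?adj (x * n + j)) {..<dg x} (nbrs G x)"
      using bij by (subst bij_betw_cong[OF eq])
    ultimately show ?thesis using 3 by simp
  qed
qed

lemma potential_deg_insert:
  assumes "a < N" "b < N" "a \<noteq> b" "f a \<le> L" "f b \<le> L"
  shows "potential N (dg(a := Suc (dg a), b := Suc (dg b))) f \<le> potential N dg f + 2 * L"
proof -
  let ?dg = "dg(a := Suc (dg a), b := Suc (dg b))"
  have split: "potential N g f = f a * Suc (g a) + (f b * Suc (g b) + (\<Sum>v\<in>{..<N} - {a} - {b}. f v * Suc (g v)))" for g
    unfolding potential_def using assms
    by (subst sum.remove[of _ a], simp, simp, subst sum.remove[of _ b]) auto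
  have "(\<Sum>v\<in>{..<N} - {a} - {b}. f v * Suc (?dg v)) = (\<Sum>v\<in>{..<N} - {a} - {b}. f v * Suc (dg v))"
    by (intro sum.cong) auto
  with split[of ?dg] split[of dg] assms show ?thesis by simp
qed

definition insert_adj :: com where
  "insert_adj =
     Seq (NStore ''adj'' (NAdd (NGet ''row'' (NVar ''ca'')) (NGet ''deg'' (NVar ''ca''))) (NVar ''cb''))
     (Seq (NStore ''adj'' (NAdd (NGet ''row'' (NVar ''cb'')) (NGet ''deg'' (NVar ''cb''))) (NVar ''ca''))
     (Seq (NStore ''deg'' (NVar ''ca'') (NAdd (NGet ''deg'' (NVar ''ca'')) (NConst 1)))
          (NStore ''deg'' (NVar ''cb'') (NAdd (NGet ''deg'' (NVar ''cb'')) (NConst 1)))))"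

definition add_edge :: com where
  "add_edge = Seq insert_adj (For ''s'' (NVar ''N'') update_row)"

lemma nvars_of_update_row:
  "nvars_of update_row = {''rs'', ''sp'', ''p'', ''j'', ''y''}" "rvars_of update_row = {}"
  "narrs_of update_row = {''d'', ''stk''}" "rarrs_of update_row = {}"
  by (auto simp: update_row_def push_relax_def propagate_def scan_def)

text \<open>Rows below the counter describe the enlarged graph, the others still the old one, while
  the adjacency arrays contain the new edge from the start. Rows occupy disjoint parts of
  \<open>d\<close>, so repairing one leaves the potential of the others alone. The overhead of a row
  is 8 steps plus 2 for the loop.\<close>

lemma wp_update_rows:
  assumes G: "simple_on {..<N} (insert {a, c} G)"
      "adj_rep n N (insert {a, c} G) (narr s ''adj'') (narr s ''deg'')"
    and row: "\<And>x. x < N \<Longrightarrow> narr s ''row'' x = x * n" and N: "N \<le> n" "nvar s ''N'' = N"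
    and v: "nvar s ''ca'' = a" "nvar s ''cb'' = c"
    and D: "\<And>r. r < N \<Longrightarrow> dist_inv k N G r (\<lambda>v. narr s ''d'' (r * n + v))"
      "\<And>r. r < N \<Longrightarrow> relaxed G (\<lambda>v. narr s ''d'' (r * n + v)) {}"
  shows "wp (For ''s'' (NVar ''N'') update_row) (\<lambda>t' s'. (\<forall>r<N.
     dist_inv k N (insert {a, c} G) r (\<lambda>v. narr s' ''d'' (r * n + v)) \<and>
     relaxed (insert {a, c} G) (\<lambda>v. narr s' ''d'' (r * n + v)) {}) \<and>
     t' + 8 * total_potential n N (narr s ''deg'') (narr s' ''d'') \<le>
       t + 8 * total_potential n N (narr s ''deg'') (narr s ''d'') + 10 * N + 2) t s"
proof -
  let ?G = "insert {a, c} G" and ?dg = "narr s ''deg''"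
  let ?C = "t + 8 * total_potential n N ?dg (narr s ''d'') + 1"
  have G0: "simple_on {..<N} G" using G(1) by (rule simple_on_subset) auto
  show ?thesis
  proof (rule wp_For[where N = N and B = "?C + 10 * N" and I = "\<lambda>i t' s'.
      (\<forall>r<N. i \<le> r \<longrightarrow> dist_inv k N G r (\<lambda>v. narr s' ''d'' (r * n + v)) \<and>
        relaxed G (\<lambda>v. narr s' ''d'' (r * n + v)) {}) \<and>
      (\<forall>r<i. dist_inv k N ?G r (\<lambda>v. narr s' ''d'' (r * n + v)) \<and>
        relaxed ?G (\<lambda>v. narr s' ''d'' (r * n + v)) {}) \<and>
      t' + 8 * total_potential n N ?dg (narr s' ''d'') \<le> ?C + 10 * i"], goal_cases)
    case (5 i u s')
    have c: "narr s' ''adj'' = narr s ''adj''" "narr s' ''row'' = narr s ''row''" "narr s' ''deg'' = ?dg"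
      "nvar s' ''ca'' = a" "nvar s' ''cb'' = c"
      using 5(4) v by (simp_all add: same_def nvars_of_update_row)
    let ?d = "narr s' ''d''"
    have todo: "\<And>r. r < N \<Longrightarrow> i \<le> r \<Longrightarrow> dist_inv k N G r (\<lambda>v. ?d (r * n + v)) \<and> relaxed G (\<lambda>v. ?d (r * n + v)) {}"
      and dn: "\<And>r. r < i \<Longrightarrow> dist_inv k N ?G r (\<lambda>v. ?d (r * n + v)) \<and> relaxed ?G (\<lambda>v. ?d (r * n + v)) {}"
      and u: "u + 8 * total_potential n N ?dg ?d \<le> ?C + 10 * i"
      using 5(3) by blast+
    have "u \<le> ?C + 10 * N" using u 5(1) by simp
    moreover have "wp update_row (\<lambda>t' s''.
      (\<forall>r<N. Suc i \<le> r \<longrightarrow> dist_inv k N G r (\<lambda>v. narr s'' ''d'' (r * n + v)) \<and>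
        relaxed G (\<lambda>v. narr s'' ''d'' (r * n + v)) {}) \<and>
      (\<forall>r<Suc i. dist_inv k N ?G r (\<lambda>v. narr s'' ''d'' (r * n + v)) \<and>
        relaxed ?G (\<lambda>v. narr s'' ''d'' (r * n + v)) {}) \<and>
      Suc t' + 8 * total_potential n N ?dg (narr s'' ''d'') \<le> ?C + 10 * Suc i) (Suc u) s'"
    proof (rule wp_consequence[OF wp_update_row[where a = a and c = c and G = G and n = n and N = N and r = i and k = k]], goal_cases)
      case (10 t' s'')
      let ?d' = "narr s'' ''d''"
      have post: "dist_inv k N ?G i (\<lambda>v. ?d' (i * n + v))" "relaxed ?G (\<lambda>v. ?d' (i * n + v)) {}"
        "t' + 8 * potential N ?dg (\<lambda>v. ?d' (i * n + v)) \<le> Suc u + 8 * potential N ?dg (\<lambda>v. ?d (i * n + v)) + 8"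
        and frame: "\<And>q. q < i * n \<or> i * n + N \<le> q \<Longrightarrow> ?d' q = ?d q"
        using 10(1) unfolding c by blast+
      have eq: "?d' (r * n + v) = ?d (r * n + v)" if "r \<noteq> i" "v < N" for r v
        by (rule frame[OF row_disjoint[OF that N(1)]])
      have "dist_inv k N G r (\<lambda>v. ?d' (r * n + v)) \<and> relaxed G (\<lambda>v. ?d' (r * n + v)) {}"
        if r: "r < N" "Suc i \<le> r" for r
      proof -
        have "r \<noteq> i" using r by simp
        then show ?thesis
          using todo[of r] r eq[of r] dist_inv_cong[of k N G r "\<lambda>v. ?d (r * n + v)" "\<lambda>v. ?d' (r * n + v)"]
            relaxed_cong[OF _ G0, of "\<lambda>v. ?d (r * n + v)" "{}" "\<lambda>v. ?d' (r * n + v)"] by simp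
      qed
      moreover have "dist_inv k N ?G r (\<lambda>v. ?d' (r * n + v)) \<and> relaxed ?G (\<lambda>v. ?d' (r * n + v)) {}"
        if r: "r < Suc i" for r
      proof (cases "r = i")
        case False
        with r have "r < i" "r < N" using 5(1) by auto
        then show ?thesis
          using dn[of r] False eq[of r] dist_inv_cong[of k N ?G r "\<lambda>v. ?d (r * n + v)" "\<lambda>v. ?d' (r * n + v)"]
            relaxed_cong[OF _ G(1), of "\<lambda>v. ?d (r * n + v)" "{}" "\<lambda>v. ?d' (r * n + v)"] by simp
      qed (use post in simp)
      moreover have "Suc t' + 8 * total_potential n N ?dg ?d' \<le> ?C + 10 * Suc i"
      proof -
        have split: "total_potential n N ?dg e = potential N ?dg (\<lambda>v. e (i * n + v)) +
            (\<Sum>r\<in>{..<N} - {i}. potential N ?dg (\<lambda>v. e (r * n + v)))" for e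
          unfolding total_potential_def using 5(1) by (intro sum.remove) auto
        have "(\<Sum>r\<in>{..<N} - {i}. potential N ?dg (\<lambda>v. ?d' (r * n + v))) =
            (\<Sum>r\<in>{..<N} - {i}. potential N ?dg (\<lambda>v. ?d (r * n + v)))"
          using eq by (intro sum.cong) (auto simp: potential_def)
        then show ?thesis using post(3) u split[of ?d] split[of ?d'] by simp
      qed
      ultimately show ?case by blast
    qed (use G row c 5 todo in \<open>simp_all\<close>)
    ultimately show ?case by blast
  next
    case (6 u s')
    then show ?case by simp
  qed (use D N in \<open>auto simp: same_def nvars_of_update_row\<close>)
qed

text \<open>Insertion raises two degrees by one, hence the potential of each row by at most
  \<open>2 * (2 * k)\<close>. With the factor 8 and \<open>N\<close> rows this gives the term
  \<open>32 * k * N\<close>.\<close>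

lemma wp_add_edge:
  assumes R: "graph_rep k n N G (narr s ''d'') (narr s ''adj'') (narr s ''deg'')" and k: "1 \<le> k"
    and row: "\<And>x. x < N \<Longrightarrow> narr s ''row'' x = x * n" and N: "nvar s ''N'' = N"
    and v: "nvar s ''ca'' = a" "nvar s ''cb'' = c" "a < N" "c < N"
    and far: "\<not> narr s ''d'' (a * n + c) < 2 * k"
  shows "wp add_edge (\<lambda>t' s'. graph_rep k n N (insert {a, c} G) (narr s' ''d'') (narr s' ''adj'') (narr s' ''deg'') \<and>
     t' + 8 * total_potential n N (narr s' ''deg'') (narr s' ''d'') \<le>
       t + 8 * total_potential n N (narr s ''deg'') (narr s ''d'') + 32 * k * N + 10 * N + 6) t s"
proof -
  have R': "N \<le> n" "simple_on {..<N} G" "high_girth k G" "adj_rep n N G (narr s ''adj'') (narr s ''deg'')"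
    "\<And>r. r < N \<Longrightarrow> dist_inv k N G r (\<lambda>v. narr s ''d'' (r * n + v))"
    "\<And>r. r < N \<Longrightarrow> relaxed G (\<lambda>v. narr s ''d'' (r * n + v)) {}"
    using R by (auto simp: graph_rep_def)
  \<comment> \<open>Distance at least \<open>2 * k\<close> excludes zero hops, so the ends differ,
    and one hop, so the edge is new.\<close>
  have "(a, c) \<notin> adj_rel G ^^ 0" "(a, c) \<notin> adj_rel G ^^ 1"
    using graph_rep_far[OF R v(3) far, of 0] graph_rep_far[OF R v(3) far, of 1] k by linarith+
  then have ne: "a \<noteq> c" and new: "{a, c} \<notin> G" by auto
  let ?G = "insert {a, c} G" and ?d = "narr s ''d''" and ?dg = "narr s ''deg''"
  let ?adj' = "(narr s ''adj'')(a * n + ?dg a := c, c * n + ?dg c := a)"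
  let ?dg' = "?dg(a := Suc (?dg a), c := Suc (?dg c))"
  have G': "simple_on {..<N} ?G" using R'(2) v ne by (auto simp: simple_on_def)
  have girth: "high_girth k ?G" using R'(3) graph_rep_far[OF R v(3) far] by (rule high_girth_insert)
  have adj: "adj_rep n N ?G ?adj' ?dg'"
    using R'(4,2) v(3,4) ne new R'(1) by (rule adj_rep_insert)
  have "total_potential n N ?dg' ?d \<le> (\<Sum>r<N. potential N ?dg (\<lambda>v. ?d (r * n + v)) + 2 * (2 * k))"
    unfolding total_potential_def
  proof (intro sum_mono potential_deg_insert v(3,4) ne)
    fix r assume "r \<in> {..<N}"
    then have "dist_inv k N G r (\<lambda>v. ?d (r * n + v))" using R'(5) by simp
    then show "?d (r * n + a) \<le> 2 * k" "?d (r * n + c) \<le> 2 * k" using v by (auto simp: dist_inv_def)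
  qed
  also have "\<dots> = total_potential n N ?dg ?d + 4 * k * N"
    by (simp add: total_potential_def sum.distrib)
  finally have pot: "total_potential n N ?dg' ?d \<le> total_potential n N ?dg ?d + 4 * k * N" .
  let ?s = "s\<lparr>narr := (narr s)(''adj'' := ?adj', ''deg'' := ?dg')\<rparr>"
  have "wp (For ''s'' (NVar ''N'') update_row)
    (\<lambda>t' s'. graph_rep k n N ?G (narr s' ''d'') (narr s' ''adj'') (narr s' ''deg'') \<and>
     t' + 8 * total_potential n N (narr s' ''deg'') (narr s' ''d'') \<le>
       t + 8 * total_potential n N ?dg ?d + 32 * k * N + 10 * N + 6) (t + 4) ?s"
  proof (rule wp_consequence[OF wp_update_rows[where a = a and c = c and G = G and n = n and N = N and k = k]], goal_cases)
    case (10 t' s')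
    have "narr s' ''adj'' = ?adj'" "narr s' ''deg'' = ?dg'"
      using 10(2) by (simp_all add: same_def nvars_of_update_row)
    with 10(1) pot G' girth adj R'(1) show ?case by (simp add: graph_rep_def)
  qed (use G' adj row R' N v in simp_all)
  then show ?thesis
    using v ne by (simp add: add_edge_def insert_adj_def row eval_nat_numeral)
qed

definition init_row :: com where
  "init_row =
     Seq (NStore ''deg'' (NVar ''x'') (NConst 0))
     (Seq (For ''y'' (NVar ''N'') (NStore ''d'' (NAdd (NGet ''row'' (NVar ''x'')) (NVar ''y'')) (NVar ''kk'')))
          (NStore ''d'' (NAdd (NGet ''row'' (NVar ''x'')) (NVar ''x'')) (NConst 0)))"

definition init_dist :: com where
  "init_dist = For ''x'' (NVar ''N'') init_row"

lemma wp_init_row: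
  assumes x: "nvar s ''x'' = x" "x < N" and N: "nvar s ''N'' = N" "N \<le> n" and row: "narr s ''row'' x = x * n"
  shows "wp init_row (\<lambda>t' s'. t' = t + 3 * N + 4 \<and> narr s' ''deg'' = (narr s ''deg'')(x := 0) \<and>
    (\<forall>y<N. narr s' ''d'' (x * n + y) = (if y = x then 0 else nvar s ''kk'')) \<and>
    (\<forall>q. q < x * n \<or> x * n + N \<le> q \<longrightarrow> narr s' ''d'' q = narr s ''d'' q)) t s"
    (is "wp _ ?Q t s")
proof -
  let ?s = "s\<lparr>narr := (narr s)(''deg'' := (narr s ''deg'')(x := 0))\<rparr>"
  have "wp (For ''y'' (NVar ''N'') (NStore ''d'' (NAdd (NGet ''row'' (NVar ''x'')) (NVar ''y'')) (NVar ''kk'')))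
    (\<lambda>t' s'. t' = t + 3 * N + 3 \<and> (\<forall>y<N. narr s' ''d'' (x * n + y) = nvar s ''kk'') \<and>
      (\<forall>q. q < x * n \<or> x * n + N \<le> q \<longrightarrow> narr s' ''d'' q = narr s ''d'' q)) (Suc t) ?s"
  proof (rule wp_For[where N = N and B = "t + 3 * N + 2" and I = "\<lambda>i t' s'. t' = t + 3 * i + 2 \<and>
      (\<forall>y<i. narr s' ''d'' (x * n + y) = nvar s ''kk'') \<and>
      (\<forall>q. q < x * n \<or> x * n + N \<le> q \<longrightarrow> narr s' ''d'' q = narr s ''d'' q)"], goal_cases)
    case (5 i u s')
    then have "narr s' ''row'' x = x * n" "nvar s' ''x'' = x" "nvar s' ''kk'' = nvar s ''kk''"
      using x row by (simp_all add: same_def)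
    with 5 show ?case by (auto simp: less_Suc_eq)
  qed (use N in \<open>auto simp: same_def\<close>)
  then have "wp (For ''y'' (NVar ''N'') (NStore ''d'' (NAdd (NGet ''row'' (NVar ''x'')) (NVar ''y'')) (NVar ''kk'')))
    (wp (NStore ''d'' (NAdd (NGet ''row'' (NVar ''x'')) (NVar ''x'')) (NConst 0))
    ?Q) (Suc t) ?s"
  proof (rule wp_consequence, goal_cases)
    case (1 t' s')
    then have "narr s' ''row'' x = x * n" "nvar s' ''x'' = x" "narr s' ''deg'' = (narr s ''deg'')(x := 0)"
      using x row by (simp_all add: same_def)
    with 1 x show ?case by auto
  qed
  then show ?thesis by (simp add: init_row_def x)
qed

lemma mods_init_row:
  "nvars_of init_row = {''y''}" "rvars_of init_row = {}" "narrs_of init_row = {''d'', ''deg''}"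
  "rarrs_of init_row = {}"
  by (auto simp: init_row_def)

text \<open>With all degrees zero, each of the \<open>N * N\<close> entries contributes at most
  \<open>2 * k\<close> to the potential, which explains \<open>16 * k * N * N\<close>. The array
  \<open>adj\<close> is not cleared, because degree zero hides its old contents.\<close>

lemma wp_init_dist:
  assumes k: "nvar s ''kk'' = 2 * k" "1 \<le> k" and N: "nvar s ''N'' = N" "N \<le> n"
    and row: "\<And>x. x < N \<Longrightarrow> narr s ''row'' x = x * n"
  shows "wp init_dist (\<lambda>t' s'. graph_rep k n N {} (narr s' ''d'') (narr s' ''adj'') (narr s' ''deg'') \<and>
    t' + 8 * total_potential n N (narr s' ''deg'') (narr s' ''d'') \<le> t + 9 * N * N + 16 * k * N * N + 2) t s"
  unfolding init_dist_def
proof (rule wp_For[where N = N and B = "t + N * (3 * N + 6) + 1" and I = "\<lambda>i t' s'.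
    t' = t + i * (3 * N + 6) + 1 \<and> (\<forall>x<i. narr s' ''deg'' x = 0 \<and>
      (\<forall>y<N. narr s' ''d'' (x * n + y) = (if y = x then 0 else 2 * k)))"], goal_cases)
  case (5 i u s')
  have c: "narr s' ''row'' = narr s ''row''" "nvar s' ''N'' = N" "nvar s' ''kk'' = 2 * k"
    using 5(4) N k by (simp_all add: same_def mods_init_row)
  have "wp init_row (\<lambda>t' s''. Suc t' = t + Suc i * (3 * N + 6) + 1 \<and> (\<forall>x<Suc i. narr s'' ''deg'' x = 0 \<and>
      (\<forall>y<N. narr s'' ''d'' (x * n + y) = (if y = x then 0 else 2 * k)))) (Suc u) s'"
  proof (rule wp_consequence[OF wp_init_row[where x = i and n = n and N = N]], goal_cases)
    case (6 t' s'')
    have "narr s'' ''d'' (x * n + y) = narr s' ''d'' (x * n + y)" if "x < i" "y < N" for x y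
      using 6(1) row_disjoint[of x i y N n] that N by auto
    with 6(1) 5(3) c show ?case by (auto simp: less_Suc_eq)
  qed (use 5 c N row in simp_all)
  moreover have "i * (3 * N + 6) \<le> N * (3 * N + 6)" using 5(1) by (intro mult_le_mono1) simp
  ultimately show ?case using 5(3) by simp
next
  case (6 u s')
  let ?d = "narr s' ''d''" and ?dg = "narr s' ''deg''"
  have d: "?d (x * n + y) = (if y = x then 0 else 2 * k)" "?dg x = 0" if "x < N" "y < N" for x y
    using 6(1) that by auto
  have "adj_rep n N {} (narr s' ''adj'') ?dg"
    using d(2) by (auto simp: adj_rep_def nbrs_def bij_betw_def)
  moreover have "dist_inv k N {} r (\<lambda>v. ?d (r * n + v)) \<and> relaxed {} (\<lambda>v. ?d (r * n + v)) {}" if "r < N" for r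
    using d that by (auto simp: dist_inv_def relaxed_def)
  ultimately have "graph_rep k n N {} ?d (narr s' ''adj'') ?dg"
    using N by (simp add: graph_rep_def simple_on_def high_girth_empty)
  moreover have "total_potential n N ?dg ?d \<le> (\<Sum>r<N. \<Sum>v<N. 2 * k)"
    unfolding total_potential_def potential_def using d by (intro sum_mono) auto
  then have "total_potential n N ?dg ?d \<le> 2 * k * N * N" by (simp add: algebra_simps)
  from mult_le_mono2[OF this, of 8]
  have "8 * total_potential n N ?dg ?d \<le> 16 * k * N * N" by (simp add: mult.assoc)
  moreover have "u = t + N * (3 * N + 6) + 1" using 6(1) by blast
  moreover have "N * (3 * N + 6) \<le> 9 * N * N" by (cases N) (auto simp: algebra_simps)
  ultimately have "Suc u + 8 * total_potential n N ?dg ?d \<le> t + 9 * N * N + 16 * k * N * N + 2"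
    by linarith
  with \<open>graph_rep k n N {} ?d (narr s' ''adj'') ?dg\<close> show ?case by blast
qed (use N in \<open>auto simp: same_def mods_init_row\<close>)

subsection \<open>One scale\<close>

text \<open>Each of the \<open>l\<close> hops is a kept edge, and each of the \<open>Suc l\<close>
  clusters visited is crossed inside \<open>K\<close> at cost at most \<open>D\<close>.\<close>

lemma cluster_path:
  assumes cl: "clustering \<omega> n K M D N cl" and K: "K \<subseteq> H"
    and rep: "\<And>x y. {x, y} \<in> G \<Longrightarrow>
      \<exists>u v. u < n \<and> v < n \<and> cl u = x \<and> cl v = y \<and> {u, v} \<in> H \<and> \<omega> {u, v} \<le> w"
    and u: "u < n" "cl u = x"
  shows "(x, y) \<in> adj_rel G ^^ l \<Longrightarrow> v < n \<Longrightarrow> cl v = y \<Longrightarrow>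
    near \<omega> H u v (real l * w + real (Suc l) * D)"
proof (induction l arbitrary: y v)
  case 0
  then have "near \<omega> K u v D" using cl u by (auto simp: clustering_def)
  then show ?case using K by (rule near_mono) simp
next
  case (Suc l)
  from Suc.prems(1) obtain z where z: "(x, z) \<in> adj_rel G ^^ l" "{z, y} \<in> G" by auto
  from rep[OF z(2)] obtain u' v' where e: "u' < n" "v' < n" "cl u' = z" "cl v' = y"
    "{u', v'} \<in> H" "\<omega> {u', v'} \<le> w" by blast
  have "near \<omega> K v' v D" using cl e Suc.prems by (auto simp: clustering_def)
  then have "near \<omega> H v' v D" using K by (rule near_mono) simp
  from near_trans[OF near_edge[OF e(5)] this] have "near \<omega> H u' v (\<omega> {u', v'} + D)" .
  from near_trans[OF Suc.IH[OF z(1) e(1,3)] this] show ?case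
    by (rule near_mono) (use e(6) in \<open>auto simp: algebra_simps\<close>)
qed

definition stretch :: "nat \<Rightarrow> real \<Rightarrow> real" where
  "stretch k \<delta> = (2 * real k - 1) * (1 + \<delta>) + \<delta>"

lemma stretch_ge:
  assumes "1 \<le> k" "0 \<le> \<delta>"
  shows "1 \<le> stretch k \<delta>" "\<delta> \<le> stretch k \<delta>"
proof -
  define X where "X = (2 * real k - 1) * (1 + \<delta>)"
  have "1 * (1 + \<delta>) \<le> X"
    unfolding X_def using assms by (intro mult_right_mono) auto
  moreover have "stretch k \<delta> = X + \<delta>" by (simp add: stretch_def X_def)
  ultimately show "1 \<le> stretch k \<delta>" "\<delta> \<le> stretch k \<delta>" using assms(2) by simp_all
qed

text \<open>There are at most \<open>2 * k - 1\<close> hops of weight \<open>w\<close> and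
  \<open>2 * k\<close> crossings of cost \<open>\<delta> * w\<close>; the sum is exactly
  \<open>stretch k \<delta> * w\<close>.\<close>

lemma stretch_bound:
  assumes "l < 2 * k" "0 \<le> \<delta>" "0 \<le> w" "0 \<le> D" "D \<le> \<delta> * w"
  shows "real l * w + real (Suc l) * D \<le> stretch k \<delta> * w"
proof -
  have "real l \<le> 2 * real k - 1" using assms(1) by linarith
  then have "real l * w \<le> (2 * real k - 1) * w" using assms by (intro mult_right_mono) auto
  moreover have "real (Suc l) * D \<le> (2 * real k) * (\<delta> * w)"
    using assms by (intro mult_mono) auto
  ultimately show ?thesis by (simp add: stretch_def algebra_simps)
qed

text \<open>\<open>G\<close> is the graph formed on the clusters by the edges kept at this scale.\<close>

definition scale_inv ::
  "(nat set \<Rightarrow> real) \<Rightarrow> nat \<Rightarrow> (nat \<times> nat) list \<Rightarrow> nat \<Rightarrow> real \<Rightarrow> nat \<Rightarrow> (nat \<Rightarrow> nat) \<Rightarrow> real \<Rightarrow>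
   nat set set \<Rightarrow> real \<Rightarrow> nat \<Rightarrow> nat \<Rightarrow> nat set set \<Rightarrow> state \<Rightarrow> nat \<Rightarrow> bool" where
  "scale_inv \<omega> n es k \<delta> N cl thr H0 W0 o0 C G s t \<longleftrightarrow>
     graph_rep k n N G (narr s ''d'') (narr s ''adj'') (narr s ''deg'') \<and>
     nvar s ''out_m'' = o0 + card G \<and> H0 \<subseteq> output_edges s \<and> output_edges s \<subseteq> edge ` set es \<and>
     total_weight \<omega> (output_edges s) \<le> W0 + real (card G) * thr \<and>
     (\<forall>x y. {x, y} \<in> G \<longrightarrow> (\<exists>u v. u < n \<and> v < n \<and> cl u = x \<and> cl v = y \<and> {u, v} \<in> output_edges s \<and>
        (\<forall>j. nvar s ''idx'' \<le> j \<longrightarrow> j < length es \<longrightarrow> \<omega> {u, v} \<le> \<omega> (edge (es ! j))))) \<and>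
     (\<forall>j<nvar s ''idx''. near \<omega> (output_edges s) (fst (es ! j)) (snd (es ! j))
        (stretch k \<delta> * \<omega> (edge (es ! j)))) \<and>
     nvar s ''idx'' \<le> length es \<and>
     t + 8 * total_potential n N (narr s ''deg'') (narr s ''d'') \<le>
       C + card G * (32 * k * N + 10 * N + 20) + 8 * nvar s ''idx''"

definition record_edge :: com where
  "record_edge =
     Seq (NStore ''out_src'' (NVar ''out_m'') (NGet ''a'' (NVar ''idx'')))
     (Seq (NStore ''out_dst'' (NVar ''out_m'') (NGet ''b'' (NVar ''idx'')))
     (Seq (inc ''out_m'') add_edge))"

definition process_edge :: com where
  "process_edge =
     Seq (NAssign ''ca'' (NGet ''cl'' (NGet ''a'' (NVar ''idx''))))
     (Seq (NAssign ''cb'' (NGet ''cl'' (NGet ''b'' (NVar ''idx''))))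
     (Seq (Cond (NLess (NGet ''d'' (NAdd (NGet ''row'' (NVar ''ca'')) (NVar ''cb''))) (NVar ''kk''))
            Skip record_edge)
          (inc ''idx'')))"

definition scale_edges :: com where
  "scale_edges =
     While (BAnd (NLess (NVar ''idx'') (NVar ''m'')) (BNot (RLess (RVar ''thr'') (RGet ''w'' (NVar ''idx'')))))
       process_edge"

lemma mods_add_edge:
  "nvars_of add_edge = {''s'', ''rs'', ''sp'', ''p'', ''j'', ''y''}" "rvars_of add_edge = {}"
  "narrs_of add_edge = {''adj'', ''deg'', ''d'', ''stk''}" "rarrs_of add_edge = {}"
  by (auto simp: add_edge_def insert_adj_def nvars_of_update_row)

lemma total_weight_insert_le:
  assumes "finite H" "0 \<le> \<omega> e"
  shows "total_weight \<omega> (insert e H) \<le> total_weight \<omega> H + \<omega> e"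
  using assms by (cases "e \<in> H") (auto simp: total_weight_def insert_absorb)

text \<open>Since the edges come in increasing order, every kept edge is at most as heavy as the
  current one, so a short walk between the two clusters is an affordable bypass. An edge inside one
  cluster has table value \<open>0\<close> and is always rejected.\<close>

lemma wp_process_edge:
  assumes I: "scale_inv \<omega> n es k \<delta> N cl thr H0 W0 o0 C G s t"
    and es: "edge_arrays s \<omega> es" "sorted (map (\<omega> \<circ> edge) es)"
    and E: "\<And>e. e \<in> set es \<Longrightarrow> fst e < n \<and> snd e < n \<and> fst e \<noteq> snd e \<and> 0 < \<omega> (edge e)"
    and cl: "clustering \<omega> n K M D N cl" "narr s ''cl'' = cl" and K: "K \<subseteq> H0"
    and row: "\<And>x. x < N \<Longrightarrow> narr s ''row'' x = x * n" and N: "nvar s ''N'' = N"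
    and kk: "nvar s ''kk'' = 2 * k" "1 \<le> k"
    and idx: "nvar s ''idx'' = i" "i < length es" and thr: "\<omega> (edge (es ! i)) \<le> thr"
    and D: "0 \<le> D" "0 \<le> \<delta>" "D \<le> \<delta> * \<omega> (edge (es ! i))"
  shows "wp process_edge (\<lambda>t' s'. nvar s' ''idx'' = Suc i \<and> (\<exists>G'. scale_inv \<omega> n es k \<delta> N cl thr H0 W0 o0 C G' s' t')) (Suc t) s"
proof -
  let ?e = "es ! i"
  let ?a = "fst ?e" and ?b = "snd ?e"
  let ?x = "cl ?a" and ?y = "cl ?b" and ?H = "output_edges s" and ?w = "\<omega> (edge ?e)"
  have e: "?e \<in> set es" "edge ?e = {?a, ?b}" using idx by (simp_all add: edge_def)
  have ab: "?a < n" "?b < n" and w: "0 < ?w" using E[OF e(1)] by auto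
  have xy: "?x < N" "?y < N" using cl(1) ab by (auto simp: clustering_def)
  have arr: "narr s ''a'' i = ?a" "narr s ''b'' i = ?b" using es(1) idx by (auto simp: edge_arrays_def)
  have J: "graph_rep k n N G (narr s ''d'') (narr s ''adj'') (narr s ''deg'')"
    "nvar s ''out_m'' = o0 + card G" "H0 \<subseteq> ?H" "?H \<subseteq> edge ` set es"
    "total_weight \<omega> ?H \<le> W0 + real (card G) * thr"
    and rep: "\<And>x y. {x, y} \<in> G \<Longrightarrow> \<exists>u v. u < n \<and> v < n \<and> cl u = x \<and> cl v = y \<and> {u, v} \<in> ?H \<and>
        (\<forall>j. i \<le> j \<longrightarrow> j < length es \<longrightarrow> \<omega> {u, v} \<le> \<omega> (edge (es ! j)))"
    and st: "\<And>j. j < i \<Longrightarrow> near \<omega> ?H (fst (es ! j)) (snd (es ! j)) (stretch k \<delta> * \<omega> (edge (es ! j)))"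
    and t: "t + 8 * total_potential n N (narr s ''deg'') (narr s ''d'') \<le>
       C + card G * (32 * k * N + 10 * N + 20) + 8 * i"
    using I unfolding scale_inv_def idx by blast+
  let ?s = "s\<lparr>nvar := (nvar s)(''ca'' := ?x, ''cb'' := ?y)\<rparr>"
  show ?thesis
  proof (cases "narr s ''d'' (?x * n + ?y) < 2 * k")
    case True
    let ?l = "narr s ''d'' (?x * n + ?y)"
    have "near \<omega> ?H ?a ?b (real ?l * ?w + real (Suc ?l) * D)"
    proof (rule cluster_path[OF cl(1) _ _ ab(1) refl graph_rep_near[OF J(1) xy True] ab(2) refl])
      show "K \<subseteq> ?H" using K J(3) by simp
      show "\<exists>u v. u < n \<and> v < n \<and> cl u = x \<and> cl v = y \<and> {u, v} \<in> ?H \<and> \<omega> {u, v} \<le> ?w"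
        if "{x, y} \<in> G" for x y
        using rep[OF that] idx(2) by blast
    qed
    then have new: "near \<omega> ?H ?a ?b (stretch k \<delta> * ?w)"
      by (rule near_mono) (use stretch_bound[OF True D(2) _ D(1,3)] w in auto)
    have "scale_inv \<omega> n es k \<delta> N cl thr H0 W0 o0 C G
      (?s\<lparr>nvar := (nvar ?s)(''idx'' := Suc i)\<rparr>) (t + 6)"
      unfolding scale_inv_def
    proof (intro conjI allI impI, goal_cases)
      case (6 x y)
      from rep[OF 6] obtain u v where uv: "u < n" "v < n" "cl u = x" "cl v = y" "{u, v} \<in> ?H"
        "\<And>j. i \<le> j \<Longrightarrow> j < length es \<Longrightarrow> \<omega> {u, v} \<le> \<omega> (edge (es ! j))" by blast
      then show ?case by (intro exI[of _ u] exI[of _ v]) (simp add: output_edges_eq)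
    next
      case (7 j)
      then show ?case using st[of j] new by (cases "j = i") (auto simp: output_edges_eq)
    qed (use J t idx in \<open>simp_all add: output_edges_eq\<close>)
    then have "wp process_edge (\<lambda>t' s'. nvar s' ''idx'' = Suc i \<and>
        scale_inv \<omega> n es k \<delta> N cl thr H0 W0 o0 C G s' t') (Suc t) s"
      using True by (simp add: process_edge_def idx arr cl(2) row[OF xy(1)] kk eval_nat_numeral)
    then show ?thesis by (rule wp_consequence) blast
  next
    case False
    let ?s1 = "?s\<lparr>narr := (narr s)(''out_src'' := (narr s ''out_src'')(nvar s ''out_m'' := ?a),
      ''out_dst'' := (narr s ''out_dst'')(nvar s ''out_m'' := ?b)),
      nvar := (nvar s)(''ca'' := ?x, ''cb'' := ?y, ''out_m'' := Suc (nvar s ''out_m''))\<rparr>"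
    let ?G = "insert {?x, ?y} G" and ?H' = "insert {?a, ?b} ?H"
    have new: "{?x, ?y} \<notin> G"
      using graph_rep_far[OF J(1) xy(1) False, of 1] kk(2) by simp
    have "finite G" using J(1) simple_on_finite by (auto simp: graph_rep_def)
    then have cardG: "card ?G = Suc (card G)" using new by simp
    have fin: "finite ?H" using J(4) finite_subset by blast
    have "wp add_edge (wp (inc ''idx'')
      (\<lambda>t' s'. nvar s' ''idx'' = Suc i \<and> scale_inv \<omega> n es k \<delta> N cl thr H0 W0 o0 C ?G s' t')) (t + 7) ?s1"
    proof (rule wp_consequence[OF wp_add_edge[where k = k and n = n and N = N and G = G and a = ?x and c = ?y]], goal_cases)
      case (10 t' s')
      have f: "nvar s' ''idx'' = i" "nvar s' ''out_m'' = Suc (nvar s ''out_m'')" "output_edges s' = ?H'"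
        using 10(2) by (simp_all add: same_def mods_add_edge idx output_edges_eq)
      have g: "graph_rep k n N ?G (narr s' ''d'') (narr s' ''adj'') (narr s' ''deg'')"
        "t' + 8 * total_potential n N (narr s' ''deg'') (narr s' ''d'') \<le>
         t + 7 + 8 * total_potential n N (narr s ''deg'') (narr s ''d'') + 32 * k * N + 10 * N + 6"
        using 10(1) by simp_all
      have o: "output_edges (s'\<lparr>nvar := (nvar s')(''idx'' := Suc i)\<rparr>) = ?H'"
        using f(3) by (simp add: output_edges_eq)
      have "scale_inv \<omega> n es k \<delta> N cl thr H0 W0 o0 C ?G (s'\<lparr>nvar := (nvar s')(''idx'' := Suc i)\<rparr>) (Suc t')"
        unfolding scale_inv_def o cardG
      proof (intro conjI allI impI, goal_cases)
        case 1
        then show ?case using g(1) by simp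
      next
        case 2
        then show ?case using f(2) J(2) by simp
      next
        case 3
        then show ?case using J(3) by blast
      next
        case 4
        have "{?a, ?b} \<in> edge ` set es" using e by (metis image_eqI)
        then show ?case using J(4) by blast
      next
        case 5
        have "total_weight \<omega> ?H' \<le> total_weight \<omega> ?H + \<omega> {?a, ?b}"
          using fin w e(2) by (intro total_weight_insert_le) auto
        then show ?case using J(5) thr e(2) by (simp add: algebra_simps)
      next
        case (6 x y)
        have le: "?w \<le> \<omega> (edge (es ! j))" if "Suc i \<le> j" "j < length es" for j
          using sorted_nth_mono[OF es(2), of i j] that by simp
        show ?case
        proof (cases "{x, y} \<in> G")
          case True
          from rep[OF True] obtain u v where uv: "u < n" "v < n" "cl u = x" "cl v = y" "{u, v} \<in> ?H"
            "\<And>j. i \<le> j \<Longrightarrow> j < length es \<Longrightarrow> \<omega> {u, v} \<le> \<omega> (edge (es ! j))" by blast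
          then show ?thesis by (intro exI[of _ u] exI[of _ v]) simp
        next
          case False
          with 6 have "x = ?x \<and> y = ?y \<or> x = ?y \<and> y = ?x" by (simp add: doubleton_eq_iff)
          then show ?thesis
          proof
            assume "x = ?x \<and> y = ?y"
            then show ?thesis using ab le e(2) by (intro exI[of _ ?a] exI[of _ ?b]) simp
          next
            assume "x = ?y \<and> y = ?x"
            then show ?thesis using ab le e(2)
              by (intro exI[of _ ?b] exI[of _ ?a]) (simp add: insert_commute)
          qed
        qed
      next
        case (7 j)
        show ?case
        proof (cases "j = i")
          case True
          have "near \<omega> ?H' ?a ?b (\<omega> {?a, ?b})" by (rule near_edge) simp
          moreover have "1 * ?w \<le> stretch k \<delta> * ?w"
            using stretch_ge(1)[OF kk(2) D(2)] w by (intro mult_right_mono) auto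
          ultimately show ?thesis unfolding True using e(2) by (intro near_mono[of _ _ _ _ _ ?H']) auto
        next
          case False
          with 7 have "j < i" by simp
          from st[OF this] show ?thesis by (rule near_mono) auto
        qed
      next
        case 8
        then show ?case using idx by simp
      next
        case 9
        then show ?case using g(2) t by (simp add: algebra_simps)
      qed
      then show ?case using f by simp
    qed (use J xy row N kk False in simp_all)
    then have "wp process_edge (\<lambda>t' s'. nvar s' ''idx'' = Suc i \<and>
        scale_inv \<omega> n es k \<delta> N cl thr H0 W0 o0 C ?G s' t') (Suc t) s"
      using False by (simp add: process_edge_def record_edge_def idx arr cl(2) row[OF xy(1)] kk eval_nat_numeral)
    then show ?thesis by (rule wp_consequence) blast
  qed
qed

lemma mods_process_edge:
  "nvars_of process_edge = {''ca'', ''cb'', ''idx'', ''out_m'', ''s'', ''rs'', ''sp'', ''p'', ''j'', ''y''}"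
  "rvars_of process_edge = {}"
  "narrs_of process_edge = {''out_src'', ''out_dst'', ''adj'', ''deg'', ''d'', ''stk''}"
  "rarrs_of process_edge = {}"
  by (auto simp: process_edge_def record_edge_def mods_add_edge)

lemma wp_scale_edges:
  assumes I: "scale_inv \<omega> n es k \<delta> N cl thr H0 W0 o0 C G s t"
    and es: "edge_arrays s \<omega> es" "sorted (map (\<omega> \<circ> edge) es)"
    and E: "\<And>e. e \<in> set es \<Longrightarrow> fst e < n \<and> snd e < n \<and> fst e \<noteq> snd e \<and> 0 < \<omega> (edge e)"
    and cl: "clustering \<omega> n K M D N cl" "narr s ''cl'' = cl" and K: "K \<subseteq> H0"
    and row: "\<And>x. x < N \<Longrightarrow> narr s ''row'' x = x * n" and N: "nvar s ''N'' = N"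
    and kk: "nvar s ''kk'' = 2 * k" "1 \<le> k" and thr: "rvar s ''thr'' = thr"
    and D: "0 \<le> D" "0 \<le> \<delta>" "\<And>j. nvar s ''idx'' \<le> j \<Longrightarrow> j < length es \<Longrightarrow> D \<le> \<delta> * \<omega> (edge (es ! j))"
  shows "wp scale_edges (\<lambda>t' s'. \<exists>G. scale_inv \<omega> n es k \<delta> N cl thr H0 W0 o0 (Suc C) G s' t' \<and>
    (\<forall>j. nvar s' ''idx'' \<le> j \<longrightarrow> j < length es \<longrightarrow> thr < \<omega> (edge (es ! j)))) t s"
  unfolding scale_edges_def
\<comment> \<open>The trivial estimate of \<open>card G\<close> by the number of vertex subsets
  serves termination only; the actual size is bounded afterwards through the girth.\<close>
proof (rule wp_While[where B = "C + 2 ^ N * (32 * k * N + 10 * N + 20) + 8 * length es" and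
    I = "\<lambda>t' s'. nvar s ''idx'' \<le> nvar s' ''idx'' \<and>
      (\<exists>G. scale_inv \<omega> n es k \<delta> N cl thr H0 W0 o0 C G s' t')"], goal_cases)
  case 1
  then show ?case using I by blast
next
  case (2 u s')
  let ?i = "nvar s' ''idx''"
  obtain G where G: "scale_inv \<omega> n es k \<delta> N cl thr H0 W0 o0 C G s' u" using 2(1) by blast
  have c: "nvar s' ''m'' = length es" "narr s' ''cl'' = cl" "narr s' ''row'' = narr s ''row''"
    "nvar s' ''N'' = N" "nvar s' ''kk'' = 2 * k" "rvar s' ''thr'' = thr" "edge_arrays s' \<omega> es"
    using 2(2) es(1) cl(2) N kk thr by (simp_all add: same_def mods_process_edge edge_arrays_def)
  from 2(3) c have i: "?i < length es" "\<omega> (edge (es ! ?i)) \<le> thr" by (auto simp: edge_arrays_def)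
  have "simple_on {..<N} G" using G by (simp add: scale_inv_def graph_rep_def)
  then have "G \<subseteq> Pow {..<N}" by (auto simp: simple_on_def)
  from card_mono[OF _ this] have "card G \<le> 2 ^ N" by (simp add: card_Pow)
  then have "card G * (32 * k * N + 10 * N + 20) \<le> 2 ^ N * (32 * k * N + 10 * N + 20)" by (rule mult_le_mono1)
  moreover have "u + 8 * total_potential n N (narr s' ''deg'') (narr s' ''d'') \<le>
       C + card G * (32 * k * N + 10 * N + 20) + 8 * ?i" using G by (simp add: scale_inv_def)
  ultimately have "u \<le> C + 2 ^ N * (32 * k * N + 10 * N + 20) + 8 * length es" using i by linarith
  moreover have "wp process_edge (\<lambda>t' s''. nvar s'' ''idx'' = Suc ?i \<and>
      (\<exists>G'. scale_inv \<omega> n es k \<delta> N cl thr H0 W0 o0 C G' s'' t')) (Suc u) s'"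
    by (rule wp_process_edge[OF G c(7) es(2) E cl(1) c(2) K _ c(4,5) kk(2) refl i D(1,2)])
      (use c(3) row D(3) 2(1) i in auto)
  then have "wp process_edge (\<lambda>t' s''. nvar s ''idx'' \<le> nvar s'' ''idx'' \<and>
      (\<exists>G. scale_inv \<omega> n es k \<delta> N cl thr H0 W0 o0 C G s'' t')) (Suc u) s'"
    by (rule wp_consequence) (use 2(1) in auto)
  ultimately show ?case by blast
next
  case (3 u s')
  let ?i = "nvar s' ''idx''"
  obtain G where G: "scale_inv \<omega> n es k \<delta> N cl thr H0 W0 o0 C G s' u" using 3(1) by blast
  have c: "nvar s' ''m'' = length es" "rvar s' ''thr'' = thr" "rarr s' ''w'' = rarr s ''w''"
    using 3(2) es(1) thr by (simp_all add: same_def mods_process_edge edge_arrays_def)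
  have "thr < \<omega> (edge (es ! j))" if j: "?i \<le> j" "j < length es" for j
  proof -
    from 3(3) c j have "thr < rarr s ''w'' ?i" by auto
    also have "\<dots> = \<omega> (edge (es ! ?i))" using es(1) j by (simp add: edge_arrays_def)
    also have "\<dots> \<le> \<omega> (edge (es ! j))" using sorted_nth_mono[OF es(2) j(1)] j by simp
    finally show ?thesis .
  qed
  moreover have "scale_inv \<omega> n es k \<delta> N cl thr H0 W0 o0 (Suc C) G s' (Suc u)"
    using G unfolding scale_inv_def by simp
  ultimately show ?case by blast
qed

subsection \<open>Numerical estimates\<close>

text \<open>Bernoulli's inequality gives \<open>(1 - 1 / (2 * k)) ^ k \<ge> 1 / 2 = r ^ k\<close>,
  so \<open>1 - r \<ge> 1 / (2 * k)\<close>. This bound on the geometric series is the source of the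
  factor \<open>k\<close> in the lightness.\<close>

lemma half_root:
  fixes k :: nat
  defines "r \<equiv> (1 / 2) powr (1 / real k)"
  assumes k: "1 \<le> k"
  shows "0 < r" "r \<le> 1" "(\<Sum>j<i. r ^ j) \<le> 2 * real k"
proof -
  show r: "0 < r" by (simp add: r_def)
  have rk: "r ^ k = 1 / 2" unfolding r_def using k by (simp add: powr_realpow[symmetric] powr_powr)
  have "1 + real k * (- 1 / (2 * real k)) \<le> (1 + (- 1 / (2 * real k))) ^ k"
    by (rule Bernoulli_inequality) (use k in \<open>auto simp: field_simps\<close>)
  moreover have "1 + real k * (- 1 / (2 * real k)) = 1 / 2" using k by (simp add: field_simps)
  moreover have "1 + (- 1 / (2 * real k)) = 1 - 1 / (2 * real k)" by simp
  ultimately have pow: "r ^ k \<le> (1 - 1 / (2 * real k)) ^ k" using rk by metis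
  obtain k' where k': "k = Suc k'" using k by (cases k) auto
  have le: "r \<le> 1 - 1 / (2 * real k)"
    by (rule power_le_imp_le_base[of r k']) (use pow k in \<open>auto simp: k' field_simps\<close>)
  moreover have "0 < 1 / (2 * real k)" using k by simp
  ultimately show "r \<le> 1" by linarith
  have r1: "1 / (2 * real k) \<le> 1 - r" "0 < 1 - r" using le \<open>0 < 1 / (2 * real k)\<close> by linarith+
  have "(\<Sum>j<i. r ^ j) = (1 - r ^ i) / (1 - r)" using r1 by (simp add: sum_gp_strict)
  also have "\<dots> \<le> 1 / (1 - r)" using r r1 by (intro divide_right_mono) auto
  also have "\<dots> \<le> 1 / (1 / (2 * real k))" using r1 k by (intro divide_left_mono) auto
  finally show "(\<Sum>j<i. r ^ j) \<le> 2 * real k" by simp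
qed

lemma sum_half_le: "(\<Sum>j<i. (1 / 2 :: real) ^ j) \<le> 2"
  by (simp add: sum_gp_strict)

lemma root_ge_1:
  assumes "1 \<le> n" "1 \<le> k"
  shows "1 \<le> real n powr (1 / real k)"
  using assms by (intro ge_one_powr_ge_zero) auto

text \<open>The degree bound is \<open>L\<close>, the ceiling of the \<open>k\<close>-th root
  \<open>y\<close> of \<open>N\<close>. From \<open>y \<le> 2 * X * r ^ i\<close> and
  \<open>L \<le> y + 1 \<le> 2 * y\<close> one gets \<open>L \<le> 4 * X * r ^ i\<close>; the factor
  \<open>N\<close> contributes the remaining \<open>2 * n / 2 ^ i\<close>.\<close>

lemma high_girth_card_scale:
  fixes n k N i :: nat
  defines "X \<equiv> real n powr (1 / real k)" and "r \<equiv> (1 / 2) powr (1 / real k)"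
  assumes G: "simple_on {..<N} G" "high_girth k G" and k: "1 \<le> k" and n: "1 \<le> n"
    and N: "1 \<le> N" "real N \<le> 2 * real n * (1 / 2) ^ i"
  shows "real (card G) \<le> 8 * real n * X * r ^ i * (1 / 2) ^ i"
proof -
  define y where "y = real N powr (1 / real k)"
  have y1: "1 \<le> y" unfolding y_def using N k by (intro root_ge_1)
  have yk: "y ^ k = real N" unfolding y_def using N k by (simp add: powr_realpow[symmetric] powr_powr)
  define L where "L = nat \<lceil>y\<rceil>"
  have L: "y \<le> real L" "real L \<le> y + 1" unfolding L_def using y1 by linarith+
  have "real N \<le> real L ^ k" unfolding yk[symmetric] using L y1 by (intro power_mono) auto
  then have "card {..<N} \<le> L ^ k" by (metis card_lessThan of_nat_le_iff of_nat_power)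
  from high_girth_card_le[OF _ G k this] have card: "card G \<le> L * N" by simp
  have "y \<le> (2 * real n * (1 / 2) ^ i) powr (1 / real k)"
    unfolding y_def using N k by (intro powr_mono2) auto
  also have "\<dots> = 2 powr (1 / real k) * X * ((1 / 2) ^ i) powr (1 / real k)"
    unfolding X_def by (simp add: powr_mult)
  also have "((1 / 2 :: real) ^ i) powr (1 / real k) = r ^ i"
    unfolding r_def by (simp add: powr_realpow[symmetric] powr_powr mult.commute)
  also have "2 powr (1 / real k) * X * r ^ i \<le> 2 powr 1 * X * r ^ i"
    using k unfolding X_def r_def by (intro mult_right_mono powr_mono) auto
  finally have "y \<le> 2 * X * r ^ i" by simp
  then have "real L \<le> 4 * X * r ^ i" using L y1 by linarith
  then have "real L * real N \<le> (4 * X * r ^ i) * (2 * real n * (1 / 2) ^ i)"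
    using N by (intro mult_mono) (auto simp: X_def r_def)
  moreover have "real (card G) \<le> real L * real N" using card by (metis of_nat_le_iff of_nat_mult)
  ultimately show ?thesis by (simp add: algebra_simps)
qed

text \<open>The logarithm of sorting is absorbed by \<open>ln n = k * ln X \<le> k * X\<close>,
  where \<open>X\<close> is the \<open>k\<close>-th root of \<open>n\<close>. Together with
  \<open>ln 2 \<ge> 1 / 2\<close> this gives 4, and the fifth unit covers the step from
  \<open>p - 1\<close> to \<open>p\<close>.\<close>

lemma log_bound:
  fixes n k m p :: nat
  assumes n: "1 \<le> n" and k: "1 \<le> k" and m: "m \<le> n * n" and p: "p = 0 \<or> 2 ^ (p - 1) < m"
  shows "real p \<le> 5 * (real k * real n powr (1 / real k))"
proof (cases "p = 0")
  case False
  let ?X = "real n powr (1 / real k)"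
  have X1: "1 \<le> ?X" using n k by (rule root_ge_1)
  have kX: "1 \<le> real k * ?X" using k X1 mult_mono[of 1 "real k" 1 ?X] by simp
  have "2 ^ (p - 1) < n * n" using False p m by simp
  then have "real (2 ^ (p - 1)) < real (n * n)" by (rule of_nat_less_iff[THEN iffD2])
  then have "ln ((2::real) ^ (p - 1)) < ln (real n * real n)"
    using n by (subst ln_less_cancel_iff) auto
  then have "real (p - 1) * ln 2 < 2 * ln (real n)" using n by (simp add: ln_realpow ln_mult)
  also have "ln (real n) = real k * ln ?X" using n k by (simp add: ln_powr)
  also have "ln ?X \<le> ?X" using ln_le_minus_one[of ?X] X1 by linarith
  finally have less: "real (p - 1) * ln 2 < 2 * (real k * ?X)" using k by (simp add: mult_left_mono)
  have "ln (1 / 2 :: real) \<le> 1 / 2 - 1" by (rule ln_le_minus_one) simp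
  then have "1 / 2 \<le> ln (2 :: real)" by (simp add: ln_div)
  then have "real (p - 1) * (1 / 2) \<le> real (p - 1) * ln 2" by (intro mult_left_mono) auto
  with less have "real (p - 1) \<le> 4 * (real k * ?X)" by simp
  with kX False show ?thesis by linarith
qed (use n k in simp)

text \<open>One of the two arcs of the tour between the vertices avoids the closing step, and its
  length is part of the total \<open>2 * M\<close>. This serves the edges too heavy for every
  scale.\<close>

lemma tour_near:
  assumes T: "tour \<omega> n K nx len M" and xy: "x < n" "y < n"
  shows "near \<omega> K x y (2 * M)"
proof -
  let ?P = "\<lambda>i. (nx ^^ i) 0"
  have P: "bij_betw ?P {..<n} {..<n}" using T by (simp add: tour_def)
  have lt: "?P i < n" if "i < n" for i using P that unfolding bij_betw_def by blast
  have step: "near \<omega> K (?P i) (?P (Suc i)) (len (?P i))" "0 \<le> len (?P i)" if "i < n" for i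
    using T lt[OF that] by (auto simp: tour_def)
  have path: "near \<omega> K (?P i) (?P j) (\<Sum>l = i..<j. len (?P l))" if "i \<le> j" "j < n" for i j
    using that
  proof (induction j rule: dec_induct)
    case base
    show ?case by (simp add: near_refl)
  next
    case (step j)
    then have "near \<omega> K (?P i) (?P (Suc j)) ((\<Sum>l = i..<j. len (?P l)) + len (?P j))"
      using \<open>\<And>i. i < n \<Longrightarrow> near \<omega> K (?P i) (?P (Suc i)) (len (?P i))\<close>[of j]
      by (intro near_trans[of _ _ _ "?P j"]) auto
    with step show ?case by simp
  qed
  have "(\<Sum>l<n. len (?P l)) = (\<Sum>x<n. len x)" using P by (rule sum.reindex_bij_betw)
  then have total: "(\<Sum>l<n. len (?P l)) = 2 * M" using T by (simp add: tour_def)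
  have all: "near \<omega> K (?P i) (?P j) (2 * M)" if "i \<le> j" "j < n" for i j
  proof -
    have "(\<Sum>l = i..<j. len (?P l)) \<le> (\<Sum>l<n. len (?P l))"
      using that step(2) by (intro sum_mono2) auto
    with total have "(\<Sum>l = i..<j. len (?P l)) \<le> 2 * M" by simp
    with path[OF that] show ?thesis by (rule near_mono[OF _ order_refl])
  qed
  have "x \<in> ?P ` {..<n}" "y \<in> ?P ` {..<n}" using P xy by (simp_all add: bij_betw_def)
  then obtain i j where ij: "i < n" "x = ?P i" "j < n" "y = ?P j" by auto
  show ?thesis
  proof (cases "i \<le> j")
    case True
    from all[OF this ij(3)] show ?thesis by (simp only: ij)
  next
    case False
    then have "near \<omega> K (?P j) (?P i) (2 * M)" using ij by (intro all) auto
    from near_sym[OF this] show ?thesis by (simp only: ij)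
  qed
qed

subsection \<open>The spanner algorithm\<close>

definition init_consts :: com where
  "init_consts =
     Seq (RAssign ''thr'' (RDiv (RMul (RMul (RNat (NConst 2)) (RVar ''q'')) (RVar ''mst'')) (RNat (NVar ''n''))))
     (Seq (RAssign ''D'' (RNat (NConst 0)))
     (Seq (NAssign ''kk'' (NAdd (NVar ''k'') (NVar ''k'')))
          (NAssign ''idx'' (NConst 0))))"

text \<open>The diameter bound of the next scale is formed from the threshold of the current one,
  hence before the threshold is doubled.\<close>

definition one_scale :: com where
  "one_scale =
     Seq build_clusters (Seq init_dist (Seq scale_edges
     (Seq (RAssign ''D'' (RDiv (RMul (RNat (NConst 2)) (RVar ''thr'')) (RVar ''q'')))
          (RAssign ''thr'' (RMul (RNat (NConst 2)) (RVar ''thr''))))))"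

definition scales :: com where
  "scales = While (RLess (RVar ''D'') (RMul (RNat (NConst 2)) (RVar ''mst''))) one_scale"

definition spanner_prog :: com where
  "spanner_prog = Seq init_arrays (Seq sort_edges (Seq kruskal_loop (Seq init_consts scales)))"

text \<open>\<open>T0\<close> is the time spent before the scales. The tree accounts for the initial
  \<open>n\<close> in the edge count and the initial \<open>M\<close> in the weight. The lower bound
  on the untreated edges, in terms of \<open>D\<close>, is what the next scale needs for the
  stretch.\<close>

definition outer_inv ::
  "(nat set \<Rightarrow> real) \<Rightarrow> nat \<Rightarrow> (nat \<times> nat) list \<Rightarrow> nat set set \<Rightarrow> real \<Rightarrow> nat \<Rightarrow> real \<Rightarrow> real \<Rightarrow> nat \<Rightarrow>
   state \<Rightarrow> nat \<Rightarrow> bool" where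
  "outer_inv \<omega> n es K M k q T0 i s t \<longleftrightarrow>
     rvar s ''thr'' = 2 * q * M / real n * 2 ^ i \<and>
     rvar s ''D'' = (if i = 0 then 0 else 2 * M / real n * 2 ^ i) \<and> i \<le> n \<and>
     K \<subseteq> output_edges s \<and> output_edges s \<subseteq> edge ` set es \<and>
     real (nvar s ''out_m'') \<le> real n + 8 * real n * real n powr (1 / real k) * (\<Sum>j<i. (1 / 2) ^ j) \<and>
     total_weight \<omega> (output_edges s) \<le>
       M + 16 * q * M * real n powr (1 / real k) * (\<Sum>j<i. ((1 / 2) powr (1 / real k)) ^ j) \<and>
     (\<forall>j<nvar s ''idx''. near \<omega> (output_edges s) (fst (es ! j)) (snd (es ! j))
        (stretch k (2 / q) * \<omega> (edge (es ! j)))) \<and>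
     (\<forall>j. nvar s ''idx'' \<le> j \<longrightarrow> j < length es \<longrightarrow> rvar s ''D'' \<le> 2 / q * \<omega> (edge (es ! j))) \<and>
     nvar s ''idx'' \<le> length es \<and>
     real t \<le> T0 + 1092 * real k * (real n)\<^sup>2 * real n powr (1 / real k) * (\<Sum>j<i. (1 / 2) ^ j) +
       (9 * real n + 14) * real i + 8 * real (nvar s ''idx'')"

lemma mods_one_scale:
  "nvars_of one_scale = {''x'', ''c'', ''i'', ''N'', ''y'', ''ca'', ''cb'', ''idx'', ''out_m'', ''s'', ''rs'', ''sp'', ''p'', ''j''}"
  "rvars_of one_scale = {''sum'', ''D'', ''thr''}"
  "narrs_of one_scale = {''cl'', ''d'', ''deg'', ''out_src'', ''out_dst'', ''adj'', ''stk''}"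
  "rarrs_of one_scale = {}"
  by (auto simp: one_scale_def build_clusters_def init_dist_def mods_init_row scale_edges_def mods_process_edge)

text \<open>For \<open>i > 0\<close> the bound \<open>D < 2 * M\<close> means
  \<open>2 ^ i < n\<close>. It absorbs the last, possibly short cluster in
  \<open>N * 2 ^ i \<le> n + 2 ^ i\<close>, and with \<open>i < 2 ^ i\<close> it bounds the number
  of scales by \<open>n\<close>.\<close>

lemma clusters_small:
  assumes cl: "clustering \<omega> n K M D N cl" and n: "1 \<le> n"
    and D: "D = (if i = 0 then 0 else 2 * M / real n * 2 ^ i)" and M: "0 \<le> M" "D < 2 * M"
  shows "real N \<le> 2 * real n * (1 / 2) ^ i" "i < n"
proof -
  have N: "1 \<le> N" "N \<le> n" "(real N - 1) * D \<le> 2 * M" using cl by (auto simp: clustering_def)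
  have "real N * 2 ^ i \<le> 2 * real n \<and> i < n"
  proof (cases "i = 0")
    case True
    with N n show ?thesis by simp
  next
    case False
    then have D': "D = 2 * M * (2 ^ i / real n)" using D by simp
    have M0: "0 < M" using M D' by (cases "M = 0") auto
    have "2 * M * (2 ^ i / real n) < 2 * M * 1" using M(2) D' by simp
    then have "2 ^ i / real n < 1" using M0 by (simp only: mult_less_cancel_left_pos)
    then have in': "2 ^ i < real n" using n by (simp add: divide_less_eq)
    have "(2 * M) * ((real N - 1) * (2 ^ i / real n)) \<le> (2 * M) * 1" using N(3) D' by (simp add: mult_ac)
    then have "(real N - 1) * (2 ^ i / real n) \<le> 1" using M0 by (simp only: mult_le_cancel_left_pos)
    then have "(real N - 1) * 2 ^ i \<le> real n" using n by (simp add: divide_le_eq)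
    then have "real N * 2 ^ i \<le> real n + 2 ^ i" by (simp add: algebra_simps)
    moreover have "i < 2 ^ i" by (rule less_exp)
    then have "real i < 2 ^ i" by (metis of_nat_less_iff of_nat_numeral of_nat_power)
    ultimately have "real N * 2 ^ i \<le> 2 * real n" "real i < real n" using in' by linarith+
    then show ?thesis by simp
  qed
  then show "real N \<le> 2 * real n * (1 / 2) ^ i" "i < n"
    by (auto simp: power_one_over field_simps)
qed

lemma wp_one_scale:
  assumes I: "outer_inv \<omega> n es K M k q T0 i s t" and T0: "0 \<le> T0"
    and es: "edge_arrays s \<omega> es" "sorted (map (\<omega> \<circ> edge) es)"
    and E: "\<And>e. e \<in> set es \<Longrightarrow> fst e < n \<and> snd e < n \<and> fst e \<noteq> snd e \<and> 0 < \<omega> (edge e)"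
    and T: "tour \<omega> n K (narr s ''nx'') (rarr s ''len'') M"
    and row: "\<And>x. x < n \<Longrightarrow> narr s ''row'' x = x * n" and n: "nvar s ''n'' = n" "1 \<le> n"
    and kk: "nvar s ''kk'' = 2 * k" "1 \<le> k" and q: "rvar s ''q'' = q" "0 < q"
    and M: "0 \<le> M" "rvar s ''D'' < 2 * M"
  shows "wp one_scale (\<lambda>t' s'. outer_inv \<omega> n es K M k q T0 (Suc i) s' t') (Suc t) s"
proof -
  let ?X = "real n powr (1 / real k)" and ?r = "(1 / 2 :: real) powr (1 / real k)"
  let ?thr = "rvar s ''thr''" and ?D = "rvar s ''D''" and ?H = "output_edges s" and ?i = "nvar s ''idx''"
  have J: "?thr = 2 * q * M / real n * 2 ^ i" "?D = (if i = 0 then 0 else 2 * M / real n * 2 ^ i)"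
    "K \<subseteq> ?H" "?H \<subseteq> edge ` set es"
    "real (nvar s ''out_m'') \<le> real n + 8 * real n * ?X * (\<Sum>j<i. (1 / 2) ^ j)"
    "total_weight \<omega> ?H \<le> M + 16 * q * M * ?X * (\<Sum>j<i. ?r ^ j)"
    "\<And>j. j < ?i \<Longrightarrow> near \<omega> ?H (fst (es ! j)) (snd (es ! j)) (stretch k (2 / q) * \<omega> (edge (es ! j)))"
    "\<And>j. ?i \<le> j \<Longrightarrow> j < length es \<Longrightarrow> ?D \<le> 2 / q * \<omega> (edge (es ! j))"
    "?i \<le> length es"
    "real t \<le> T0 + 1092 * real k * (real n)\<^sup>2 * ?X * (\<Sum>j<i. (1 / 2) ^ j) +
       (9 * real n + 14) * real i + 8 * real ?i"
    using I unfolding outer_inv_def by blast+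
  have D0: "0 \<le> ?D" using J(2) M by simp
  have X1: "1 \<le> ?X" using n kk by (intro root_ge_1)
  have r: "0 < ?r" "?r \<le> 1" using half_root[OF kk(2)] by auto
  show ?thesis
    unfolding one_scale_def wp_Seq
  proof (rule wp_consequence[OF wp_build_clusters[where D = ?D and n = n and K = K and M = M and \<omega> = \<omega>]], goal_cases)
    case (6 t1 s1)
    let ?N = "nvar s1 ''N''" and ?cl = "narr s1 ''cl''"
    have t1: "t1 \<le> Suc t + 9 * n + 6" and cl: "clustering \<omega> n K M ?D ?N ?cl" using 6(1) by auto
    have N: "1 \<le> ?N" "?N \<le> n" using cl by (auto simp: clustering_def)
    have small: "real ?N \<le> 2 * real n * (1 / 2) ^ i" and i: "i < n"
      using clusters_small[OF cl n(2) J(2) M] by auto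
    have s1: "narr s1 ''row'' = narr s ''row''" "nvar s1 ''kk'' = 2 * k" "nvar s1 ''idx'' = ?i"
      "nvar s1 ''m'' = nvar s ''m''" "rvar s1 ''thr'' = ?thr" "rvar s1 ''q'' = q" "output_edges s1 = ?H"
      "nvar s1 ''out_m'' = nvar s ''out_m''" "narr s1 ''a'' = narr s ''a''" "narr s1 ''b'' = narr s ''b''"
      "rarr s1 ''w'' = rarr s ''w''"
      using 6(2) kk q by (simp_all add: same_def build_clusters_def output_edges_eq)
    show ?case
    proof (rule wp_consequence[OF wp_init_dist[where k = k and N = ?N and n = n]], goal_cases)
      case (6 t2 s2)
      let ?pot = "total_potential n ?N (narr s2 ''deg'') (narr s2 ''d'')"
      have rep: "graph_rep k n ?N {} (narr s2 ''d'') (narr s2 ''adj'') (narr s2 ''deg'')"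
        and t2: "t2 + 8 * ?pot \<le> t1 + 9 * ?N * ?N + 16 * k * ?N * ?N + 2" using 6(1) by auto
      have s2: "narr s2 ''row'' = narr s ''row''" "nvar s2 ''kk'' = 2 * k" "nvar s2 ''idx'' = ?i"
        "edge_arrays s2 \<omega> es" "rvar s2 ''thr'' = ?thr" "rvar s2 ''q'' = q" "output_edges s2 = ?H"
        "nvar s2 ''out_m'' = nvar s ''out_m''" "narr s2 ''cl'' = ?cl" "nvar s2 ''N'' = ?N"
        using 6(2) s1 es(1) by (simp_all add: same_def init_dist_def mods_init_row output_edges_eq edge_arrays_def)
      \<comment> \<open>The 8 steps per edge for edges treated at earlier scales are already spent
        and must not be granted again. The subtraction is truncated, so the bound on
        \<open>?C\<close> below distinguishes two cases.\<close>
      let ?C = "t2 + 8 * ?pot - 8 * ?i"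
      have inv: "scale_inv \<omega> n es k (2 / q) ?N ?cl ?thr ?H (total_weight \<omega> ?H) (nvar s ''out_m'') ?C {} s2 t2"
        unfolding scale_inv_def s2 using rep J(4,7,9) by simp
      show ?case
      proof (rule wp_consequence[OF wp_scale_edges[OF inv s2(4) es(2) E cl s2(9) J(3) _ s2(10,2) kk(2) s2(5) D0]], goal_cases)
        case (5 t3 s3)
        then obtain G where G: "scale_inv \<omega> n es k (2 / q) ?N ?cl ?thr ?H (total_weight \<omega> ?H) (nvar s ''out_m'') (Suc ?C) G s3 t3"
          and rest: "\<And>j. nvar s3 ''idx'' \<le> j \<Longrightarrow> j < length es \<Longrightarrow> ?thr < \<omega> (edge (es ! j))" by blast
        have s3: "rvar s3 ''thr'' = ?thr" "rvar s3 ''q'' = q"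
          using 5(2) s2 by (simp_all add: same_def scale_edges_def mods_process_edge)
        let ?H3 = "output_edges s3" and ?i3 = "nvar s3 ''idx''"
        have S: "graph_rep k n ?N G (narr s3 ''d'') (narr s3 ''adj'') (narr s3 ''deg'')"
          "nvar s3 ''out_m'' = nvar s ''out_m'' + card G" "?H \<subseteq> ?H3" "?H3 \<subseteq> edge ` set es"
          "total_weight \<omega> ?H3 \<le> total_weight \<omega> ?H + real (card G) * ?thr"
          "\<And>j. j < ?i3 \<Longrightarrow> near \<omega> ?H3 (fst (es ! j)) (snd (es ! j)) (stretch k (2 / q) * \<omega> (edge (es ! j)))"
          "?i3 \<le> length es"
          "t3 + 8 * total_potential n ?N (narr s3 ''deg'') (narr s3 ''d'') \<le>
             Suc ?C + card G * (32 * k * ?N + 10 * ?N + 20) + 8 * ?i3"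
          using G unfolding scale_inv_def by blast+
        have card: "real (card G) \<le> 8 * real n * ?X * ?r ^ i * (1 / 2) ^ i"
          using S(1) kk(2) n(2) N(1) small by (intro high_girth_card_scale[where N = ?N]) (auto simp: graph_rep_def)
        have ri: "?r ^ i \<le> 1" using r by (intro power_le_one) auto
        have "8 * real n * ?X * (1 / 2) ^ i * ?r ^ i \<le> 8 * real n * ?X * (1 / 2) ^ i * 1"
          using ri X1 by (intro mult_left_mono) auto
        with card have card': "real (card G) \<le> 8 * real n * ?X * (1 / 2) ^ i" by (simp add: mult_ac)
        have thr0: "0 \<le> ?thr" using J(1) M q by simp
        have "real (card G) * ?thr \<le> 8 * real n * ?X * ?r ^ i * (1 / 2) ^ i * ?thr"
          using card thr0 by (rule mult_right_mono)
        \<comment> \<open>The doubling of the threshold cancels the halving of the cluster number;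
          only the slowly decaying \<open>?r ^ i\<close> is left.\<close>
        also have "\<dots> = 16 * q * M * ?X * ?r ^ i * ((1 / 2) ^ i * 2 ^ i)"
          using n by (simp add: J(1))
        also have "(1 / 2 :: real) ^ i * 2 ^ i = 1" by (simp add: power_one_over)
        finally have wt: "real (card G) * ?thr \<le> 16 * q * M * ?X * ?r ^ i" by simp
        have out: "real (nvar s3 ''out_m'') \<le> real n + 8 * real n * ?X * (\<Sum>j<Suc i. (1 / 2) ^ j)"
          using S(2) J(5) card' by (simp add: distrib_left)
        have weight: "total_weight \<omega> ?H3 \<le> M + 16 * q * M * ?X * (\<Sum>j<Suc i. ?r ^ j)"
          using S(5) J(6) wt by (simp add: distrib_left)
        let ?A = "T0 + 1092 * real k * (real n)\<^sup>2 * ?X * (\<Sum>j<i. (1 / 2) ^ j) + (9 * real n + 14) * real i"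
        let ?Y = "real k * (real n)\<^sup>2 * ?X * (1 / 2) ^ i"
        have A0: "0 \<le> ?A" using T0 X1 by (intro add_nonneg_nonneg mult_nonneg_nonneg sum_nonneg) auto
        have NN: "real ?N * real ?N \<le> 4 * ((real n)\<^sup>2 * ?X * (1 / 2) ^ i)"
        proof -
          have "real ?N * real ?N \<le> real n * (2 * real n * (1 / 2) ^ i)"
            using N small by (intro mult_mono) auto
          also have "\<dots> = 2 * (real n)\<^sup>2 * (1 / 2) ^ i * 1" by (simp add: power2_eq_square)
          also have "\<dots> \<le> 2 * (real n)\<^sup>2 * (1 / 2) ^ i * ?X" using X1 by (intro mult_left_mono) auto
          also have "\<dots> \<le> 4 * ((real n)\<^sup>2 * ?X * (1 / 2) ^ i)" using X1 by simp
          finally show ?thesis .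
        qed
        have GN: "real (card G) * real ?N \<le> 16 * ((real n)\<^sup>2 * ?X * (1 / 2) ^ i)"
        proof -
          have "real (card G) * real ?N \<le> (8 * real n * ?X * (1 / 2) ^ i) * real n"
            using card' N X1 by (intro mult_mono) auto
          also have "\<dots> = 8 * ((real n)\<^sup>2 * ?X * (1 / 2) ^ i)" by (simp add: power2_eq_square)
          also have "\<dots> \<le> 16 * ((real n)\<^sup>2 * ?X * (1 / 2) ^ i)" using X1 by simp
          finally show ?thesis .
        qed
        have k1: "1 \<le> real k" using kk by simp
        have NN': "9 * real ?N * real ?N + 16 * real k * real ?N * real ?N \<le> 100 * ?Y"
        proof -
          have "9 * (real ?N * real ?N) \<le> 9 * real k * (real ?N * real ?N)"
            using k1 by (intro mult_right_mono) auto
          then have "9 * real ?N * real ?N + 16 * real k * real ?N * real ?N \<le> 25 * real k * (real ?N * real ?N)"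
            by (simp add: algebra_simps)
          also have "\<dots> \<le> 25 * real k * (4 * ((real n)\<^sup>2 * ?X * (1 / 2) ^ i))"
            using NN by (intro mult_left_mono) auto
          finally show ?thesis by (simp add: mult_ac)
        qed
        have GN': "real (card G * (32 * k * ?N + 10 * ?N + 20)) \<le> 992 * ?Y"
        proof -
          have kN: "1 \<le> k * ?N" "?N \<le> k * ?N" using kk(2) N(1) by auto
          then have "32 * k * ?N + 10 * ?N + 20 \<le> 62 * (k * ?N)" by linarith
          then have "card G * (32 * k * ?N + 10 * ?N + 20) \<le> card G * (62 * (k * ?N))" by (rule mult_le_mono2)
          then have "real (card G * (32 * k * ?N + 10 * ?N + 20)) \<le> real (card G * (62 * (k * ?N)))"
            by (rule of_nat_mono)
          also have "\<dots> = 62 * real k * (real (card G) * real ?N)" by simp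
          also have "\<dots> \<le> 62 * real k * (16 * ((real n)\<^sup>2 * ?X * (1 / 2) ^ i))"
            using GN by (intro mult_left_mono) auto
          finally show ?thesis by (simp add: mult_ac)
        qed
        have t2': "real t2 + 8 * real ?pot \<le> ?A + 9 * real n + 9 + 100 * ?Y + 8 * real ?i"
        proof -
          have "real (t2 + 8 * ?pot) \<le> real (Suc t + 9 * n + 6 + 9 * ?N * ?N + 16 * k * ?N * ?N + 2)"
            using t1 t2 by (intro of_nat_mono) linarith
          then have "real t2 + 8 * real ?pot \<le> real t + 9 * real n + 9 +
            (9 * real ?N * real ?N + 16 * real k * real ?N * real ?N)" by simp
          with NN' J(10) show ?thesis by linarith
        qed
        have "real ?C \<le> ?A + 9 * real n + 9 + 100 * ?Y"
        proof (cases "8 * ?i \<le> t2 + 8 * ?pot")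
          case True
          then have "real ?C = real t2 + 8 * real ?pot - 8 * real ?i" by (simp add: of_nat_diff)
          with t2' show ?thesis by linarith
        next
          case False
          then have "real ?C = 0" by simp
          moreover have "0 \<le> 100 * ?Y" using X1 by simp
          ultimately show ?thesis using A0 by linarith
        qed
        moreover have "real t3 \<le> real ?C + 1 + real (card G * (32 * k * ?N + 10 * ?N + 20)) + 8 * real ?i3"
        proof -
          have "t3 \<le> Suc ?C + card G * (32 * k * ?N + 10 * ?N + 20) + 8 * ?i3" using S(8) by linarith
          then have "real t3 \<le> real (Suc ?C + card G * (32 * k * ?N + 10 * ?N + 20) + 8 * ?i3)" by (rule of_nat_mono)
          then show ?thesis by simp
        qed
        \<comment> \<open>The coefficient 1092 is 100 for building the table plus 992 for the
          insertions; the latter is 62, from \<open>32 + 10 + 20\<close>, times 16.\<close>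
        ultimately have "real t3 + 2 \<le> ?A + 9 * real n + 14 + 1092 * ?Y + 8 * real ?i3"
          using GN' by linarith
        then have time: "real (t3 + 2) \<le> T0 + 1092 * real k * (real n)\<^sup>2 * ?X * (\<Sum>j<Suc i. (1 / 2) ^ j) +
            (9 * real n + 14) * real (Suc i) + 8 * real ?i3"
          by (simp add: algebra_simps)
        have D': "2 * ?thr / q = 2 * M / real n * 2 ^ Suc i" using J(1) q by simp
        let ?s4 = "s3\<lparr>rvar := (rvar s3)(''D'' := 2 * ?thr / q, ''thr'' := 2 * ?thr)\<rparr>"
        have o: "output_edges ?s4 = ?H3" by (simp add: output_edges_eq)
        have "outer_inv \<omega> n es K M k q T0 (Suc i) ?s4 (t3 + 2)"
          unfolding outer_inv_def o
        proof (intro conjI allI impI, goal_cases)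
          \<comment> \<open>An edge left over exceeds the old threshold, and the new
            \<open>D\<close> is \<open>2 / q\<close> times that threshold.\<close>
          case (9 j)
          then have "?thr < \<omega> (edge (es ! j))" using rest by simp
          then show ?case using q by (simp add: field_simps)
        qed (use S J i out weight time D' in \<open>auto\<close>)
        then show ?case by (simp add: s3 eval_nat_numeral)
      qed (use row N J(8) q s2 E in auto)
    qed (use s1 kk row N n in auto)
  qed (use T D0 n in auto)
qed

section \<open>Time, stretch, size and lightness of the result\<close>

lemma outer_inv_time:
  assumes I: "outer_inv \<omega> n es K M k q T0 i s t"
  shows "real t \<le> T0 + 2184 * real k * (real n)\<^sup>2 * real n powr (1 / real k) +
    (9 * real n + 14) * real n + 8 * real (length es)"
proof -
  have i: "i \<le> n" "nvar s ''idx'' \<le> length es"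
    and t: "real t \<le> T0 + 1092 * real k * (real n)\<^sup>2 * real n powr (1 / real k) * (\<Sum>j<i. (1 / 2) ^ j) +
       (9 * real n + 14) * real i + 8 * real (nvar s ''idx'')"
    using I unfolding outer_inv_def by blast+
  have "1092 * real k * (real n)\<^sup>2 * real n powr (1 / real k) * (\<Sum>j<i. (1 / 2) ^ j) \<le>
    1092 * real k * (real n)\<^sup>2 * real n powr (1 / real k) * 2"
    using sum_half_le by (intro mult_left_mono) auto
  moreover have "(9 * real n + 14) * real i \<le> (9 * real n + 14) * real n"
    using i by (intro mult_left_mono) auto
  moreover have "8 * real (nvar s ''idx'') \<le> 8 * real (length es)" using i by simp
  ultimately show ?thesis using t by linarith
qed

lemma wp_scales:
  assumes I: "outer_inv \<omega> n es K M k q T0 0 s t" and T0: "0 \<le> T0"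
    and es: "edge_arrays s \<omega> es" "sorted (map (\<omega> \<circ> edge) es)"
    and E: "\<And>e. e \<in> set es \<Longrightarrow> fst e < n \<and> snd e < n \<and> fst e \<noteq> snd e \<and> 0 < \<omega> (edge e)"
    and T: "tour \<omega> n K (narr s ''nx'') (rarr s ''len'') M"
    and row: "\<And>x. x < n \<Longrightarrow> narr s ''row'' x = x * n" and n: "nvar s ''n'' = n" "1 \<le> n"
    and kk: "nvar s ''kk'' = 2 * k" "1 \<le> k" and q: "rvar s ''q'' = q" "0 < q"
    and M: "0 \<le> M" "rvar s ''mst'' = M"
  shows "wp scales (\<lambda>t' s'. \<exists>i u. outer_inv \<omega> n es K M k q T0 i s' u \<and> t' = Suc u \<and>
    2 * M \<le> rvar s' ''D'') t s"
  unfolding scales_def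
proof (rule wp_While[where I = "\<lambda>t' s'. \<exists>i. outer_inv \<omega> n es K M k q T0 i s' t'" and
    B = "nat \<lceil>T0 + 2184 * real k * (real n)\<^sup>2 * real n powr (1 / real k) +
    (9 * real n + 14) * real n + 8 * real (length es)\<rceil>"], goal_cases)
  case 1
  show ?case using I by blast
next
  case (2 u s')
  then obtain i where i: "outer_inv \<omega> n es K M k q T0 i s' u" by blast
  have c: "edge_arrays s' \<omega> es" "narr s' ''nx'' = narr s ''nx''" "rarr s' ''len'' = rarr s ''len''"
    "narr s' ''row'' = narr s ''row''" "nvar s' ''n'' = n" "nvar s' ''kk'' = 2 * k" "rvar s' ''q'' = q"
    "rvar s' ''mst'' = M"
    using 2(2) es(1) n kk q M by (simp_all add: same_def mods_one_scale edge_arrays_def)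
  have "wp one_scale (\<lambda>t' s''. outer_inv \<omega> n es K M k q T0 (Suc i) s'' t') (Suc u) s'"
    using 2(3) c T row n kk q M
    by (intro wp_one_scale[OF i T0 c(1) es(2) E]) simp_all
  then have "wp one_scale (\<lambda>t' s''. \<exists>i. outer_inv \<omega> n es K M k q T0 i s'' t') (Suc u) s'"
    by (rule wp_consequence) blast
  moreover have "u \<le> nat \<lceil>T0 + 2184 * real k * (real n)\<^sup>2 * real n powr (1 / real k) +
    (9 * real n + 14) * real n + 8 * real (length es)\<rceil>"
    using outer_inv_time[OF i] by linarith
  ultimately show ?case by blast
next
  case (3 u s')
  have "rvar s' ''mst'' = M" using 3(2) M by (simp add: same_def mods_one_scale)
  with 3(1,3) show ?case by auto
qed

text \<open>Treated edges carry their bound in the invariant. For the others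
  \<open>2 * M \<le> D \<le> 2 / q * w\<close>, so the part of the tour between their ends is short
  enough, because \<open>2 / q\<close> is at most the stretch.\<close>

lemma outer_inv_spanner:
  assumes I: "outer_inv \<omega> n es K M k q T0 i s t" and D: "2 * M \<le> rvar s ''D''"
    and T: "tour \<omega> n K nx len M" and G: "weighted_graph {..<n} E \<omega>" and es: "edge ` set es = E"
    and k: "1 \<le> k" and q: "0 < q"
  shows "spanner (stretch k (2 / q)) {..<n} E \<omega> (output_edges s)"
proof (rule spannerI[OF G])
  let ?H = "output_edges s"
  have J: "K \<subseteq> ?H" "?H \<subseteq> edge ` set es"
    "\<And>j. j < nvar s ''idx'' \<Longrightarrow> near \<omega> ?H (fst (es ! j)) (snd (es ! j)) (stretch k (2 / q) * \<omega> (edge (es ! j)))"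
    "\<And>j. nvar s ''idx'' \<le> j \<Longrightarrow> j < length es \<Longrightarrow> rvar s ''D'' \<le> 2 / q * \<omega> (edge (es ! j))"
    using I unfolding outer_inv_def by blast+
  have q0: "0 \<le> 2 / q" using q by simp
  note st = stretch_ge[OF k q0]
  show "?H \<subseteq> E" using J(2) es by simp
  show "1 \<le> stretch k (2 / q)" by (rule st)
  fix u v assume uv: "{u, v} \<in> E"
  then obtain e where e: "e \<in> set es" "{u, v} = edge e" using es by blast
  then obtain j where j: "j < length es" "es ! j = e" by (meson in_set_conv_nth)
  have w: "0 < \<omega> (edge e)" using weighted_graphD(5)[OF G] e uv by simp
  have "near \<omega> ?H (fst e) (snd e) (stretch k (2 / q) * \<omega> (edge e))"
  proof (cases "j < nvar s ''idx''")
    case True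
    from J(3)[OF True] j show ?thesis by simp
  next
    case False
    then have "rvar s ''D'' \<le> 2 / q * \<omega> (edge e)" using J(4)[of j] j by simp
    also have "\<dots> \<le> stretch k (2 / q) * \<omega> (edge e)" using st(2) w by (intro mult_right_mono) auto
    finally have le: "2 * M \<le> stretch k (2 / q) * \<omega> (edge e)" using D by simp
    have "edge e \<subseteq> {..<n}" using weighted_graphD(3)[OF G uv] e by simp
    then have "fst e < n" "snd e < n" by (auto simp: edge_def)
    from near_mono[OF tour_near[OF T this] J(1) le] show ?thesis .
  qed
  moreover have "u = fst e \<and> v = snd e \<or> u = snd e \<and> v = fst e"
    using e(2) by (auto simp: edge_def doubleton_eq_iff)
  ultimately show "near \<omega> ?H u v (stretch k (2 / q) * \<omega> {u, v})"
    using e(2) near_sym by metis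
qed

lemma outer_inv_size:
  assumes I: "outer_inv \<omega> n es K M k q T0 i s t" and n: "1 \<le> n" and k: "1 \<le> k" and q: "0 < q"
  shows "real (card (output_edges s)) \<le> 17 * (real n powr (1 + 1 / real k) * (1 + q))"
proof -
  let ?X = "real n powr (1 / real k)"
  have X1: "1 \<le> ?X" using n k by (rule root_ge_1)
  \<comment> \<open>Only an inequality: a tree edge may be recorded a second time at its
    scale.\<close>
  have "card (output_edges s) \<le> nvar s ''out_m''"
    unfolding output_edges_def using card_image_le[of "{..<nvar s ''out_m''}"] by simp
  then have "real (card (output_edges s)) \<le> real (nvar s ''out_m'')" by simp
  also have "\<dots> \<le> real n + 8 * real n * ?X * (\<Sum>j<i. (1 / 2) ^ j)"
    using I unfolding outer_inv_def by blast
  also have "\<dots> \<le> real n * ?X + 8 * real n * ?X * 2"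
  proof (rule add_mono)
    show "real n \<le> real n * ?X" using mult_left_mono[OF X1, of "real n"] by simp
    show "8 * real n * ?X * (\<Sum>j<i. (1 / 2) ^ j) \<le> 8 * real n * ?X * 2"
      using sum_half_le by (intro mult_left_mono) auto
  qed
  also have "\<dots> = 17 * (real n * ?X) * 1" by simp
  also have "\<dots> \<le> 17 * (real n * ?X) * (1 + q)" using q by (intro mult_left_mono) auto
  also have "real n * ?X = real n powr (1 + 1 / real k)" using n by (simp add: powr_add)
  finally show ?thesis by (simp add: mult.assoc)
qed

text \<open>The lower bound on \<open>q\<close> gives \<open>1 \<le> 2 * (k * X * q)\<close>, so the
  tree, of weight \<open>M\<close>, is absorbed by the claimed bound. The constant is 2 for the tree
  and 32 for the scales, namely 16 times the 2 of \<open>half_root\<close>.\<close>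

lemma outer_inv_light:
  assumes I: "outer_inv \<omega> n es K M k q T0 i s t" and n: "1 \<le> n" and k: "1 \<le> k"
    and q: "1 / (2 * real k - 1) < q" and M: "0 \<le> M" "M \<le> mst_weight V E \<omega>"
  shows "lightness V E \<omega> (output_edges s) \<le> 34 * (real k * real n powr (1 / real k) * q)"
proof -
  let ?X = "real n powr (1 / real k)" and ?r = "(1 / 2 :: real) powr (1 / real k)"
  let ?m = "mst_weight V E \<omega>"
  have X1: "1 \<le> ?X" using n k by (rule root_ge_1)
  have "1 / (2 * real k) \<le> 1 / (2 * real k - 1)" using k by (intro divide_left_mono) auto
  then have q': "1 / (2 * real k) < q" using q by linarith
  then have kq: "1 < 2 * (real k * q)" using k by (simp add: field_simps)
  have q0: "0 < q" using q' k by (meson divide_pos_pos less_trans of_nat_0_less_iff zero_less_mult_iff zero_less_numeral zero_less_one order.strict_trans2)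
  have "1 * 1 \<le> 2 * (real k * q) * ?X" using kq X1 by (intro mult_mono) auto
  then have kqX: "1 \<le> 2 * (real k * ?X * q)" by (simp add: mult_ac)
  have "total_weight \<omega> (output_edges s) \<le> M + 16 * q * M * ?X * (\<Sum>j<i. ?r ^ j)"
    using I unfolding outer_inv_def by blast
  also have "\<dots> \<le> M + 16 * q * M * ?X * (2 * real k)"
    using half_root(3)[OF k, of i] q0 M by (intro add_left_mono mult_left_mono) auto
  also have "M + 16 * q * M * ?X * (2 * real k) = M * (1 + 32 * (real k * ?X * q))"
    by (simp add: algebra_simps)
  also have "\<dots> \<le> M * (34 * (real k * ?X * q))"
    by (rule mult_left_mono[OF _ M(1)]) (use kqX in linarith)
  also have "\<dots> \<le> ?m * (34 * (real k * ?X * q))" using M q0 by (intro mult_right_mono) auto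
  finally have w: "total_weight \<omega> (output_edges s) \<le> ?m * (34 * (real k * ?X * q))" .
  show ?thesis
  proof (cases "?m = 0")
    case True
    \<comment> \<open>Here the quotient has its default value \<open>0\<close>.\<close>
    then show ?thesis using kqX by (simp add: lightness_def)
  next
    case False
    with M have "0 < ?m" by simp
    with w show ?thesis by (simp add: lightness_def divide_le_eq mult.commute)
  qed
qed

lemma total_time:
  fixes n k m p T :: nat
  defines "X \<equiv> real n powr (1 / real k)"
  assumes n: "1 \<le> n" and k: "1 \<le> k" and m: "m \<le> n * n" and p: "p = 0 \<or> 2 ^ (p - 1) < m"
    and T0: "T0 \<le> real (6 * n + 2 + (8 * m + 6 + p * (20 * m + 6)) + (8 * m + (4 * n + 12) * n + 2) + 4)"
    and T: "real T \<le> T0 + 2184 * real k * (real n)\<^sup>2 * X + (9 * real n + 14) * real n + 8 * real m + 1"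
  shows "real T \<le> 2400 * (real k * real n powr (2 + 1 / real k))"
proof -
  have X1: "1 \<le> X" unfolding X_def using n k by (rule root_ge_1)
  let ?Z = "real k * ((real n)\<^sup>2 * X)"
  have kX: "1 \<le> real k * X" using k X1 mult_mono[of 1 "real k" 1 X] by simp
  have n2: "(real n)\<^sup>2 \<le> ?Z" using mult_left_mono[OF kX, of "(real n)\<^sup>2"] by (simp add: mult_ac)
  have "real n * 1 \<le> real n * real n" using n by (intro mult_left_mono) auto
  then have "real n \<le> (real n)\<^sup>2" by (simp only: power2_eq_square mult_1_right)
  moreover have "1 \<le> real n" using n by simp
  ultimately have nn: "real n \<le> (real n)\<^sup>2" "1 \<le> (real n)\<^sup>2" by linarith+
  have mm: "real m \<le> (real n)\<^sup>2" using m by (metis of_nat_le_iff of_nat_mult power2_eq_square)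
  have pX: "real p \<le> 5 * (real k * X)" unfolding X_def by (rule log_bound[OF n k m p])
  have "20 * real m + 6 \<le> 26 * (real n)\<^sup>2" using mm nn by linarith
  with pX have "real p * (20 * real m + 6) \<le> (5 * (real k * X)) * (26 * (real n)\<^sup>2)"
    using kX by (intro mult_mono) auto
  then have ps: "real p * (20 * real m + 6) \<le> 130 * ?Z" by (simp add: mult_ac)
  have "T0 \<le> 6 * real n + 14 + 16 * real m + real p * (20 * real m + 6) + 4 * (real n)\<^sup>2 + 12 * real n"
    using T0 by (simp add: power2_eq_square algebra_simps)
  moreover have "(9 * real n + 14) * real n = 9 * (real n)\<^sup>2 + 14 * real n"
    by (simp add: power2_eq_square algebra_simps)
  moreover have "2184 * real k * (real n)\<^sup>2 * X = 2184 * ?Z" by simp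
  \<comment> \<open>The coefficients add up to 2184 for the scales, 130 for sorting and 84 for all
    lower terms, each at most a multiple of \<open>?Z\<close>.\<close>
  ultimately have "real T \<le> 2400 * ?Z" using T ps mm nn n2 by linarith
  moreover have "(real n)\<^sup>2 * X = real n powr (2 + 1 / real k)"
    unfolding X_def using n by (simp add: powr_add)
  ultimately show ?thesis by simp
qed

lemma wp_spanner_prog:
  fixes s0 :: state
  assumes G: "weighted_graph {..<n} E \<omega>" "connected_graph {..<n} E" and es: "lists_edges es E"
    and k: "1 \<le> k" and q: "1 / (2 * real k - 1) < q"
  defines "s0 \<equiv> input_state n es \<omega> k q"
  shows "wp spanner_prog (\<lambda>T s.
    spanner ((2 * real k - 1) * (1 + 2 / q) + 2 / q) {..<n} E \<omega> (output_edges s) \<and>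
    real (card (output_edges s)) \<le> 17 * (real n powr (1 + 1 / real k) * (1 + q)) \<and>
    lightness {..<n} E \<omega> (output_edges s) \<le> 34 * (real k * real n powr (1 / real k) * q) \<and>
    real T \<le> 2400 * (real k * real n powr (2 + 1 / real k))) 0 s0"
    (is "wp _ ?Q _ _")
proof -
  let ?m = "length es"
  have n: "1 \<le> n" using G(2) by (auto simp: connected_graph_def lessThan_empty_iff Suc_le_eq)
  have k': "0 < 2 * real k - 1" using k by simp
  then have q0: "0 < q" using q by (meson divide_pos_pos less_trans zero_less_one)
  have E: "edge ` set es = E" "distinct (map edge es)" using es by (auto simp: lists_edges_def)
  have m: "?m \<le> n * n"
  proof -
    have "E \<subseteq> (\<lambda>(x, y). {x, y}) ` ({..<n} \<times> {..<n})"
    proof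
      fix e assume e: "e \<in> E"
      then obtain x y where "e = {x, y}" using weighted_graphD(4)[OF G(1) e] by (meson card_2_iff)
      with weighted_graphD(3)[OF G(1) e] show "e \<in> (\<lambda>(x, y). {x, y}) ` ({..<n} \<times> {..<n})" by auto
    qed
    then have "card E \<le> card ({..<n} \<times> {..<n})" by (rule surj_card_le[rotated]) simp
    moreover have "card E = ?m" using E distinct_card[OF E(2)] by simp
    ultimately show ?thesis by simp
  qed
  show ?thesis
    unfolding spanner_prog_def wp_Seq
  proof (rule wp_consequence[OF wp_init_arrays], goal_cases)
    case 1
    show ?case by (simp add: s0_def input_state_def)
  next
    case (2 t1 s1)
    have s1: "nvar s1 ''n'' = n" "nvar s1 ''m'' = ?m" "nvar s1 ''k'' = k" "rvar s1 ''q'' = q"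
      "nvar s1 ''out_m'' = 0" "rvar s1 ''mst'' = 0" "rarr s1 ''len'' = (\<lambda>_. 0)" "t1 = 6 * n + 2"
      "narr s1 ''src'' = (\<lambda>i. if i < ?m then fst (es ! i) else 0)"
      "narr s1 ''dst'' = (\<lambda>i. if i < ?m then snd (es ! i) else 0)"
      "rarr s1 ''wgt'' = (\<lambda>i. if i < ?m then \<omega> (edge (es ! i)) else 0)"
      using 2 by (simp_all add: same_def init_arrays_def s0_def input_state_def)
    have a1: "\<And>x. x < n \<Longrightarrow> narr s1 ''comp'' x = x \<and> narr s1 ''nx'' x = x \<and> narr s1 ''row'' x = x * n"
      using 2 by (simp add: s0_def input_state_def)
    show ?case
    proof (rule wp_consequence[OF wp_sort_edges[where es = es and \<omega> = \<omega>]], goal_cases)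
      case (5 t2 s2)
      then obtain es' p where es': "mset es' = mset es" "sorted (map (\<omega> \<circ> edge) es')" "edge_arrays s2 \<omega> es'"
        and p: "p = 0 \<or> 2 ^ (p - 1) < ?m" and t2: "t2 \<le> t1 + 8 * ?m + 6 + p * (20 * ?m + 6)" by blast
      have len: "length es' = ?m" using es'(1) by (metis size_mset)
      have "mset (map edge es') = mset (map edge es)" using es'(1) by simp
      then have "distinct (map edge es')" using E(2) mset_eq_imp_distinct_iff by blast
      moreover have set: "set es' = set es" using es'(1) by (rule mset_eq_setD)
      ultimately have lists: "lists_edges es' E" using E(1) by (simp add: lists_edges_def)
      have E': "edge ` set es' = E" using E(1) set by simp
      have ev: "fst e < n \<and> snd e < n \<and> fst e \<noteq> snd e \<and> 0 < \<omega> (edge e)" if "e \<in> set es'" for e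
      proof -
        have e: "edge e \<in> E" using that E' by blast
        have "fst e \<noteq> snd e" using weighted_graphD(4)[OF G(1) e] by (auto simp: edge_def)
        with weighted_graphD(3,5)[OF G(1) e] show ?thesis by (auto simp: edge_def)
      qed
      have s2: "nvar s2 ''n'' = n" "nvar s2 ''k'' = k" "rvar s2 ''q'' = q"
        "nvar s2 ''out_m'' = 0" "rvar s2 ''mst'' = 0" "rarr s2 ''len'' = (\<lambda>_. 0)"
        "narr s2 ''comp'' = narr s1 ''comp''" "narr s2 ''nx'' = narr s1 ''nx''" "narr s2 ''row'' = narr s1 ''row''"
        using 5(2) s1 by (simp_all add: same_def sort_edges_def merge_sort_def merge_pass_def merge_runs_def
            merge_step_def set_mid_hi_def gather_def)
      have init: "kruskal_state \<omega> n {} s2"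
        using kruskal_inv_init[of n "narr s2 ''comp''" "narr s2 ''nx''" \<omega>] a1 s2
        by (simp add: output_edges_def)
      show ?case
      proof (rule wp_consequence[OF wp_kruskal_loop[OF es'(3) s2(1) ev init s2(4)]], goal_cases)
        case (2 t3 s3)
        let ?K = "kruskal {} es'" and ?M = "rvar s3 ''mst''"
        have inv: "kruskal_inv \<omega> n ?K (narr s3 ''comp'') (narr s3 ''nx'') (rarr s3 ''len'') ?M (nvar s3 ''out_m'')"
          and out: "output_edges s3 = ?K" and t3: "t3 \<le> t2 + 8 * ?m + (4 * n + 12) * n + 2"
          using 2(1) len by auto
        note tour = kruskal_inv_tour[OF inv G lists]
        have s3: "nvar s3 ''n'' = n" "nvar s3 ''k'' = k" "rvar s3 ''q'' = q" "edge_arrays s3 \<omega> es'"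
          "narr s3 ''row'' = narr s1 ''row''"
          using 2(2) s2 es'(3) by (simp_all add: same_def kruskal_loop_def splice_def relabel_def edge_arrays_def)
        have "0 \<le> (\<Sum>x<n. rarr s3 ''len'' x)"
          using tour(1) by (intro sum_nonneg) (auto simp: tour_def)
        also have "\<dots> = 2 * ?M" using tour(1) by (simp add: tour_def)
        finally have M0: "0 \<le> ?M" by simp
        have Mmst: "?M \<le> mst_weight {..<n} E \<omega>"
          using kruskal_le_mst_weight[OF G lists es'(2)] tour(3) by simp
        let ?s4 = "s3\<lparr>rvar := (rvar s3)(''thr'' := 2 * q * ?M / real n, ''D'' := 0),
          nvar := (nvar s3)(''kk'' := k + k, ''idx'' := 0)\<rparr>"
        let ?T0 = "real (t3 + 4)"
        have o4: "output_edges ?s4 = ?K" using out by (simp add: output_edges_eq)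
        have start: "outer_inv \<omega> n es' ?K ?M k q ?T0 0 ?s4 (t3 + 4)"
          unfolding outer_inv_def o4
          using tour(2-4) ev q0 E' by (auto simp: less_imp_le)
        have T0: "?T0 \<le> real (6 * n + 2 + (8 * ?m + 6 + p * (20 * ?m + 6)) + (8 * ?m + (4 * n + 12) * n + 2) + 4)"
          using t2 t3 s1(8) by (intro of_nat_mono) linarith
        have "wp scales ?Q (t3 + 4) ?s4"
        proof (rule wp_consequence[OF wp_scales[OF start]], goal_cases)
          case (15 t5 s5)
          then obtain i u where u: "outer_inv \<omega> n es' ?K ?M k q ?T0 i s5 u" "t5 = Suc u" "2 * ?M \<le> rvar s5 ''D''"
            by auto
          have "real t5 \<le> 2400 * (real k * real n powr (2 + 1 / real k))"
            by (rule total_time[OF n k m p T0]) (use outer_inv_time[OF u(1)] u(2) len in simp)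
          then show ?case
            using outer_inv_spanner[OF u(1,3) tour(1) G(1) E' k q0] outer_inv_size[OF u(1) n k q0]
              outer_inv_light[OF u(1) n k q M0 Mmst] by (simp add: stretch_def)
        qed (use s3 es'(2) ev tour(1) a1 n k q0 M0 in \<open>auto simp: edge_arrays_def\<close>)
        then show ?case by (simp add: init_consts_def s3 eval_nat_numeral)
      qed
    qed (use s1 in auto)
  qed
qed

theorem theorem3p7:
  "\<exists>(P :: com) (C\<^sub>e :: real) (C\<^sub>l :: real) (C\<^sub>t :: real).
     \<forall>(n :: nat) (E :: nat set set) (\<omega> :: nat set \<Rightarrow> real) (es :: (nat \<times> nat) list)
       (k :: nat) (q :: real).
       weighted_graph {..<n} E \<omega> \<longrightarrow> connected_graph {..<n} E \<longrightarrow> lists_edges es E \<longrightarrow>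
       1 \<le> k \<longrightarrow> 1 / (2 * real k - 1) < q \<longrightarrow> q < real k \<longrightarrow>
       (\<exists>T s. exec P (input_state n es \<omega> k q) T s \<and>
          spanner ((2 * real k - 1) * (1 + 2 / q) + 2 / q) {..<n} E \<omega> (output_edges s) \<and>
          real (card (output_edges s)) \<le> C\<^sub>e * (real n powr (1 + 1 / real k) * (1 + q)) \<and>
          lightness {..<n} E \<omega> (output_edges s) \<le> C\<^sub>l * (real k * real n powr (1 / real k) * q) \<and>
          real T \<le> C\<^sub>t * (real k * real n powr (2 + 1 / real k) * (1 + q\<^sup>2)))"
proof (rule exI[of _ spanner_prog], rule exI[of _ 17], rule exI[of _ 34], rule exI[of _ 2400], intro allI impI)
  fix n :: nat and E :: "nat set set" and \<omega> :: "nat set \<Rightarrow> real" and es :: "(nat \<times> nat) list"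
    and k :: nat and q :: real
  assume "weighted_graph {..<n} E \<omega>" "connected_graph {..<n} E" "lists_edges es E"
    "1 \<le> k" "1 / (2 * real k - 1) < q" "q < real k"
  from wp_spanner_prog[OF this(1-5)] obtain T s where run: "exec spanner_prog (input_state n es \<omega> k q) T s"
    and res: "spanner ((2 * real k - 1) * (1 + 2 / q) + 2 / q) {..<n} E \<omega> (output_edges s)"
      "real (card (output_edges s)) \<le> 17 * (real n powr (1 + 1 / real k) * (1 + q))"
      "lightness {..<n} E \<omega> (output_edges s) \<le> 34 * (real k * real n powr (1 / real k) * q)"
      "real T \<le> 2400 * (real k * real n powr (2 + 1 / real k))"
    unfolding wp_def by auto
  \<comment> \<open>The bound on the running time has no factor depending on \<open>q\<close>;
    \<open>1 + q\<^sup>2 \<ge> 1\<close> brings it to the stated form.\<close>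
  have "real k * real n powr (2 + 1 / real k) * 1 \<le> real k * real n powr (2 + 1 / real k) * (1 + q\<^sup>2)"
    by (intro mult_left_mono) auto
  with res(4) have "real T \<le> 2400 * (real k * real n powr (2 + 1 / real k) * (1 + q\<^sup>2))" by linarith
  with run res(1-3) show "\<exists>T s. exec spanner_prog (input_state n es \<omega> k q) T s \<and>
          spanner ((2 * real k - 1) * (1 + 2 / q) + 2 / q) {..<n} E \<omega> (output_edges s) \<and>
          real (card (output_edges s)) \<le> 17 * (real n powr (1 + 1 / real k) * (1 + q)) \<and>
          lightness {..<n} E \<omega> (output_edges s) \<le> 34 * (real k * real n powr (1 / real k) * q) \<and>
          real T \<le> 2400 * (real k * real n powr (2 + 1 / real k) * (1 + q\<^sup>2))"
    by blast
qed

end
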